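(* Let $L_1,L_2,h,g,\lambda>0$, $\mathbb{T}^2=(2\pi L_1\mathcal{T})\times(2\pi L_2\mathcal{T})$ with $\mathcal{T}=\mathbb{R}/\mathbb{Z}$, and $\Omega_+=\mathbb{T}^2\times(0,h)$. Let $\bar\rho\in C^2[0,h]$ (a function of $x_3$ only) satisfy $\bar\rho'(x_3^0)>0$ for some $x_3^0\in(0,h)$, and let $\bar M=(\bar M_1,\bar M_2,\bar M_3)$ be a non-zero constant vector. Define $$m_{\mathrm N}:=\sqrt{\sup_{0\neq w\in H^1_\sigma(\Omega_+)}\frac{g\int_{\Omega_+}\bar\rho'(x_3)w_3^2\,\mathrm{d}x}{\lambda\|\partial_3 w\|^2_{L^2(\Omega_+)}}}$$ and, for $\eta$ on $\Omega_+$, $$\delta^{\mathrm N}_{E_{\mathrm P}}(\eta):=\frac{\lambda}{2}\|(\bar M\cdot\nabla)\eta\|^2_{L^2(\Omega_+)}-\frac{g}{2}\int_{\Omega_+}\bar\rho'(y_3)\eta_3^2\,\mathrm{d}y-\int_{\Omega_+}\int_0^{\eta_3(y)}\mathcal{N}_{g\bar\rho'}(\tau,y_3)\,\mathrm{d}\tau\,\mathrm{d}y,$$ where $\mathcal{N}_{g\bar\rho'}(\tau,y_3):=g\int_0^\tau(\tau-z)\bar\rho''(y_3+z)\,\mathrm{d}z$. Then: (1) If $|\bar M_3|<m_{\mathrm N}$, then for any $k\geq3$ there exist $w\in C^\infty_\sigma(\Omega_+)$ and $\varepsilon_0\in(0,1)$ (depending on $w$ and $k$) such that for every $\varepsilon\in(0,\varepsilon_0)$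 there is a function $\varpi_{\varepsilon,\mathrm r}$ with $\|\varpi_{\varepsilon,\mathrm r}\|_{H^k(\Omega_+)}\leq c$, where $c>0$ depends only on $k$, $\|w\|_{H^k(\Omega_+)}$ and $\Omega_+$ (not on $\varepsilon$), such that $\varpi:=\varepsilon w+\varepsilon^2\varpi_{\varepsilon,\mathrm r}\in H^{k,1}_{0,*}(\Omega_+)$ and $\delta^{\mathrm N}_{E_{\mathrm P}}(\varpi)<0$. (2) If $|\bar M_3|>m_{\mathrm N}$, then there is a constant $\varepsilon>0$ such that for every non-zero $\varpi\in H^1_0(\Omega_+)$ with $\|\varpi\|_{L^\infty(\Omega_+)}\leq\varepsilon$ one has $\delta^{\mathrm N}_{E_{\mathrm P}}(\varpi)>0$.
   Context: Functions on $\Omega_+=\mathbb{T}^2\times(0,h)$ are horizontally periodic (periods $2\pi L_1$ in $x_1$, $2\pi L_2$ in $x_2$) and all norms and integrals over $\Omega_+$ are taken over one periodic cell $(0,2\pi L_1)\times(0,2\pi L_2)\times(0,h)$; the boundary of $\Omega_+$ is $\{x_3=0\}\cup\{x_3=h\}$. $H^1_\sigma(\Omega_+)=\{\eta\in H^1(\Omega_+):\operatorname{div}\eta=0,\ \eta=0\text{ on }\partial\Omega_+\text{ in the trace sense}\}$. $C^\infty_\sigma(\Omega_+)$ is the set of smooth divergence-free (horizontally periodic) vector fields $w$ on $\Omega_+$ vanishing on $\mathbb{T}^2\times((0,h)\setminus(c,d))$ for some $0<c<d<h$. For $k\geq2$, $H^{k,1}_{0,*}(\Omega_+)$ is the set of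 $\varpi\in H^1_0(\Omega_+)\cap H^k(\Omega_+)$ such that $y\mapsto\varpi(y)+y$ is a homeomorphism of $\overline{\mathbb{R}^2\times(0,h)}$ onto itself (with $\varpi$ extended periodically) and $\det(\nabla(\varpi(y)+y))=1$. In $\mathcal{N}_{g\bar\rho'}$, $\bar\rho''$ is evaluated at $y_3+z$ for $z$ between $0$ and $\eta_3(y)$.
   Formalization: The density profile is assumed twice continuously differentiable on all of ℝ rather than only on [0,h], since in part (2) its second derivative is evaluated at y_3+z, which may lie outside [0,h]; any C^2 extension may be used. *)

theory Defs
  imports "HOL-Analysis.Analysis"
begin

text \<open>Points of R^3 are vectors of type real^3; directions are indices of type 3.
  Functions on Omega_+ are represented by horizontally periodic functions on R^3;
  only their values on the strip R^2 x (0,h) matter, and all norms/integrals are over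
  one periodic cell.\<close>

definition cell :: "real \<Rightarrow> real \<Rightarrow> real \<Rightarrow> (real^3) set" where
  "cell L1 L2 h = {x. 0 < x$1 \<and> x$1 < 2*pi*L1 \<and> 0 < x$2 \<and> x$2 < 2*pi*L2 \<and> 0 < x$3 \<and> x$3 < h}"

definition strip :: "real \<Rightarrow> (real^3) set" where
  "strip h = {x. 0 < x$3 \<and> x$3 < h}"

definition cstrip :: "real \<Rightarrow> (real^3) set" where
  "cstrip h = {x. 0 \<le> x$3 \<and> x$3 \<le> h}"

definition periodic :: "real \<Rightarrow> real \<Rightarrow> (real^3 \<Rightarrow> 'b) \<Rightarrow> bool" where
  "periodic L1 L2 f \<longleftrightarrow>
     (\<forall>x. f (x + (2*pi*L1) *\<^sub>R axis 1 1) = f x \<and> f (x + (2*pi*L2) *\<^sub>R axis 2 1) = f x)"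

definition pd :: "3 \<Rightarrow> (real^3 \<Rightarrow> real) \<Rightarrow> real^3 \<Rightarrow> real" where
  "pd i f x = deriv (\<lambda>t. f (x + t *\<^sub>R axis i 1)) 0"

fun Ck :: "nat \<Rightarrow> (real^3 \<Rightarrow> real) \<Rightarrow> bool" where
  "Ck 0 f = continuous_on UNIV f"
| "Ck (Suc k) f = ((\<forall>x. f differentiable at x) \<and> (\<forall>i. Ck k (pd i f)))"

definition smooth :: "(real^3 \<Rightarrow> real) \<Rightarrow> bool" where
  "smooth f \<longleftrightarrow> (\<forall>k. Ck k f)"

definition test_fun :: "real \<Rightarrow> (real^3 \<Rightarrow> real) \<Rightarrow> bool" where
  "test_fun h \<phi> \<longleftrightarrow> smooth \<phi> \<and> (\<exists>K. compact K \<and> K \<subseteq> strip h \<and> (\<forall>x. x \<notin> K \<longrightarrow> \<phi> x = 0))"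

definition loc_int :: "real \<Rightarrow> (real^3 \<Rightarrow> real) \<Rightarrow> bool" where
  "loc_int h f \<longleftrightarrow> (\<forall>K. compact K \<and> K \<subseteq> strip h \<longrightarrow> set_integrable lborel K f)"

definition weak_pd :: "real \<Rightarrow> (real^3 \<Rightarrow> real) \<Rightarrow> 3 \<Rightarrow> (real^3 \<Rightarrow> real) \<Rightarrow> bool" where
  "weak_pd h f i g \<longleftrightarrow> loc_int h f \<and> loc_int h g \<and>
     (\<forall>\<phi>. test_fun h \<phi> \<longrightarrow>
        (LINT x:strip h|lborel. f x * pd i \<phi> x) = - (LINT x:strip h|lborel. g x * \<phi> x))"

definition wpd :: "real \<Rightarrow> (real^3 \<Rightarrow> real) \<Rightarrow> 3 \<Rightarrow> real^3 \<Rightarrow> real" where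
  "wpd h f i = (SOME g. weak_pd h f i g)"

text \<open>D alpha is the weak derivative along the list of directions alpha (applied right to left),
  all of order at most k, each in L^2 of the cell.\<close>
definition hk_family :: "real \<Rightarrow> real \<Rightarrow> real \<Rightarrow> nat \<Rightarrow> (real^3 \<Rightarrow> real) \<Rightarrow> (3 list \<Rightarrow> real^3 \<Rightarrow> real) \<Rightarrow> bool" where
  "hk_family L1 L2 h k f D \<longleftrightarrow> D [] = f \<and>
     (\<forall>\<alpha>. length \<alpha> \<le> k \<longrightarrow> D \<alpha> \<in> borel_measurable lborel \<and>
          set_integrable lborel (cell L1 L2 h) (\<lambda>x. (D \<alpha> x)\<^sup>2) \<and> loc_int h (D \<alpha>)) \<and>
     (\<forall>\<alpha> i. length \<alpha> < k \<longrightarrow> weak_pd h (D \<alpha>) i (D (i # \<alpha>)))"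

definition Hk :: "real \<Rightarrow> real \<Rightarrow> real \<Rightarrow> nat \<Rightarrow> (real^3 \<Rightarrow> real) \<Rightarrow> bool" where
  "Hk L1 L2 h k f \<longleftrightarrow> periodic L1 L2 f \<and> (\<exists>D. hk_family L1 L2 h k f D)"

definition Hk_sqnorm :: "real \<Rightarrow> real \<Rightarrow> real \<Rightarrow> nat \<Rightarrow> (real^3 \<Rightarrow> real) \<Rightarrow> real" where
  "Hk_sqnorm L1 L2 h k f =
     (\<Sum>\<alpha>\<in>{\<alpha>::3 list. length \<alpha> \<le> k}.
        LINT x:cell L1 L2 h|lborel. ((SOME D. hk_family L1 L2 h k f D) \<alpha> x)\<^sup>2)"

definition Hk_vec :: "real \<Rightarrow> real \<Rightarrow> real \<Rightarrow> nat \<Rightarrow> (real^3 \<Rightarrow> real^3) \<Rightarrow> bool" where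
  "Hk_vec L1 L2 h k f \<longleftrightarrow> (\<forall>j. Hk L1 L2 h k (\<lambda>x. f x $ j))"

definition Hk_norm :: "real \<Rightarrow> real \<Rightarrow> real \<Rightarrow> nat \<Rightarrow> (real^3 \<Rightarrow> real^3) \<Rightarrow> real" where
  "Hk_norm L1 L2 h k f = sqrt (\<Sum>j\<in>UNIV. Hk_sqnorm L1 L2 h k (\<lambda>x. f x $ j))"

definition test_per :: "real \<Rightarrow> real \<Rightarrow> real \<Rightarrow> (real^3 \<Rightarrow> real) \<Rightarrow> bool" where
  "test_per L1 L2 h \<phi> \<longleftrightarrow> smooth \<phi> \<and> periodic L1 L2 \<phi> \<and>
     (\<exists>c d. 0 < c \<and> c < d \<and> d < h \<and> (\<forall>x \<in> strip h. x$3 \<notin> {c<..<d} \<longrightarrow> \<phi> x = 0))"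

definition H10 :: "real \<Rightarrow> real \<Rightarrow> real \<Rightarrow> (real^3 \<Rightarrow> real) \<Rightarrow> bool" where
  "H10 L1 L2 h f \<longleftrightarrow> Hk L1 L2 h 1 f \<and>
     (\<exists>\<phi>::nat \<Rightarrow> real^3 \<Rightarrow> real. (\<forall>n. test_per L1 L2 h (\<phi> n)) \<and>
        (\<lambda>n. Hk_sqnorm L1 L2 h 1 (\<lambda>x. f x - \<phi> n x)) \<longlonglongrightarrow> 0)"

definition H10_vec :: "real \<Rightarrow> real \<Rightarrow> real \<Rightarrow> (real^3 \<Rightarrow> real^3) \<Rightarrow> bool" where
  "H10_vec L1 L2 h f \<longleftrightarrow> (\<forall>j. H10 L1 L2 h (\<lambda>x. f x $ j))"

definition nontrivial :: "real \<Rightarrow> real \<Rightarrow> real \<Rightarrow> (real^3 \<Rightarrow> real^3) \<Rightarrow> bool" where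
  "nontrivial L1 L2 h f \<longleftrightarrow> \<not> (AE x in lborel. x \<in> cell L1 L2 h \<longrightarrow> f x = 0)"

definition H1sigma :: "real \<Rightarrow> real \<Rightarrow> real \<Rightarrow> (real^3 \<Rightarrow> real^3) \<Rightarrow> bool" where
  "H1sigma L1 L2 h w \<longleftrightarrow> H10_vec L1 L2 h w \<and>
     (AE x in lborel. x \<in> strip h \<longrightarrow> (\<Sum>j\<in>UNIV. wpd h (\<lambda>y. w y $ j) j x) = 0)"

definition Csigma :: "real \<Rightarrow> real \<Rightarrow> real \<Rightarrow> (real^3 \<Rightarrow> real^3) \<Rightarrow> bool" where
  "Csigma L1 L2 h w \<longleftrightarrow>
     (\<forall>j. smooth (\<lambda>x. w x $ j)) \<and> periodic L1 L2 w \<and>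
     (\<forall>x \<in> strip h. (\<Sum>j\<in>UNIV. pd j (\<lambda>y. w y $ j) x) = 0) \<and>
     (\<exists>c d. 0 < c \<and> c < d \<and> d < h \<and> (\<forall>x \<in> strip h. x$3 \<notin> {c<..<d} \<longrightarrow> w x = 0))"

definition Hk1_0star :: "real \<Rightarrow> real \<Rightarrow> real \<Rightarrow> nat \<Rightarrow> (real^3 \<Rightarrow> real^3) \<Rightarrow> bool" where
  "Hk1_0star L1 L2 h k vp \<longleftrightarrow> H10_vec L1 L2 h vp \<and> Hk_vec L1 L2 h k vp \<and>
     (\<exists>g. homeomorphism (cstrip h) (cstrip h) (\<lambda>y. vp y + y) g) \<and>
     (AE x in lborel. x \<in> strip h \<longrightarrow>
        det (\<chi> i j. (if i = j then 1 else 0) + wpd h (\<lambda>y. vp y $ i) j x) = (1::real))"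

definition mN :: "real \<Rightarrow> real \<Rightarrow> real \<Rightarrow> real \<Rightarrow> real \<Rightarrow> (real \<Rightarrow> real) \<Rightarrow> real" where
  "mN L1 L2 h g lam \<rho> = sqrt (Sup
     {g * (LINT x:cell L1 L2 h|lborel. deriv \<rho> (x$3) * (w x $ 3)\<^sup>2) /
        (lam * (\<Sum>j\<in>UNIV. LINT x:cell L1 L2 h|lborel. (wpd h (\<lambda>y. w y $ j) 3 x)\<^sup>2)) | w.
      H1sigma L1 L2 h w \<and> nontrivial L1 L2 h w})"

definition NN :: "real \<Rightarrow> (real \<Rightarrow> real) \<Rightarrow> real \<Rightarrow> real \<Rightarrow> real" where
  "NN g \<rho> \<tau> s = g * (LBINT z = ereal 0..ereal \<tau>. (\<tau> - z) * deriv (deriv \<rho>) (s + z))"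

definition deltaN :: "real \<Rightarrow> real \<Rightarrow> real \<Rightarrow> real \<Rightarrow> real \<Rightarrow> (real \<Rightarrow> real) \<Rightarrow> real^3 \<Rightarrow> (real^3 \<Rightarrow> real^3) \<Rightarrow> real" where
  "deltaN L1 L2 h g lam \<rho> M \<eta> =
     lam / 2 * (\<Sum>j\<in>UNIV. LINT y:cell L1 L2 h|lborel. (\<Sum>i\<in>UNIV. M$i * wpd h (\<lambda>z. \<eta> z $ j) i y)\<^sup>2)
     - g / 2 * (LINT y:cell L1 L2 h|lborel. deriv \<rho> (y$3) * (\<eta> y $ 3)\<^sup>2)
     - (LINT y:cell L1 L2 h|lborel. (LBINT \<tau> = ereal 0..ereal (\<eta> y $ 3). NN g \<rho> \<tau> (y$3)))"

end

theory Submission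
  imports Defs
begin

text \<open>Restricting a function to the lines parallel to \<open>M\<close> and integrating over the
  horizontal cell reduces both parts to the one-dimensional quotient
  \<open>g \<integral> \<rho>' \<psi>\<^sup>2 / (\<lambda> \<integral> \<psi>'\<^sup>2)\<close> for \<open>\<psi>\<close> smooth with compact support in \<open>(0,h)\<close>.
  Its supremum is \<open>m\<^sub>N\<^sup>2\<close>: the divergence-free fields
  \<open>w = (\<xi>/|\<xi>|\<^sup>2 \<psi>'(x\<^sub>3) sin(\<xi>\<cdot>x), -\<psi>(x\<^sub>3) cos(\<xi>\<cdot>x))\<close> with horizontal frequency \<open>\<xi>\<close> realise it
  as \<open>|\<xi>|\<close> tends to infinity.

  If \<open>|M\<^sub>3| > m\<^sub>N\<close>, the quadratic part of the energy is coercive by the one-dimensional inequality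
  along the lines, and the cubic remainder is absorbed for small \<open>L\<^sup>\<infinity>\<close> norm.

  If \<open>|M\<^sub>3| < m\<^sub>N\<close>, Dirichlet's approximation theorem gives large \<open>\<xi>\<close> with \<open>M\<cdot>\<xi>\<close> small, so the
  quadratic part is negative at \<open>w\<close>. The volume-preserving map near \<open>y + \<epsilon> w(y)\<close> is a symplectic
  Euler step: solve \<open>Z + \<epsilon> \<psi>(Z) cos(\<xi>\<cdot>x) = x\<^sub>3\<close> and move \<open>x\<close> horizontally by
  \<open>\<epsilon> \<xi>/|\<xi>|\<^sup>2 \<psi>'(Z) sin(\<xi>\<cdot>x)\<close>. Replacing \<open>w\<close> by \<open>a w\<close> replaces the second-order corrector by \<open>a\<^sup>2\<close> times
  a uniformly bounded one, so a small \<open>a\<close> makes its norm at most 1 and the constant can be 1.\<close>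

section \<open>Partial derivatives\<close>

text \<open>A divergence-free displacement need not preserve volume, and the determinant has to be
  exactly 1, so the corrector must come from an exact map. In the phase s = \<xi>\<cdot>x and the
  height z = x_3 the field w is the Hamiltonian field of \<psi>(z) sin s, and the generating
  function sZ + \<epsilon> \<psi>(Z) sin s gives an area-preserving map in closed form up to the
  implicit Z. All its derivatives must stay bounded as \<epsilon> tends to 0; hence the algebras of
  uniformly bounded generators.

  High frequency makes the horizontal components of w, of size 1/|\<xi>|, negligible, so that
  incompressibility leaves no trace in the critical number. It also inflates the derivative along
  the horizontal part of M. If M_1/L_1 and M_2/L_2 have an irrational ratio, no admissible \<xi> is
  orthogonal to M, and only approximate orthogonality remains.

  A Sobolev class has no values on a single line, so the inequality along lines is proved for smooth
  functions and carried over by density. As weak derivatives are fixed by choice, their uniqueness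
  almost everywhere comes first.\<close>

lemma pd_eq_derivative:
  assumes "(f has_derivative f') (at x)"
  shows "pd i f x = f' (axis i 1)"
proof -
  have *: "((\<lambda>t::real. x + t *\<^sub>R axis i 1) has_derivative (\<lambda>t. t *\<^sub>R axis i 1)) (at 0)"
    by (auto intro!: derivative_eq_intros)
  have "((\<lambda>t. f (x + t *\<^sub>R axis i 1)) has_derivative (\<lambda>t. f' (t *\<^sub>R axis i 1))) (at 0)"
    using has_derivative_compose[OF *, of f f'] assms by simp
  moreover have "(\<lambda>t. f' (t *\<^sub>R axis i 1)) = (*) (f' (axis i 1))"
    using has_derivative_linear[OF assms] by (auto simp: linear_scale)
  ultimately have "((\<lambda>t. f (x + t *\<^sub>R axis i 1)) has_real_derivative f' (axis i 1)) (at 0)"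
    by (simp add: has_field_derivative_def)
  then show ?thesis
    by (simp add: pd_def DERIV_imp_deriv)
qed

lemma has_derivative_pd:
  fixes f :: "real^3 \<Rightarrow> real"
  assumes "f differentiable at x"
  shows "(f has_derivative (\<lambda>v. \<Sum>i\<in>UNIV. v$i * pd i f x)) (at x)"
proof -
  from assms obtain f' where f': "(f has_derivative f') (at x)"
    by (auto simp: differentiable_def)
  have "f' = (\<lambda>v. \<Sum>i\<in>UNIV. v$i * pd i f x)"
  proof
    fix v
    have "f' v = f' (\<Sum>i\<in>UNIV. v$i *\<^sub>R axis i 1)"
      using basis_expansion[of v] by (simp add: scalar_mult_eq_scaleR)
    also have "\<dots> = (\<Sum>i\<in>UNIV. v$i * f' (axis i 1))"
      using has_derivative_linear[OF f'] by (simp add: linear_sum linear_scale)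
    finally show "f' v = (\<Sum>i\<in>UNIV. v$i * pd i f x)"
      by (simp add: pd_eq_derivative[OF f'])
  qed
  with f' show ?thesis by simp
qed

lemma line_derivative:
  fixes f :: "real^3 \<Rightarrow> real"
  assumes "\<And>x. f differentiable at x"
  shows "((\<lambda>t. f (x + t *\<^sub>R v)) has_real_derivative (\<Sum>i\<in>UNIV. v$i * pd i f (x + t *\<^sub>R v))) (at t)"
proof -
  have *: "((\<lambda>t::real. x + t *\<^sub>R v) has_derivative (\<lambda>t. t *\<^sub>R v)) (at t)"
    by (auto intro!: derivative_eq_intros)
  have "((\<lambda>t. f (x + t *\<^sub>R v)) has_derivative
      (\<lambda>s. \<Sum>i\<in>UNIV. (s *\<^sub>R v)$i * pd i f (x + t *\<^sub>R v))) (at t)"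
    by (rule has_derivative_compose[OF * has_derivative_pd[OF assms]])
  moreover have "(\<lambda>s. \<Sum>i\<in>UNIV. (s *\<^sub>R v)$i * pd i f (x + t *\<^sub>R v))
      = (*) (\<Sum>i\<in>UNIV. v$i * pd i f (x + t *\<^sub>R v))"
    by (auto simp: sum_distrib_left mult_ac)
  ultimately show ?thesis by (simp add: has_field_derivative_def)
qed

lemma line_derivative_axis:
  fixes f :: "real^3 \<Rightarrow> real"
  assumes "\<And>x. f differentiable at x"
  shows "((\<lambda>t. f (x + t *\<^sub>R axis i 1)) has_real_derivative pd i f (x + t *\<^sub>R axis i 1)) (at t)"
  using line_derivative[OF assms, of x "axis i 1" t] by (simp add: axis_def if_distrib[of "\<lambda>z. z * _"] cong: if_cong)

lemma pd_const [simp]: "pd i (\<lambda>x. c) = (\<lambda>x. 0)"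
  by (auto simp: pd_def)

lemma pd_add:
  fixes f g :: "real^3 \<Rightarrow> real"
  assumes "f differentiable at x" "g differentiable at x"
  shows "pd i (\<lambda>x. f x + g x) x = pd i f x + pd i g x"
  using has_derivative_add[OF has_derivative_pd[OF assms(1)] has_derivative_pd[OF assms(2)]]
  by (subst pd_eq_derivative, assumption) (simp add: axis_def if_distrib[of "\<lambda>z. z * _"] cong: if_cong)

lemma pd_mult:
  fixes f g :: "real^3 \<Rightarrow> real"
  assumes "f differentiable at x" "g differentiable at x"
  shows "pd i (\<lambda>x. f x * g x) x = f x * pd i g x + pd i f x * g x"
  using has_derivative_mult[OF has_derivative_pd[OF assms(1)] has_derivative_pd[OF assms(2)]]
  by (subst pd_eq_derivative, assumption) (simp add: axis_def if_distrib[of "\<lambda>z. z * _"] cong: if_cong)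

lemma pd_cmult:
  fixes f :: "real^3 \<Rightarrow> real"
  assumes "f differentiable at x"
  shows "pd i (\<lambda>x. c * f x) x = c * pd i f x"
  using pd_mult[of "\<lambda>x. c" x f i] assms by simp

lemma has_derivative_compose_real:
  fixes f :: "real^3 \<Rightarrow> real"
  assumes "f differentiable at x" "(\<psi> has_real_derivative d) (at (f x))"
  shows "((\<lambda>x. \<psi> (f x)) has_derivative (\<lambda>v. d * (\<Sum>i\<in>UNIV. v$i * pd i f x))) (at x)"
  using has_derivative_compose[OF has_derivative_pd[OF assms(1)], of \<psi> "(*) d"] assms(2)
  by (simp add: has_field_derivative_def)

lemma differentiable_compose_real:
  fixes f :: "real^3 \<Rightarrow> real"
  assumes "f differentiable at x" "(\<psi> has_real_derivative d) (at (f x))"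
  shows "(\<lambda>x. \<psi> (f x)) differentiable at x"
  using has_derivative_compose_real[OF assms] by (auto simp: differentiable_def)

lemma pd_compose:
  fixes f :: "real^3 \<Rightarrow> real"
  assumes "f differentiable at x" "(\<psi> has_real_derivative d) (at (f x))"
  shows "pd i (\<lambda>x. \<psi> (f x)) x = d * pd i f x"
  using pd_eq_derivative[OF has_derivative_compose_real[OF assms]]
  by (simp add: axis_def if_distrib[of "\<lambda>z. z * _"] cong: if_cong)

lemma differentiable_coord: "(\<lambda>x::real^3. x $ i) differentiable at x"
  by (auto simp: differentiable_def intro!: exI bounded_linear_imp_has_derivative bounded_linear_vec_nth)

lemma pd_coord: "pd i (\<lambda>x. x $ j) x = (if i = j then 1 else 0)"
  by (subst pd_eq_derivative[OF bounded_linear_imp_has_derivative[OF bounded_linear_vec_nth]])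
    (simp add: axis_def)

lemma differentiable_inner_left: "(\<lambda>x::real^3. a \<bullet> x) differentiable at x"
  by (auto simp: differentiable_def intro!: exI bounded_linear_imp_has_derivative bounded_linear_inner_right)

lemma pd_inner: "pd i (\<lambda>x. a \<bullet> x) x = a $ i"
  by (subst pd_eq_derivative[OF bounded_linear_imp_has_derivative[OF bounded_linear_inner_right]])
    (simp add: inner_axis)

lemma pd_cong_open:
  fixes f g :: "real^3 \<Rightarrow> real"
  assumes "open U" "x \<in> U" "\<And>y. y \<in> U \<Longrightarrow> f y = g y"
  shows "pd i f x = pd i g x"
proof -
  have *: "((\<lambda>t::real. x + t *\<^sub>R axis i 1) \<longlongrightarrow> x + 0 *\<^sub>R axis i 1) (nhds 0)"
    by (intro tendsto_intros filterlim_ident)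
  have "eventually (\<lambda>y. y \<in> U) (nhds (x + 0 *\<^sub>R axis i 1))"
    using assms by (simp add: eventually_nhds_in_open)
  from filterlim_iff[THEN iffD1, OF *, rule_format, OF this]
  have "eventually (\<lambda>t. f (x + t *\<^sub>R axis i 1) = g (x + t *\<^sub>R axis i 1)) (nhds 0)"
    by (rule eventually_mono) (auto simp: assms)
  then show ?thesis
    unfolding pd_def by (rule deriv_cong_ev) simp
qed

lemma smooth_differentiable: "smooth f \<Longrightarrow> f differentiable at x"
  unfolding smooth_def by (metis Ck.simps(2))

lemma smooth_pd: "smooth f \<Longrightarrow> smooth (pd i f)"
  unfolding smooth_def by (metis Ck.simps(2))

lemma smooth_continuous: "smooth f \<Longrightarrow> continuous_on A f"
  unfolding smooth_def by (metis Ck.simps(1) continuous_on_subset subset_UNIV)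

lemma Ck_add: "Ck k f \<Longrightarrow> Ck k g \<Longrightarrow> Ck k (\<lambda>x. f x + g x)"
proof (induction k arbitrary: f g)
  case 0 then show ?case by (auto intro: continuous_intros)
next
  case (Suc k)
  then have "pd i (\<lambda>x. f x + g x) = (\<lambda>x. pd i f x + pd i g x)" for i
    by (auto simp: pd_add)
  with Suc show ?case by auto
qed

lemma Ck_cmult: "Ck k f \<Longrightarrow> Ck k (\<lambda>x. c * f x)"
proof (induction k arbitrary: f)
  case 0 then show ?case by (auto intro: continuous_intros)
next
  case (Suc k)
  then have "pd i (\<lambda>x. c * f x) = (\<lambda>x. c * pd i f x)" for i
    by (auto simp: pd_cmult)
  with Suc show ?case by auto
qed

lemma Ck_const: "Ck k (\<lambda>x. c)"
  by (induction k arbitrary: c) auto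

lemma smooth_sum_cmult: "(\<And>j. j \<in> A \<Longrightarrow> smooth (f j)) \<Longrightarrow> smooth (\<lambda>x. \<Sum>j\<in>A. c j * f j x)"
  unfolding smooth_def
  by (induction A rule: infinite_finite_induct) (auto intro!: Ck_add Ck_cmult Ck_const)

text \<open>The head of the list is applied last, in the order of \<open>hk_family\<close>, so
  \<open>\<lambda>\<alpha>. pds \<alpha> f\<close> is directly a family of weak derivatives of a
  smooth \<open>f\<close>.\<close>

fun pds :: "3 list \<Rightarrow> (real^3 \<Rightarrow> real) \<Rightarrow> real^3 \<Rightarrow> real" where
  "pds [] f = f"
| "pds (i # \<alpha>) f = pd i (pds \<alpha> f)"

lemma smooth_pds: "smooth f \<Longrightarrow> smooth (pds \<alpha> f)"
  by (induction \<alpha>) (auto intro: smooth_pd)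

text \<open>The algebra generated by \<open>S\<close> over the coefficients bounded on the parameter set \<open>I\<close>. If the
  generators are bounded and their partial derivatives stay in the algebra, then every member is
  smooth with all derivatives bounded uniformly in the parameter.\<close>

inductive_set alg :: "'p set \<Rightarrow> ('p \<Rightarrow> real^3 \<Rightarrow> real) set \<Rightarrow> ('p \<Rightarrow> real^3 \<Rightarrow> real) set"
  for I S where
  gen: "F \<in> S \<Longrightarrow> F \<in> alg I S"
| const: "(\<forall>p\<in>I. \<bar>c p\<bar> \<le> B) \<Longrightarrow> (\<lambda>p x. c p) \<in> alg I S"
| add: "F \<in> alg I S \<Longrightarrow> G \<in> alg I S \<Longrightarrow> (\<lambda>p x. F p x + G p x) \<in> alg I S"
| mult: "F \<in> alg I S \<Longrightarrow> G \<in> alg I S \<Longrightarrow> (\<lambda>p x. F p x * G p x) \<in> alg I S"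
| cong: "F \<in> alg I S \<Longrightarrow> (\<forall>p\<in>I. G p = F p) \<Longrightarrow> G \<in> alg I S"

lemma alg_const: "(\<lambda>p x. c) \<in> alg I S"
  by (rule alg.const[where B="\<bar>c\<bar>"]) auto

lemma alg_uminus: "F \<in> alg I S \<Longrightarrow> (\<lambda>p x. - F p x) \<in> alg I S"
  using alg.mult[OF alg_const[of "-1"], of F] by simp

lemma alg_diff: "F \<in> alg I S \<Longrightarrow> G \<in> alg I S \<Longrightarrow> (\<lambda>p x. F p x - G p x) \<in> alg I S"
  using alg.add[OF _ alg_uminus, of F I S G] by simp

lemma alg_prod:
  assumes "\<And>i. i \<in> A \<Longrightarrow> F i \<in> alg I S"
  shows "(\<lambda>p x. \<Prod>i\<in>A. F i p x) \<in> alg I S"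
  using assms by (induction A rule: infinite_finite_induct) (auto intro: alg_const alg.mult)

definition pd_closed :: "'p set \<Rightarrow> ('p \<Rightarrow> real^3 \<Rightarrow> real) set \<Rightarrow> bool" where
  "pd_closed I S \<longleftrightarrow> (\<forall>F\<in>S. (\<exists>B. \<forall>p\<in>I. \<forall>x. \<bar>F p x\<bar> \<le> B) \<and>
     (\<forall>p\<in>I. \<forall>x. F p differentiable at x) \<and> (\<forall>i. (\<lambda>p. pd i (F p)) \<in> alg I S))"

lemma alg_bounded:
  assumes "pd_closed I S" "F \<in> alg I S"
  shows "\<exists>B. \<forall>p\<in>I. \<forall>x. \<bar>F p x\<bar> \<le> B"
  using assms(2)
proof induction
  case (gen F) then show ?case using assms(1) by (auto simp: pd_closed_def)
next
  case (const c B) then show ?case by auto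
next
  case (add F G)
  then obtain B C where "\<forall>p\<in>I. \<forall>x. \<bar>F p x\<bar> \<le> B" "\<forall>p\<in>I. \<forall>x. \<bar>G p x\<bar> \<le> C" by auto
  then have "\<forall>p\<in>I. \<forall>x. \<bar>F p x + G p x\<bar> \<le> B + C"
    by (metis abs_triangle_ineq add_mono order_trans)
  then show ?case by blast
next
  case (mult F G)
  then obtain B C where *: "\<forall>p\<in>I. \<forall>x. \<bar>F p x\<bar> \<le> B" "\<forall>p\<in>I. \<forall>x. \<bar>G p x\<bar> \<le> C" by auto
  have "\<bar>F p x * G p x\<bar> \<le> B * C" if "p \<in> I" for p x
    unfolding abs_mult using * that by (intro mult_mono) (auto intro: order_trans[OF abs_ge_zero])
  then show ?case by blast
qed auto

lemma alg_differentiable: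
  assumes "pd_closed I S" "F \<in> alg I S" "p \<in> I"
  shows "F p differentiable at x"
  using assms(2)
  by induction (use assms(1,3) in \<open>auto simp: pd_closed_def\<close>)

text \<open>The sum and product rules require differentiability, which is known only for parameters
  in \<open>I\<close>; the closure rule \<open>alg.cong\<close> absorbs whatever happens for other
  parameters.\<close>

lemma alg_pd:
  assumes "pd_closed I S" "F \<in> alg I S"
  shows "(\<lambda>p. pd i (F p)) \<in> alg I S"
  using assms(2)
proof induction
  case (gen F) then show ?case using assms(1) by (auto simp: pd_closed_def)
next
  case (const c B) then show ?case by (auto intro: alg_const)
next
  case (add F G)
  show ?case
    by (rule alg.cong[OF alg.add[OF add.IH]])
      (auto simp: pd_add alg_differentiable[OF assms(1)] add.hyps)
next
  case (mult F G)
  show ?case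
    by (rule alg.cong[OF alg.add[OF alg.mult[OF mult.hyps(1) mult.IH(2)] alg.mult[OF mult.IH(1) mult.hyps(2)]]])
      (auto simp: pd_mult alg_differentiable[OF assms(1)] mult.hyps)
next
  case (cong F G)
  show ?case by (rule alg.cong[OF cong.IH]) (use cong.hyps in auto)
qed

lemma alg_pds:
  assumes "pd_closed I S" "F \<in> alg I S"
  shows "(\<lambda>p. pds \<alpha> (F p)) \<in> alg I S"
  by (induction \<alpha>) (auto intro: assms alg_pd)

lemma alg_smooth:
  assumes "pd_closed I S" "F \<in> alg I S" "p \<in> I"
  shows "smooth (F p)"
proof -
  have "Ck k (F p)" for k
    using assms(2)
  proof (induction k arbitrary: F)
    case 0
    then show ?case
      using alg_differentiable[OF assms(1) 0 assms(3)]
      by (auto intro!: continuous_at_imp_continuous_on differentiable_imp_continuous_within)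
  next
    case (Suc k)
    then show ?case
      using alg_differentiable[OF assms(1) Suc.prems assms(3)] Suc.IH[OF alg_pd[OF assms(1) Suc.prems]]
      by auto
  qed
  then show ?thesis by (simp add: smooth_def)
qed

lemma alg_pds_bounded:
  assumes "pd_closed I S" "F \<in> alg I S"
  shows "\<exists>B. \<forall>p\<in>I. \<forall>\<alpha>. length \<alpha> \<le> k \<longrightarrow> (\<forall>x. \<bar>pds \<alpha> (F p) x\<bar> \<le> B)"
proof -
  have "\<forall>\<alpha>. \<exists>B. \<forall>p\<in>I. \<forall>x. \<bar>pds \<alpha> (F p) x\<bar> \<le> B"
    using alg_bounded[OF assms(1) alg_pds[OF assms]] by blast
  then obtain B where B: "\<And>\<alpha> p x. p \<in> I \<Longrightarrow> \<bar>pds \<alpha> (F p) x\<bar> \<le> B \<alpha>" by metis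
  have fin: "finite {\<alpha>::3 list. length \<alpha> \<le> k}"
    using finite_lists_length_le[of "UNIV :: 3 set" k] by simp
  have "\<bar>pds \<alpha> (F p) x\<bar> \<le> Max (B ` {\<alpha>. length \<alpha> \<le> k})" if "p \<in> I" "length \<alpha> \<le> k" for p \<alpha> x
    using B[OF that(1), of \<alpha> x] Max_ge[of "B ` {\<alpha>. length \<alpha> \<le> k}" "B \<alpha>"] fin that
    by (auto intro: order_trans)
  then show ?thesis by blast
qed

section \<open>Bump functions and the fundamental lemma\<close>

text \<open>With \<open>q = 1\<close> this is the classical function exp(-1/t), extended by 0. The
  polynomial in 1/t makes the family closed under differentiation.\<close>

definition flat :: "real poly \<Rightarrow> real \<Rightarrow> real" where
  "flat q t = (if 0 < t then poly q (1 / t) * exp (- (1 / t)) else 0)"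

lemma flat_bounded: "\<exists>B. \<forall>t. \<bar>flat q t\<bar> \<le> B"
proof -
  define B where "B = (\<Sum>i\<le>degree q. \<bar>coeff q i\<bar> * fact i)"
  have pow: "x ^ i * exp (- x) \<le> fact i" if "x > 0" for x :: real and i
  proof -
    \<comment> \<open>A single term of the exponential series is a lower bound for exp x.\<close>
    have "x ^ i /\<^sub>R fact i \<le> exp x"
      using that sum_le_suminf[OF summable_exp_generic[of x], of "{i}"]
      by (simp add: exp_def)
    then show ?thesis by (simp add: exp_minus field_simps)
  qed
  have "\<bar>flat q t\<bar> \<le> B" for t
  proof (cases "t > 0")
    case True
    define x where "x = 1 / t"
    have "x > 0" using True by (simp add: x_def)
    have "\<bar>poly q x\<bar> * exp (- x) \<le> (\<Sum>i\<le>degree q. \<bar>coeff q i\<bar> * x ^ i) * exp (- x)"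
      unfolding poly_altdef using \<open>x > 0\<close>
      by (intro mult_right_mono order_trans[OF sum_abs]) (auto simp: abs_mult)
    also have "\<dots> = (\<Sum>i\<le>degree q. \<bar>coeff q i\<bar> * (x ^ i * exp (- x)))"
      by (simp add: sum_distrib_right mult.assoc)
    also have "\<dots> \<le> B"
      unfolding B_def using pow[OF \<open>x > 0\<close>] by (intro sum_mono mult_left_mono) auto
    finally show ?thesis using True by (simp add: flat_def x_def abs_mult)
  next
    case False
    then show ?thesis by (auto simp: flat_def B_def intro!: sum_nonneg)
  qed
  then show ?thesis by blast
qed

text \<open>For t > 0, differentiating q(1/t) exp(-1/t) produces (q - q')(1/t) / t^2 times the
  exponential, and 1/t^2 is the factor \<open>[:0, 0, 1:]\<close>. At 0 the difference quotient is
  dominated by a multiple of |s|.\<close>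

lemma flat_has_derivative:
  "(flat q has_real_derivative flat ([:0, 0, 1:] * (q - pderiv q)) t) (at t)"
proof -
  consider "t > 0" | "t < 0" | "t = 0" by linarith
  then show ?thesis
  proof cases
    case 1
    have inv: "((\<lambda>t::real. 1 / t) has_real_derivative (- (1 / t\<^sup>2))) (at t)"
      using 1 by (auto intro!: derivative_eq_intros simp: power2_eq_square)
    have p: "((\<lambda>t. poly q (1 / t)) has_real_derivative poly (pderiv q) (1 / t) * (- (1 / t\<^sup>2))) (at t)"
      by (rule DERIV_chain2[OF poly_DERIV inv])
    have e: "((\<lambda>t. exp (- (1 / t))) has_real_derivative exp (- (1 / t)) * (1 / t\<^sup>2)) (at t)"
      using DERIV_chain2[OF DERIV_exp DERIV_minus[OF inv]] by simp
    have "((\<lambda>t. poly q (1 / t) * exp (- (1 / t))) has_real_derivative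
        flat ([:0, 0, 1:] * (q - pderiv q)) t) (at t)"
      using DERIV_mult[OF p e] 1 by (simp add: flat_def field_simps power2_eq_square)
    then show ?thesis
      by (rule DERIV_cong_ev[THEN iffD1, OF refl _ refl, rotated])
        (use 1 in \<open>auto simp: flat_def intro!: eventually_mono[OF eventually_nhds_in_open[of "{0<..}" t]]\<close>)
  next
    case 2
    have "((\<lambda>t. 0) has_real_derivative flat ([:0, 0, 1:] * (q - pderiv q)) t) (at t)"
      using 2 by (auto simp: flat_def)
    then show ?thesis
      by (rule DERIV_cong_ev[THEN iffD1, OF refl _ refl, rotated])
        (use 2 in \<open>auto simp: flat_def intro!: eventually_mono[OF eventually_nhds_in_open[of "{..<0}" t]]\<close>)
  next
    case 3
    \<comment> \<open>Multiplying the polynomial by the square of its variable gains a factor s^2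
      outside, so boundedness of another member of the family gives quadratic decay of this
      one.\<close>
    obtain B where B: "\<And>t. \<bar>flat (pCons 0 (pCons 0 q)) t\<bar> \<le> B" using flat_bounded by blast
    have "\<bar>flat q s\<bar> \<le> B * s\<^sup>2" for s
    proof (cases "s > 0")
      case True
      then have "flat q s = s\<^sup>2 * flat (pCons 0 (pCons 0 q)) s"
        by (simp add: flat_def power2_eq_square field_simps)
      then show ?thesis using mult_right_mono[OF B[of s], of "s\<^sup>2"] by (simp add: abs_mult mult.commute)
    next
      case False
      then show ?thesis using B[of s] by (auto simp: flat_def)
    qed
    then have bd: "\<bar>flat q s / s\<bar> \<le> B * \<bar>s\<bar>" for s
    proof (cases "s = 0")
      case False
      have "\<bar>flat q s\<bar> / \<bar>s\<bar> \<le> (B * \<bar>s\<bar>\<^sup>2) / \<bar>s\<bar>"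
        using \<open>\<bar>flat q s\<bar> \<le> B * s\<^sup>2\<close> by (intro divide_right_mono) auto
      also have "\<dots> = B * \<bar>s\<bar>" using False unfolding power2_eq_square by (simp only: mult.assoc[symmetric] nonzero_mult_div_cancel_right abs_eq_0 not_False_eq_True)
      finally show ?thesis by simp
    qed auto
    have "((\<lambda>s. flat q s / s) \<longlongrightarrow> 0) (at 0)"
    proof (rule Lim_null_comparison)
      show "\<forall>\<^sub>F s in at 0. norm (flat q s / s) \<le> B * \<bar>s\<bar>" using bd by auto
      show "((\<lambda>s. B * \<bar>s\<bar>) \<longlongrightarrow> 0) (at 0)" by (auto intro!: tendsto_eq_intros)
    qed
    then show ?thesis using 3 by (simp add: DERIV_def flat_def)
  qed
qed

lemma flat_1_bounds: "0 \<le> flat 1 t" "flat 1 t \<le> 1"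
  by (auto simp: flat_def)

lemma flat_1_pos: "0 < t \<Longrightarrow> 0 < flat 1 t"
  by (auto simp: flat_def)

lemma flat_nonpos: "t \<le> 0 \<Longrightarrow> flat q t = 0"
  by (auto simp: flat_def)

lemma flat_scaled_limit: "(\<lambda>n. flat 1 (real n * t)) \<longlonglongrightarrow> (if 0 < t then 1 else 0)"
proof (cases "0 < t")
  case True
  have lim: "(\<lambda>n. exp (- (inverse (real n) * (1 / t)))) \<longlonglongrightarrow> exp (- (0 * (1 / t)))"
    by (intro tendsto_intros lim_inverse_n)
  have ev: "\<forall>\<^sub>F n in sequentially. exp (- (inverse (real n) * (1 / t))) = flat 1 (real n * t)"
    using True by (auto simp: flat_def field_simps intro!: eventually_mono[OF eventually_gt_at_top[of 0]])
  show ?thesis using tendsto_cong[OF ev] lim True by simp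
next
  case False
  then have "flat 1 (real n * t) = 0" for n by (auto simp: flat_def zero_less_mult_iff)
  with False show ?thesis by simp
qed

text \<open>The parameter ranges over a single point: here the algebra serves only to prove
  smoothness.\<close>

definition flat_gens :: "(unit \<Rightarrow> real^3 \<Rightarrow> real) set" where
  "flat_gens = {(\<lambda>p x. flat q (c * (x $ i) + d)) | q c d i. True}"

lemma flat_gens_closed: "pd_closed UNIV flat_gens"
proof -
  have "(\<exists>B. \<forall>x::real^3. \<bar>flat q (c * (x $ i) + d)\<bar> \<le> B) \<and>
     (\<forall>x::real^3. (\<lambda>x. flat q (c * (x $ i) + d)) differentiable at x) \<and>
     (\<forall>j. (\<lambda>p. pd j (\<lambda>x. flat q (c * (x $ i) + d))) \<in> alg (UNIV::unit set) flat_gens)" for q c d i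
  proof (intro conjI allI)
    show "\<exists>B. \<forall>x::real^3. \<bar>flat q (c * (x $ i) + d)\<bar> \<le> B"
      using flat_bounded[of q] by blast
    have aff: "(\<lambda>x::real^3. c * (x $ i) + d) differentiable at x" for x
      by (intro derivative_intros differentiable_coord)
    show "(\<lambda>x. flat q (c * (x $ i) + d)) differentiable at x" for x :: "real^3"
      by (rule differentiable_compose_real[OF aff flat_has_derivative])
    fix j
    have "pd j (\<lambda>x. flat q (c * (x $ i) + d)) x =
      flat ([:0, 0, 1:] * (q - pderiv q)) (c * (x $ i) + d) * (if j = i then c else 0)" for x
      by (subst pd_compose[OF aff flat_has_derivative])
        (auto simp: pd_add pd_cmult pd_coord differentiable_coord derivative_intros)
    then have eq: "(\<lambda>p. pd j (\<lambda>x. flat q (c * (x $ i) + d))) =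
      (\<lambda>p x. flat ([:0, 0, 1:] * (q - pderiv q)) (c * (x $ i) + d) * (if j = i then c else 0))"
      by (intro ext)
    show "(\<lambda>p. pd j (\<lambda>x. flat q (c * (x $ i) + d))) \<in> alg (UNIV::unit set) flat_gens"
      unfolding eq by (intro alg.mult alg_const alg.gen) (auto simp: flat_gens_def)
  qed
  then show ?thesis unfolding pd_closed_def flat_gens_def by blast
qed

text \<open>Dilation by n replaces mollification: the bumps have values in [0,1], are supported in
  the box, and tend pointwise to its indicator, which is all that dominated convergence asks
  for.\<close>

definition box_bump :: "real^3 \<Rightarrow> real^3 \<Rightarrow> nat \<Rightarrow> real^3 \<Rightarrow> real" where
  "box_bump a b n x = (\<Prod>i\<in>UNIV. flat 1 (real n * (x $ i - a $ i)) * flat 1 (real n * (b $ i - x $ i)))"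

lemma smooth_box_bump: "smooth (box_bump a b n)"
proof -
  have g: "(\<lambda>p x. flat 1 (c * (x $ i) + d)) \<in> alg (UNIV::unit set) flat_gens" for c d i
    by (rule alg.gen) (auto simp: flat_gens_def)
  have "(\<lambda>p x. \<Prod>i\<in>UNIV. flat 1 (real n * (x $ i) + (- real n * a $ i)) *
      flat 1 ((- real n) * (x $ i) + real n * b $ i)) \<in> alg (UNIV::unit set) flat_gens"
    by (intro alg_prod alg.mult g)
  from alg_smooth[OF flat_gens_closed this, of "()"]
  show ?thesis unfolding box_bump_def by (simp add: algebra_simps)
qed

lemma box_bump_outside:
  assumes "x \<notin> box a b"
  shows "box_bump a b n x = 0"
proof -
  obtain i where "x $ i \<le> a $ i \<or> b $ i \<le> x $ i"
    using assms by (auto simp: mem_box_cart not_less)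
  then have "flat 1 (real n * (x $ i - a $ i)) * flat 1 (real n * (b $ i - x $ i)) = 0"
    by (auto intro!: flat_nonpos mult_nonneg_nonpos)
  then show ?thesis unfolding box_bump_def by (auto intro!: prod_zero)
qed

lemma box_bump_bounds: "0 \<le> box_bump a b n x" "box_bump a b n x \<le> 1"
  unfolding box_bump_def
  by (auto intro!: prod_nonneg prod_le_1 mult_nonneg_nonneg mult_le_one flat_1_bounds)

lemma box_bump_limit: "(\<lambda>n. box_bump a b n x) \<longlonglongrightarrow> indicator (box a b) x"
proof -
  have "(\<lambda>n. box_bump a b n x) \<longlonglongrightarrow>
    (\<Prod>i\<in>UNIV. (if 0 < x $ i - a $ i then 1 else 0) * (if 0 < b $ i - x $ i then 1 else 0))"
    unfolding box_bump_def by (intro tendsto_intros flat_scaled_limit)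
  also have "(\<Prod>i\<in>UNIV. (if 0 < x $ i - a $ i then 1 else 0) * (if 0 < b $ i - x $ i then 1 else 0)) =
    (indicator (box a b) x :: real)"
  proof (cases "x \<in> box a b")
    case True
    then show ?thesis by (auto simp: mem_box_cart intro!: prod.neutral)
  next
    case False
    then obtain i where "x $ i \<le> a $ i \<or> b $ i \<le> x $ i"
      by (auto simp: mem_box_cart not_less)
    then have "\<exists>i\<in>UNIV. (if 0 < x $ i - a $ i then 1 else 0) * (if 0 < b $ i - x $ i then 1 else 0) = (0::real)"
      by (intro bexI[of _ i]) auto
    from prod_zero[OF finite this] show ?thesis using False by simp
  qed
  finally show ?thesis .
qed

section \<open>Locally integrable functions annihilated by all test functions\<close>

lemma open_strip: "open (strip h)"
  unfolding strip_def
  by (intro open_Collect_conj open_Collect_less continuous_intros)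

lemma strip_measurable [measurable]: "strip h \<in> sets borel"
  using open_strip by auto

lemma test_fun_box_bump:
  assumes "cbox a b \<subseteq> strip h"
  shows "test_fun h (box_bump a b n)"
  unfolding test_fun_def
proof (intro conjI exI[of _ "cbox a b"] allI impI)
  show "box_bump a b n x = 0" if "x \<notin> cbox a b" for x
    using that box_subset_cbox[of a b] by (intro box_bump_outside) auto
qed (use assms smooth_box_bump in auto)

lemma loc_int_box:
  assumes "loc_int h g" "cbox a b \<subseteq> strip h"
  shows "set_integrable lborel (cbox a b) g"
  using assms by (auto simp: loc_int_def)

text \<open>The closed box lies in the strip, so the bumps of the open box are admissible test
  functions; |g| on the closed box is the integrable majorant in the passage to the
  indicator.\<close>

lemma zero_on_boxes:
  assumes g: "loc_int h g"
    and zero: "\<And>\<phi>. test_fun h \<phi> \<Longrightarrow> (LINT x:strip h|lborel. g x * \<phi> x) = 0"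
    and sub: "cbox a b \<subseteq> strip h"
  shows "(LINT x:box a b|lborel. g x) = 0"
proof -
  let ?f = "\<lambda>x. indicator (cbox a b) x *\<^sub>R g x"
  have int: "integrable lborel ?f"
    using loc_int_box[OF g sub] by (simp add: set_integrable_def)
  then have [measurable]: "?f \<in> borel_measurable lborel" by auto
  have [measurable]: "box_bump a b n \<in> borel_measurable borel" for n
    by (intro borel_measurable_continuous_onI smooth_continuous smooth_box_bump)
  have "(\<lambda>n. LINT x|lborel. ?f x * box_bump a b n x) \<longlonglongrightarrow> (LINT x|lborel. ?f x * indicator (box a b) x)"
  proof (rule integral_dominated_convergence[where w = "\<lambda>x. norm (?f x)"])
    show "AE x in lborel. norm (?f x * box_bump a b n x) \<le> norm (?f x)" for n
    proof (intro AE_I2)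
      fix x
      have "norm (?f x) * \<bar>box_bump a b n x\<bar> \<le> norm (?f x) * 1"
        using box_bump_bounds[of a b n x] by (intro mult_left_mono) auto
      then show "norm (?f x * box_bump a b n x) \<le> norm (?f x)" by (simp only: norm_mult real_norm_def abs_mult mult_1_right)
    qed
    show "AE x in lborel. (\<lambda>n. ?f x * box_bump a b n x) \<longlonglongrightarrow> ?f x * indicator (box a b) x"
      by (intro AE_I2 tendsto_intros box_bump_limit)
  qed (use int in auto)
  moreover have "(LINT x|lborel. ?f x * box_bump a b n x) = 0" for n
  proof -
    have "(LINT x|lborel. ?f x * box_bump a b n x) = (LINT x:strip h|lborel. g x * box_bump a b n x)"
      unfolding set_lebesgue_integral_def
    proof (rule Bochner_Integration.integral_cong[OF refl])
      fix x
      show "?f x * box_bump a b n x = indicator (strip h) x *\<^sub>R (g x * box_bump a b n x)"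
        using sub box_subset_cbox[of a b] box_bump_outside[of x a b n]
        by (cases "x \<in> box a b") (auto simp: indicator_def)
    qed
    then show ?thesis using zero[OF test_fun_box_bump[OF sub]] by simp
  qed
  ultimately have "(LINT x|lborel. ?f x * indicator (box a b) x) = 0"
    by (simp add: LIMSEQ_const_iff)
  also have "(LINT x|lborel. ?f x * indicator (box a b) x) = (LINT x:box a b|lborel. g x)"
    unfolding set_lebesgue_integral_def
    using box_subset_cbox[of a b] by (intro Bochner_Integration.integral_cong) (auto simp: indicator_def)
  finally show ?thesis .
qed

text \<open>Boxes form an intersection-stable generator of the Borel sets. The sets over which the
  truncated \<open>g\<close> integrates to 0 are closed under complements and countable disjoint
  unions, so they comprise all Borel sets, and a density with vanishing integrals is 0 almost
  everywhere.\<close>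

lemma AE_zero_on_box:
  fixes g :: "real^3 \<Rightarrow> real"
  assumes int: "set_integrable lborel (box a b) g"
    and zero: "\<And>c d. cbox c d \<subseteq> cbox a b \<Longrightarrow> (LINT x:box c d|lborel. g x) = 0"
  shows "AE x in lborel. x \<in> box a b \<longrightarrow> g x = 0"
proof -
  define f where "f = (\<lambda>x. indicator (box a b) x *\<^sub>R g x)"
  have f: "integrable lborel f" using int by (simp add: f_def set_integrable_def)
  have f_set: "set_integrable lborel A f" if "A \<in> sets lborel" for A
    using f that unfolding set_integrable_def by (intro integrable_mult_indicator)
  have sub: "(LINT x:A|lborel. f x) = (LINT x:A \<inter> box a b|lborel. g x)" for A
    unfolding f_def set_lebesgue_integral_def
    by (intro Bochner_Integration.integral_cong) (auto simp: indicator_def)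
  have zf: "(LINT x:A|lborel. f x) = 0" if "A \<in> sigma_sets UNIV (range (\<lambda>(c,d). box c d))" for A
  proof -
    have "Int_stable (range (\<lambda>(c,d). box c d :: (real^3) set))"
      by (auto simp: Int_stable_def box_Int_box)
    moreover have "range (\<lambda>(c,d). box c d :: (real^3) set) \<subseteq> Pow UNIV" by simp
    ultimately show ?thesis using that
    proof (induction rule: sigma_sets_induct_disjoint)
      case (basic A)
      then obtain c d where A: "A = box c d" by auto
      obtain c' d' where cd': "box c d \<inter> box a b = box c' d'" "cbox c' d' \<subseteq> cbox a b"
      proof
        let ?c = "(\<chi> i. max (c$i) (a$i)) :: real^3" and ?d = "(\<chi> i. min (d$i) (b$i)) :: real^3"
        show "box c d \<inter> box a b = box ?c ?d" by (auto simp: mem_box_cart)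
        show "cbox ?c ?d \<subseteq> cbox a b" by (auto simp: mem_box_cart)
      qed
      then show ?case using zero[OF cd'(2)] by (simp add: sub A)
    next
      case empty then show ?case by (simp add: set_lebesgue_integral_def)
    next
      case (compl A)
      have A: "A \<in> sets lborel" using compl.hyps by (simp add: borel_eq_box)
      have "(LINT x:UNIV|lborel. f x) = 0" using zero[of a b] by (simp add: sub)
      moreover have "(LINT x:(UNIV - A) \<union> A|lborel. f x) = (LINT x:UNIV - A|lborel. f x) + (LINT x:A|lborel. f x)"
        by (rule set_integral_Un) (use A f_set in auto)
      ultimately show ?case using compl.IH by simp
    next
      case (union A)
      have A: "A i \<in> sets lborel" for i using union.hyps by (auto simp: borel_eq_box)
      have "(LINT x:(\<Union>i. A i)|lborel. f x) = (\<Sum>i. LINT x:A i|lborel. f x)"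
        using union.hyps A f_set by (intro lebesgue_integral_countable_add) (auto simp: disjoint_family_on_def)
      then show ?case using union.IH by simp
    qed
  qed
  have "AE x in lborel. f x = 0"
  proof (rule density_unique_real[OF f])
    fix A :: "(real^3) set" assume "A \<in> sets lborel"
    then have "A \<in> sigma_sets UNIV (range (\<lambda>(c,d). box c d))" by (simp add: borel_eq_box)
    from zf[OF this] show "(LINT x:A|lborel. f x) = (LINT x:A|lborel. 0)" by simp
  qed simp
  then show ?thesis by (rule AE_mp) (auto simp: f_def indicator_def)
qed

text \<open>Local integrability speaks of compact subsets only. Countably many boxes that stay
  1/(n+1) away from the two walls carry statements from compact sets to the whole strip without
  leaving null sets.\<close>

lemma strip_exhaustion:
  obtains a b :: "nat \<Rightarrow> real^3" where "\<And>n. cbox (a n) (b n) \<subseteq> strip h"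
    "\<And>x. x \<in> strip h \<Longrightarrow> \<exists>n. x \<in> box (a n) (b n)"
proof
  define a b :: "nat \<Rightarrow> real^3" where
    "a n = (\<chi> i. if i = 3 then 1 / Suc n else - real n)" and
    "b n = (\<chi> i. if i = 3 then h - 1 / Suc n else real n)" for n
  show "cbox (a n) (b n) \<subseteq> strip h" for n
  proof
    fix x assume "x \<in> cbox (a n) (b n)"
    then have "a n $ 3 \<le> x $ 3 \<and> x $ 3 \<le> b n $ 3" unfolding mem_box_cart by blast
    moreover have "0 < 1 / real (Suc n)" by simp
    ultimately have "0 < x $ 3 \<and> x $ 3 < h" unfolding a_def b_def vec_lambda_beta by (smt (verit))
    then show "x \<in> strip h" by (simp add: strip_def)
  qed
  fix x assume x: "x \<in> strip h"
  obtain m1 where m1: "norm x < real m1" using reals_Archimedean2 by blast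
  obtain m2 where m2: "1 / real (Suc m2) < x $ 3" using nat_approx_posE[of "x$3"] x by (auto simp: strip_def)
  obtain m3 where m3: "1 / real (Suc m3) < h - x $ 3" using nat_approx_posE[of "h - x$3"] x by (auto simp: strip_def)
  define n where "n = max m1 (max m2 m3)"
  have "1 / real (Suc n) \<le> 1 / real (Suc m2)" "1 / real (Suc n) \<le> 1 / real (Suc m3)"
    by (auto simp: n_def intro!: divide_left_mono)
  moreover have "\<bar>x $ i\<bar> < real n" for i
    using component_le_norm_cart[of x i] m1 by (auto simp: n_def)
  ultimately have "x \<in> box (a n) (b n)"
    using m2 m3 unfolding mem_box_cart a_def b_def vec_lambda_beta
    by (auto simp: abs_less_iff minus_less_iff)
  then show "\<exists>n. x \<in> box (a n) (b n)" ..
qed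

lemma fundamental_lemma:
  assumes g: "loc_int h g"
    and zero: "\<And>\<phi>. test_fun h \<phi> \<Longrightarrow> (LINT x:strip h|lborel. g x * \<phi> x) = 0"
  shows "AE x in lborel. x \<in> strip h \<longrightarrow> g x = 0"
proof -
  obtain a b where sub: "\<And>n::nat. cbox (a n) (b n) \<subseteq> strip h"
    and ex: "\<And>x. x \<in> strip h \<Longrightarrow> \<exists>n. x \<in> box (a n) (b n)"
    using strip_exhaustion by blast
  have "AE x in lborel. x \<in> box (a n) (b n) \<longrightarrow> g x = 0" for n
  proof (rule AE_zero_on_box)
    show "set_integrable lborel (box (a n) (b n)) g"
      by (rule set_integrable_subset[OF loc_int_box[OF g sub[of n]]]) (auto simp: box_subset_cbox)
    show "(LINT x:box c d|lborel. g x) = 0" if "cbox c d \<subseteq> cbox (a n) (b n)" for c d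
      using zero_on_boxes[OF g zero] that sub by blast
  qed
  then have "AE x in lborel. \<forall>n. x \<in> box (a n) (b n) \<longrightarrow> g x = 0"
    by (subst AE_all_countable) blast
  then show ?thesis
    by (rule AE_mp) (use ex in \<open>auto intro!: AE_I2\<close>)
qed

section \<open>Weak derivatives\<close>

lemma integrable_compact_support:
  fixes f :: "real^3 \<Rightarrow> real"
  assumes "continuous_on UNIV f" "compact K" "\<And>x. x \<notin> K \<Longrightarrow> f x = 0"
  shows "integrable lborel f"
proof -
  have "integrable lborel (\<lambda>x. indicator K x *\<^sub>R f x)"
    by (rule borel_integrable_compact[OF assms(2)]) (rule continuous_on_subset[OF assms(1)], simp)
  also have "(\<lambda>x. indicator K x *\<^sub>R f x) = f"
    using assms(3) by (auto simp: indicator_def fun_eq_iff)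
  finally show ?thesis .
qed

lemma pd_outside:
  fixes u :: "real^3 \<Rightarrow> real"
  assumes "compact K" "\<And>x. x \<notin> K \<Longrightarrow> u x = 0" "x \<notin> K"
  shows "pd i u x = 0"
  using pd_cong_open[of "- K" x u "\<lambda>x. 0" i] assms by (simp add: open_Compl compact_imp_closed)

lemma integral_lborel_translate:
  fixes u :: "'a::euclidean_space \<Rightarrow> real"
  assumes "integrable lborel u"
  shows "integrable lborel (\<lambda>x. u (c + x))" "(LINT x|lborel. u (c + x)) = (LINT x|lborel. u x)"
proof -
  have m: "(+) c \<in> borel_measurable lborel" by simp
  have d: "distr lborel lborel ((+) c) = (lborel :: 'a measure)"
    using lborel_distr_plus[of c] by (simp cong: distr_cong)
  have u: "u \<in> borel_measurable lborel" using assms by auto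
  show "integrable lborel (\<lambda>x. u (c + x))"
    using integrable_distr[of "(+) c" lborel lborel u] d assms by simp
  show "(LINT x|lborel. u (c + x)) = (LINT x|lborel. u x)"
    using integral_distr[of "(+) c" lborel lborel u] d u by simp
qed

text \<open>The difference quotients of \<open>u\<close> have integral zero by translation invariance, and they
  converge boundedly to the partial derivative.\<close>

lemma integral_pd_zero:
  fixes u :: "real^3 \<Rightarrow> real"
  assumes diff: "\<And>x. u differentiable at x" and cont: "continuous_on UNIV (pd i u)"
    and K: "compact K" "\<And>x. x \<notin> K \<Longrightarrow> u x = 0"
  shows "(LINT x|lborel. pd i u x) = 0"
proof -
  have ucont: "continuous_on UNIV u"
    using diff by (intro continuous_at_imp_continuous_on) (auto intro: differentiable_imp_continuous_within)
  have uint: "integrable lborel u" by (rule integrable_compact_support[OF ucont K])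
  obtain R where R: "\<And>x. x \<in> K \<Longrightarrow> norm x \<le> R"
    using compact_imp_bounded[OF K(1)] by (auto simp: bounded_iff)
  have "bounded (pd i u ` K)"
    using K(1) cont by (intro compact_imp_bounded compact_continuous_image) (auto intro: continuous_on_subset)
  then obtain B0 where B0: "\<And>x. x \<in> K \<Longrightarrow> \<bar>pd i u x\<bar> \<le> B0" by (auto simp: bounded_iff)
  define B where "B = max B0 0"
  have B: "\<bar>pd i u x\<bar> \<le> B" for x
    using B0[of x] pd_outside[of K u x i] K by (cases "x \<in> K") (auto simp: B_def)
  define c :: "nat \<Rightarrow> real^3" where "c n = (1 / real (Suc n)) *\<^sub>R axis i 1" for n
  define d where "d n x = real (Suc n) * (u (c n + x) - u x)" for n x
  have mvt: "\<bar>d n x\<bar> \<le> B" for n x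
  proof -
    have "\<exists>z>0. z < 1 / real (Suc n) \<and>
       u (x + (1 / real (Suc n)) *\<^sub>R axis i 1) - u (x + 0 *\<^sub>R axis i 1)
         = (1 / real (Suc n) - 0) * pd i u (x + z *\<^sub>R axis i 1)"
      by (rule MVT2) (auto intro: line_derivative_axis diff)
    then obtain z where "u (x + c n) - u x = (1 / real (Suc n)) * pd i u (x + z *\<^sub>R axis i 1)"
      by (auto simp: c_def)
    then have "d n x = pd i u (x + z *\<^sub>R axis i 1)" by (simp add: d_def add.commute)
    then show ?thesis using B by simp
  qed
  have lim: "(\<lambda>n. d n x) \<longlonglongrightarrow> pd i u x" for x
  proof -
    have "((\<lambda>s. (u (x + (0 + s) *\<^sub>R axis i 1) - u (x + 0 *\<^sub>R axis i 1)) / s) \<longlongrightarrow> pd i u x) (at 0)"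
      using line_derivative_axis[OF diff, of x i 0] by (simp add: DERIV_def)
    moreover have "filterlim (\<lambda>n. 1 / real (Suc n)) (at 0) sequentially"
      using LIMSEQ_inverse_real_of_nat by (auto simp: filterlim_at inverse_eq_divide)
    ultimately have "(\<lambda>n. (u (x + (0 + 1 / real (Suc n)) *\<^sub>R axis i 1) - u (x + 0 *\<^sub>R axis i 1)) / (1 / real (Suc n)))
        \<longlonglongrightarrow> pd i u x"
      by (rule filterlim_compose)
    moreover have "(\<lambda>n. (u (x + (0 + 1 / real (Suc n)) *\<^sub>R axis i 1) - u (x + 0 *\<^sub>R axis i 1)) / (1 / real (Suc n))) = (\<lambda>n. d n x)"
      by (auto simp: d_def c_def add.commute mult.commute)
    ultimately show ?thesis by simp
  qed
  have "(\<lambda>n. LINT x|lborel. d n x) \<longlonglongrightarrow> (LINT x|lborel. pd i u x)"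
  \<comment> \<open>The increment \<open>c n\<close> has length at most 1, so every quotient
    \<open>d n\<close> vanishes outside the ball of radius R + 1 when the support lies in the ball
    of radius R.\<close>
  proof (rule integral_dominated_convergence[where w = "\<lambda>x. indicator (cball 0 (R + 1)) x * B"])
    show "pd i u \<in> borel_measurable lborel" using cont by (auto intro: borel_measurable_continuous_onI)
    have [measurable]: "u \<in> borel_measurable borel" using ucont by (rule borel_measurable_continuous_onI)
    show "d n \<in> borel_measurable lborel" for n unfolding d_def by measurable
    have "integrable lborel (\<lambda>x. indicator (cball 0 (R + 1)) x *\<^sub>R B :: real)"
      by (rule borel_integrable_compact) auto
    then show "integrable lborel (\<lambda>x. indicator (cball 0 (R + 1)) x * B :: real)" by simp
    show "AE x in lborel. (\<lambda>n. d n x) \<longlonglongrightarrow> pd i u x" using lim by simp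
    show "AE x in lborel. norm (d n x) \<le> indicator (cball 0 (R + 1)) x * B" for n
    proof (intro AE_I2)
      fix x
      show "norm (d n x) \<le> indicator (cball 0 (R + 1)) x * B"
      proof (cases "x \<in> cball 0 (R + 1)")
        case False
        have "norm (c n) \<le> 1" by (simp add: c_def norm_axis_1)
        then have "norm (c n + x) \<ge> norm x - 1"
          using norm_triangle_ineq2[of x "- c n"] by (simp add: add.commute)
        then have "x \<notin> K" "c n + x \<notin> K" using False R[of x] R[of "c n + x"] by (auto simp: dist_norm)
        then show ?thesis using False K(2) by (simp add: d_def)
      qed (use mvt in simp)
    qed
  qed
  moreover have "(LINT x|lborel. d n x) = 0" for n
    unfolding d_def using integral_lborel_translate[OF uint, of "c n"] uint by simp
  ultimately show ?thesis by (simp add: LIMSEQ_const_iff)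
qed

text \<open>The support of \<open>\<phi>\<close> confines the product \<open>f x * \<phi> x\<close>
  to a compact set, so \<open>integral_pd_zero\<close> applies to the product although
  \<open>f\<close> itself has no decay.\<close>

lemma integration_by_parts:
  fixes f \<phi> :: "real^3 \<Rightarrow> real"
  assumes f: "smooth f" and \<phi>: "test_fun h \<phi>"
  shows "(LINT x:strip h|lborel. f x * pd i \<phi> x) = - (LINT x:strip h|lborel. pd i f x * \<phi> x)"
proof -
  from \<phi> obtain K where s: "smooth \<phi>" and K: "compact K" "K \<subseteq> strip h" "\<And>x. x \<notin> K \<Longrightarrow> \<phi> x = 0"
    by (auto simp: test_fun_def)
  have eq: "(LINT x:strip h|lborel. v x) = (LINT x|lborel. v x)" if "\<And>x. x \<notin> K \<Longrightarrow> v x = 0" for v :: "real^3 \<Rightarrow> real"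
    unfolding set_lebesgue_integral_def using K(2) that
    by (intro Bochner_Integration.integral_cong) (auto simp: indicator_def)
  have z: "pd i \<phi> x = 0" if "x \<notin> K" for x by (rule pd_outside[OF K(1,3) that])
  have i1: "integrable lborel (\<lambda>x. f x * pd i \<phi> x)"
    by (rule integrable_compact_support[OF _ K(1)])
      (auto simp: z intro!: continuous_on_mult smooth_continuous[OF f] smooth_continuous[OF smooth_pd[OF s]])
  have i2: "integrable lborel (\<lambda>x. pd i f x * \<phi> x)"
    by (rule integrable_compact_support[OF _ K(1)])
      (auto simp: K(3) intro!: continuous_on_mult smooth_continuous[OF s] smooth_continuous[OF smooth_pd[OF f]])
  have pdeq: "pd i (\<lambda>x. f x * \<phi> x) = (\<lambda>x. f x * pd i \<phi> x + pd i f x * \<phi> x)"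
    by (intro ext pd_mult smooth_differentiable f s)
  have "(LINT x|lborel. pd i (\<lambda>x. f x * \<phi> x) x) = 0"
  proof (rule integral_pd_zero[OF _ _ K(1)])
    show "(\<lambda>x. f x * \<phi> x) differentiable at x" for x
      by (intro differentiable_mult smooth_differentiable f s)
    show "continuous_on UNIV (pd i (\<lambda>x. f x * \<phi> x))"
      unfolding pdeq by (intro continuous_on_add continuous_on_mult smooth_continuous f smooth_pd s)
  qed (use K(3) in auto)
  then have "(LINT x|lborel. f x * pd i \<phi> x) + (LINT x|lborel. pd i f x * \<phi> x) = 0"
    unfolding pdeq by (simp add: Bochner_Integration.integral_add[OF i1 i2])
  then show ?thesis
    by (subst (1 2) eq) (auto simp: z K(3))
qed

lemma loc_int_continuous: "continuous_on UNIV f \<Longrightarrow> loc_int h f"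
  unfolding loc_int_def set_integrable_def
  by (intro allI impI borel_integrable_compact) (auto intro: continuous_on_subset)

lemma loc_int_diff: "loc_int h f \<Longrightarrow> loc_int h g \<Longrightarrow> loc_int h (\<lambda>x. f x - g x)"
  unfolding loc_int_def by (auto intro!: set_integral_diff)

lemma weak_pd_smooth: "smooth f \<Longrightarrow> weak_pd h f i (pd i f)"
  unfolding weak_pd_def
  by (auto intro!: loc_int_continuous integration_by_parts smooth_continuous smooth_pd)

lemma loc_int_times_test:
  assumes g: "loc_int h g" and c: "continuous_on UNIV \<phi>"
    and K: "compact K" "K \<subseteq> strip h" "\<And>x. x \<notin> K \<Longrightarrow> \<phi> x = 0"
  shows "set_integrable lborel (strip h) (\<lambda>x. g x * \<phi> x)"
proof -
  have int: "integrable lborel (\<lambda>x. indicator K x *\<^sub>R g x)"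
    using g K by (auto simp: loc_int_def set_integrable_def)
  have "bounded (\<phi> ` K)"
    using K(1) c by (intro compact_imp_bounded compact_continuous_image) (auto intro: continuous_on_subset)
  then obtain B where B: "\<And>x. x \<in> K \<Longrightarrow> \<bar>\<phi> x\<bar> \<le> B" by (auto simp: bounded_iff)
  have m1: "(\<lambda>x. indicator K x *\<^sub>R g x) \<in> borel_measurable lborel" using int by auto
  have m2: "\<phi> \<in> borel_measurable lborel" using borel_measurable_continuous_onI[OF c] by simp
  have "integrable lborel (\<lambda>x. (indicator K x *\<^sub>R g x) * \<phi> x)"
  proof (rule Bochner_Integration.integrable_bound)
    show "integrable lborel (\<lambda>x. B * (indicator K x *\<^sub>R g x))" using int by simp
    show "(\<lambda>x. (indicator K x *\<^sub>R g x) * \<phi> x) \<in> borel_measurable lborel"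
      using m1 m2 by (rule borel_measurable_times)
    show "AE x in lborel. norm ((indicator K x *\<^sub>R g x) * \<phi> x) \<le> norm (B * (indicator K x *\<^sub>R g x))"
    proof (intro AE_I2)
      fix x show "norm ((indicator K x *\<^sub>R g x) * \<phi> x) \<le> norm (B * (indicator K x *\<^sub>R g x))"
        using B[of x] mult_right_mono[of "\<bar>\<phi> x\<bar>" "\<bar>B\<bar>" "\<bar>g x\<bar>"]
        by (cases "x \<in> K") (auto simp: abs_mult mult.commute)
    qed
  qed
  moreover have "(\<lambda>x. (indicator K x *\<^sub>R g x) * \<phi> x) = (\<lambda>x. indicator (strip h) x *\<^sub>R (g x * \<phi> x))"
    using K(2,3) by (auto simp: indicator_def fun_eq_iff)
  ultimately show ?thesis by (simp add: set_integrable_def)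
qed

lemma test_fun_integrable:
  assumes "loc_int h g" "test_fun h \<phi>"
  shows "set_integrable lborel (strip h) (\<lambda>x. g x * \<phi> x)"
    and "set_integrable lborel (strip h) (\<lambda>x. g x * pd i \<phi> x)"
proof -
  from assms(2) obtain K where s: "smooth \<phi>" and K: "compact K" "K \<subseteq> strip h" "\<And>x. x \<notin> K \<Longrightarrow> \<phi> x = 0"
    by (auto simp: test_fun_def)
  show "set_integrable lborel (strip h) (\<lambda>x. g x * \<phi> x)"
    by (rule loc_int_times_test[OF assms(1) smooth_continuous[OF s] K])
  show "set_integrable lborel (strip h) (\<lambda>x. g x * pd i \<phi> x)"
    by (rule loc_int_times_test[OF assms(1) smooth_continuous[OF smooth_pd[OF s]] K(1,2)])
      (rule pd_outside[OF K(1,3)])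
qed

section \<open>Uniqueness and measurability of weak derivatives\<close>

lemma set_integral_cong_AE':
  fixes f g :: "'a \<Rightarrow> real"
  assumes "set_borel_measurable M A f" "set_borel_measurable M A g" "AE x in M. x \<in> A \<longrightarrow> f x = g x"
  shows "(LINT x:A|M. f x) = (LINT x:A|M. g x)"
  unfolding set_lebesgue_integral_def
  using assms(1,2) unfolding set_borel_measurable_def
  by (rule integral_cong_AE) (use assms(3) in \<open>auto simp: indicator_def elim!: AE_mp\<close>)

text \<open>The two primitives are compared only almost everywhere, because uniqueness is iterated
  along a multi-index in \<open>hk_family_unique\<close>, where equality everywhere is lost after
  the first derivative.\<close>

lemma weak_pd_unique:
  assumes f: "weak_pd h f i g" and f': "weak_pd h f' i g'"
    and eq: "AE x in lborel. x \<in> strip h \<longrightarrow> f x = f' x"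
  shows "AE x in lborel. x \<in> strip h \<longrightarrow> g x = g' x"
proof -
  have l: "loc_int h f" "loc_int h f'" "loc_int h g" "loc_int h g'"
    using f f' by (auto simp: weak_pd_def)
  have "AE x in lborel. x \<in> strip h \<longrightarrow> g x - g' x = 0"
  proof (rule fundamental_lemma[OF loc_int_diff[OF l(3,4)]])
    fix \<phi> assume t: "test_fun h \<phi>"
    have "(LINT x:strip h|lborel. f x * pd i \<phi> x) = (LINT x:strip h|lborel. f' x * pd i \<phi> x)"
      by (rule set_integral_cong_AE')
        (use test_fun_integrable(2)[OF l(1) t] test_fun_integrable(2)[OF l(2) t] eq in
          \<open>auto simp: set_integrable_def set_borel_measurable_def\<close>)
    then have "(LINT x:strip h|lborel. g x * \<phi> x) = (LINT x:strip h|lborel. g' x * \<phi> x)"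
      using f f' t by (auto simp: weak_pd_def)
    then show "(LINT x:strip h|lborel. (g x - g' x) * \<phi> x) = 0"
      using set_integral_diff(2)[OF test_fun_integrable(1)[OF l(3) t] test_fun_integrable(1)[OF l(4) t]]
      by (simp add: left_diff_distrib)
  qed
  then show ?thesis by (rule AE_mp) auto
qed

lemma weak_pd_diff:
  assumes f: "weak_pd h f i g" and f': "weak_pd h f' i g'"
  shows "weak_pd h (\<lambda>x. f x - f' x) i (\<lambda>x. g x - g' x)"
proof -
  have l: "loc_int h f" "loc_int h f'" "loc_int h g" "loc_int h g'"
    using f f' by (auto simp: weak_pd_def)
  have "(LINT x:strip h|lborel. (f x - f' x) * pd i \<phi> x) = - (LINT x:strip h|lborel. (g x - g' x) * \<phi> x)"
    if t: "test_fun h \<phi>" for \<phi>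
    unfolding left_diff_distrib
    using f f' t set_integral_diff(2)[OF test_fun_integrable(1)[OF l(3) t] test_fun_integrable(1)[OF l(4) t]]
      set_integral_diff(2)[OF test_fun_integrable(2)[OF l(1) t] test_fun_integrable(2)[OF l(2) t]]
    by (auto simp: weak_pd_def)
  then show ?thesis using l by (auto simp: weak_pd_def intro: loc_int_diff)
qed

text \<open>\<open>wpd\<close> is an arbitrary choice among the weak derivatives, so this equality
  almost everywhere is the way to compute with it.\<close>

lemma wpd_AE:
  assumes "weak_pd h f i g"
  shows "AE x in lborel. x \<in> strip h \<longrightarrow> wpd h f i x = g x"
proof -
  have "weak_pd h f i (wpd h f i)" unfolding wpd_def by (rule someI[of "weak_pd h f i"]) (rule assms)
  from weak_pd_unique[OF this assms] show ?thesis by simp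
qed

text \<open>The derivative chosen by \<open>wpd\<close> is known to be locally integrable and no
  more. Measurability on the strip, needed to compare integrals of functions equal almost
  everywhere, is glued together from the boxes of the exhaustion.\<close>

lemma loc_int_measurable:
  assumes g: "loc_int h g"
  shows "set_borel_measurable lborel (strip h) g"
proof -
  obtain a b where sub: "\<And>n::nat. cbox (a n) (b n) \<subseteq> strip h"
    and ex: "\<And>x. x \<in> strip h \<Longrightarrow> \<exists>n. x \<in> box (a n) (b n)"
    using strip_exhaustion by blast
  let ?f = "\<lambda>x. indicator (strip h) x *\<^sub>R g x"
  let ?C = "insert (- strip h) (range (\<lambda>n. cbox (a n) (b n)))"
  have "?f \<in> borel_measurable lborel"
  proof (rule measurable_piecewise_restrict[of ?C])
    show "space lborel \<subseteq> \<Union>?C" using ex box_subset_cbox by fastforce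
    fix \<Omega> assume \<Omega>: "\<Omega> \<in> ?C"
    then show meas: "\<Omega> \<inter> space lborel \<in> sets lborel" by auto
    show "?f \<in> borel_measurable (restrict_space lborel \<Omega>)"
    proof (cases "\<Omega> = - strip h")
      case True
      then have "(\<lambda>x. indicator \<Omega> x *\<^sub>R ?f x) = (\<lambda>x. 0)" by (auto simp: indicator_def)
      then show ?thesis using meas by (subst borel_measurable_restrict_space_iff) auto
    next
      case False
      then obtain n where n: "\<Omega> = cbox (a n) (b n)" using \<Omega> by auto
      have "(\<lambda>x. indicator \<Omega> x *\<^sub>R ?f x) = (\<lambda>x. indicator \<Omega> x *\<^sub>R g x)"
        using sub[of n] n by (auto simp: indicator_def fun_eq_iff)
      moreover have "(\<lambda>x. indicator \<Omega> x *\<^sub>R g x) \<in> borel_measurable lborel"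
        using loc_int_box[OF g sub[of n]] n by (auto simp: set_integrable_def)
      ultimately show ?thesis using meas by (subst borel_measurable_restrict_space_iff) auto
    qed
  qed auto
  then show ?thesis by (simp add: set_borel_measurable_def)
qed

section \<open>Sobolev families and norms on the periodic cell\<close>

lemma cell_subset_strip: "cell L1 L2 h \<subseteq> strip h"
  by (auto simp: cell_def strip_def)

lemma cell_measurable [measurable]: "cell L1 L2 h \<in> sets borel"
  unfolding cell_def
  by (intro borel_open open_Collect_conj open_Collect_less continuous_intros)

lemma cell_eq_box: "cell L1 L2 h = box 0 (vector [2*pi*L1, 2*pi*L2, h])"
  by (auto simp: cell_def mem_box_cart forall_3)

lemma cell_integrable_continuous:
  fixes f :: "real^3 \<Rightarrow> real"
  assumes "continuous_on UNIV f"
  shows "set_integrable lborel (cell L1 L2 h) f"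
proof -
  have "set_integrable lborel (cbox 0 (vector [2*pi*L1, 2*pi*L2, h])) f"
    unfolding set_integrable_def
    by (rule borel_integrable_compact) (auto intro: continuous_on_subset[OF assms])
  then show ?thesis
    by (rule set_integrable_subset) (auto simp: cell_eq_box box_subset_cbox)
qed

lemma AE_cell: "AE x in lborel. x \<in> strip h \<longrightarrow> P x \<Longrightarrow> AE x in lborel. x \<in> cell L1 L2 h \<longrightarrow> P x"
  by (erule AE_mp) (use cell_subset_strip[of L1 L2 h] in \<open>auto intro!: AE_I2\<close>)

lemma hk_family_unique:
  assumes D: "hk_family L1 L2 h k f D" and E: "hk_family L1 L2 h k f E" and "length \<alpha> \<le> k"
  shows "AE x in lborel. x \<in> strip h \<longrightarrow> D \<alpha> x = E \<alpha> x"
  using assms(3)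
proof (induction \<alpha>)
  case Nil
  then show ?case using D E by (auto simp: hk_family_def)
next
  case (Cons i \<alpha>)
  then have "weak_pd h (D \<alpha>) i (D (i # \<alpha>))" "weak_pd h (E \<alpha>) i (E (i # \<alpha>))"
    using D E by (auto simp: hk_family_def)
  from weak_pd_unique[OF this] Cons show ?case by simp
qed

text \<open>The norm is defined through a chosen family of derivatives; uniqueness almost everywhere
  makes it computable from any family at hand, in particular from classical derivatives.\<close>

lemma Hk_sqnorm_eq:
  assumes D: "hk_family L1 L2 h k f D"
  shows "Hk_sqnorm L1 L2 h k f =
    (\<Sum>\<alpha>\<in>{\<alpha>. length \<alpha> \<le> k}. LINT x:cell L1 L2 h|lborel. (D \<alpha> x)\<^sup>2)"
  unfolding Hk_sqnorm_def
proof (rule sum.cong[OF refl])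
  fix \<alpha> :: "3 list" assume a: "\<alpha> \<in> {\<alpha>. length \<alpha> \<le> k}"
  let ?E = "SOME D. hk_family L1 L2 h k f D"
  have E: "hk_family L1 L2 h k f ?E" by (rule someI[of "hk_family L1 L2 h k f"]) (rule D)
  have [measurable]: "D \<alpha> \<in> borel_measurable borel" "?E \<alpha> \<in> borel_measurable borel"
    using D E a by (auto simp: hk_family_def)
  have "AE x in lborel. x \<in> cell L1 L2 h \<longrightarrow> ?E \<alpha> x = D \<alpha> x"
    by (rule AE_cell[OF hk_family_unique[OF E D]]) (use a in auto)
  then show "(LINT x:cell L1 L2 h|lborel. (?E \<alpha> x)\<^sup>2) = (LINT x:cell L1 L2 h|lborel. (D \<alpha> x)\<^sup>2)"
    by (intro set_integral_cong_AE') (auto simp: set_borel_measurable_def)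
qed

lemma hk_family_smooth:
  assumes "smooth f"
  shows "hk_family L1 L2 h k f (\<lambda>\<alpha>. pds \<alpha> f)"
  unfolding hk_family_def
  using assms smooth_pds[OF assms]
  by (auto intro!: borel_measurable_continuous_onI cell_integrable_continuous continuous_on_power
      loc_int_continuous weak_pd_smooth intro: smooth_continuous)

lemma set_integrable_sq_diff:
  fixes u v :: "'a \<Rightarrow> real"
  assumes [measurable]: "u \<in> borel_measurable M" "v \<in> borel_measurable M" "A \<in> sets M"
    and "set_integrable M A (\<lambda>x. (u x)\<^sup>2)" "set_integrable M A (\<lambda>x. (v x)\<^sup>2)"
  shows "set_integrable M A (\<lambda>x. (u x - v x)\<^sup>2)"
  unfolding set_integrable_def
proof (rule Bochner_Integration.integrable_bound)
  show "integrable M (\<lambda>x. 2 * (indicator A x *\<^sub>R (u x)\<^sup>2) + 2 * (indicator A x *\<^sub>R (v x)\<^sup>2))"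
    using assms(4,5) by (auto simp: set_integrable_def)
  have "(a - b)\<^sup>2 \<le> 2 * a\<^sup>2 + 2 * b\<^sup>2" for a b :: real
    using zero_le_power2[of "a + b"] by (simp add: power2_eq_square algebra_simps)
  then show "AE x in M. norm (indicator A x *\<^sub>R (u x - v x)\<^sup>2)
      \<le> norm (2 * (indicator A x *\<^sub>R (u x)\<^sup>2) + 2 * (indicator A x *\<^sub>R (v x)\<^sup>2))"
    by (intro AE_I2) (auto simp: indicator_def)
qed measurable

lemma hk_family_diff:
  assumes "hk_family L1 L2 h k f D" "hk_family L1 L2 h k g E"
  shows "hk_family L1 L2 h k (\<lambda>x. f x - g x) (\<lambda>\<alpha> x. D \<alpha> x - E \<alpha> x)"
  using assms unfolding hk_family_def
  by (auto intro!: weak_pd_diff loc_int_diff set_integrable_sq_diff borel_measurable_diff)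

lemma set_integral_sq_nonneg: "0 \<le> (LINT x:A|M. (f x :: real)\<^sup>2)"
  unfolding set_lebesgue_integral_def by (intro integral_nonneg_AE) auto

lemma finite_lists_3: "finite {\<alpha>::3 list. length \<alpha> \<le> k}"
  using finite_lists_length_le[of "UNIV :: 3 set" k] by simp

text \<open>Each L^2 error is one of the nonnegative summands of the squared Sobolev norm of
  \<open>f - \<phi> n\<close>, so convergence in norm splits into convergence of the function and of
  each derivative.\<close>

lemma H10_approx:
  assumes "H10 L1 L2 h f"
  obtains D \<phi> where "hk_family L1 L2 h 1 f D" "\<And>n. test_per L1 L2 h (\<phi> n)"
    "(\<lambda>n. LINT x:cell L1 L2 h|lborel. (f x - \<phi> n x)\<^sup>2) \<longlonglongrightarrow> 0"
    "\<And>i. (\<lambda>n. LINT x:cell L1 L2 h|lborel. (D [i] x - pd i (\<phi> n) x)\<^sup>2) \<longlonglongrightarrow> 0"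
proof -
  obtain D \<phi> where D: "hk_family L1 L2 h 1 f D" and t: "\<And>n. test_per L1 L2 h (\<phi> n)"
    and lim: "(\<lambda>n. Hk_sqnorm L1 L2 h 1 (\<lambda>x. f x - \<phi> n x)) \<longlonglongrightarrow> 0"
    using assms by (auto simp: H10_def Hk_def)
  have fam: "hk_family L1 L2 h 1 (\<lambda>x. f x - \<phi> n x) (\<lambda>\<alpha> x. D \<alpha> x - pds \<alpha> (\<phi> n) x)" for n
    using t by (intro hk_family_diff D hk_family_smooth) (auto simp: test_per_def)
  have bd: "(LINT x:cell L1 L2 h|lborel. (D \<alpha> x - pds \<alpha> (\<phi> n) x)\<^sup>2) \<le> Hk_sqnorm L1 L2 h 1 (\<lambda>x. f x - \<phi> n x)"
    if "length \<alpha> \<le> 1" for \<alpha> n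
    unfolding Hk_sqnorm_eq[OF fam]
    by (rule member_le_sum[where f="\<lambda>\<alpha>. LINT x:cell L1 L2 h|lborel. (D \<alpha> x - pds \<alpha> (\<phi> n) x)\<^sup>2"])
      (use that finite_lists_3 in \<open>auto intro!: set_integral_sq_nonneg\<close>)
  have lim': "(\<lambda>n. LINT x:cell L1 L2 h|lborel. (D \<alpha> x - pds \<alpha> (\<phi> n) x)\<^sup>2) \<longlonglongrightarrow> 0" if "length \<alpha> \<le> 1" for \<alpha>
    by (rule tendsto_sandwich[OF _ _ tendsto_const lim]) (use bd[OF that] in \<open>auto intro!: always_eventually set_integral_sq_nonneg\<close>)
  have D0: "D [] = f" using D by (simp add: hk_family_def)
  show ?thesis
    by (rule that[OF D t]) (use lim'[of "[]"] lim'[of "[_]"] D0 in auto)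
qed

lemma Hk_smooth: "smooth f \<Longrightarrow> periodic L1 L2 f \<Longrightarrow> Hk L1 L2 h k f"
  unfolding Hk_def using hk_family_smooth by blast

lemma H10_test_per:
  assumes "test_per L1 L2 h f"
  shows "H10 L1 L2 h f"
proof -
  have s: "smooth f" "periodic L1 L2 f" using assms by (auto simp: test_per_def)
  have "hk_family L1 L2 h 1 (\<lambda>x. f x - f x) (\<lambda>\<alpha> x. pds \<alpha> f x - pds \<alpha> f x)"
    by (intro hk_family_diff hk_family_smooth s)
  from Hk_sqnorm_eq[OF this] have "Hk_sqnorm L1 L2 h 1 (\<lambda>x. f x - f x) = 0"
    by (simp add: set_lebesgue_integral_def)
  then show ?thesis unfolding H10_def
    using Hk_smooth[OF s] assms by (intro conjI exI[of _ "\<lambda>n. f"]) auto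
qed

text \<open>A non-integrable \<open>f\<close> has integral 0 by convention, so the bound holds for
  it too. Hence it applies to the nested integral in \<open>deltaN\<close> without an argument about
  its measurability in the point.\<close>

lemma set_integral_abs_bound:
  fixes f g :: "'a \<Rightarrow> real"
  assumes "set_integrable M A g" "AE x in M. x \<in> A \<longrightarrow> \<bar>f x\<bar> \<le> g x"
  shows "\<bar>LINT x:A|M. f x\<bar> \<le> (LINT x:A|M. g x)"
proof -
  have "norm (LINT x|M. indicator A x *\<^sub>R f x) \<le> (LINT x|M. norm (indicator A x *\<^sub>R f x))"
    by (rule integral_norm_bound)
  also have "\<dots> \<le> (LINT x|M. indicator A x *\<^sub>R g x)"
  proof (rule integral_mono_AE')
    show "integrable M (\<lambda>x. indicator A x *\<^sub>R g x)" using assms(1) by (simp add: set_integrable_def)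
    show "AE x in M. norm (indicator A x *\<^sub>R f x) \<le> indicator A x *\<^sub>R g x"
      using assms(2) by (rule AE_mp) (auto simp: indicator_def intro!: AE_I2)
    show "AE x in M. 0 \<le> indicator A x *\<^sub>R g x"
      using assms(2) by (rule AE_mp) (auto simp: indicator_def intro!: AE_I2)
  qed
  finally show ?thesis by (simp add: set_lebesgue_integral_def)
qed

text \<open>Young's inequality with a free weight \<delta> separates the difference of squares into
  a large multiple of the L^2 error and a small multiple of the fixed norm of \<open>u\<close>:
  first \<delta> is chosen small, then n large.\<close>

lemma L2_tendsto:
  fixes u q :: "'a \<Rightarrow> real" and v :: "nat \<Rightarrow> 'a \<Rightarrow> real"
  assumes [measurable]: "u \<in> borel_measurable M" "\<And>n. v n \<in> borel_measurable M" "q \<in> borel_measurable M"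
      "A \<in> sets M"
    and u: "set_integrable M A (\<lambda>x. (u x)\<^sup>2)" and v: "\<And>n. set_integrable M A (\<lambda>x. (v n x)\<^sup>2)"
    and q: "\<And>x. x \<in> A \<Longrightarrow> \<bar>q x\<bar> \<le> Q"
    and lim: "(\<lambda>n. LINT x:A|M. (u x - v n x)\<^sup>2) \<longlonglongrightarrow> 0"
  shows "(\<lambda>n. LINT x:A|M. q x * (v n x)\<^sup>2) \<longlonglongrightarrow> (LINT x:A|M. q x * (u x)\<^sup>2)"
proof -
  \<comment> \<open>On an empty \<open>A\<close> the bound \<open>Q\<close> could be
    negative.\<close>
  define Q' where "Q' = max Q 0"
  have q': "\<bar>q x\<bar> \<le> Q'" if "x \<in> A" for x using q[OF that] by (simp add: Q'_def)
  have Q'0: "Q' \<ge> 0" by (simp add: Q'_def)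
  have d: "set_integrable M A (\<lambda>x. (u x - v n x)\<^sup>2)" for n
    by (intro set_integrable_sq_diff u v) measurable
  have qi: "set_integrable M A (\<lambda>x. q x * (f x)\<^sup>2)"
    if [measurable]: "f \<in> borel_measurable M" and f: "set_integrable M A (\<lambda>x. (f x)\<^sup>2)" for f
    unfolding set_integrable_def
  proof (rule Bochner_Integration.integrable_bound)
    show "integrable M (\<lambda>x. Q' * (indicator A x *\<^sub>R (f x)\<^sup>2))" using f by (simp add: set_integrable_def)
    show "AE x in M. norm (indicator A x *\<^sub>R (q x * (f x)\<^sup>2)) \<le> norm (Q' * (indicator A x *\<^sub>R (f x)\<^sup>2))"
      using q' Q'0 by (intro AE_I2) (auto simp: indicator_def abs_mult intro!: mult_right_mono)
  qed measurable
  have key: "\<bar>(LINT x:A|M. q x * (v n x)\<^sup>2) - (LINT x:A|M. q x * (u x)\<^sup>2)\<bar>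
     \<le> Q' * (1 + 1 / \<delta>) * (LINT x:A|M. (u x - v n x)\<^sup>2) + Q' * \<delta> * (LINT x:A|M. (u x)\<^sup>2)"
    if "\<delta> > 0" for \<delta> n
  proof -
    have pt: "\<bar>b\<^sup>2 - a\<^sup>2\<bar> \<le> (1 + 1 / \<delta>) * (a - b)\<^sup>2 + \<delta> * a\<^sup>2" for a b :: real
    proof -
      have "2 * (\<bar>a - b\<bar> * \<bar>a\<bar>) \<le> (a - b)\<^sup>2 / \<delta> + \<delta> * a\<^sup>2"
      proof -
        have "0 \<le> (\<bar>a - b\<bar> - \<delta> * \<bar>a\<bar>)\<^sup>2 / \<delta>" using that by simp
        also have "\<dots> = (a - b)\<^sup>2 / \<delta> + \<delta> * a\<^sup>2 - 2 * (\<bar>a - b\<bar> * \<bar>a\<bar>)"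
          using that by (simp add: power2_diff power_mult_distrib field_simps power2_eq_square)
        finally show ?thesis by simp
      qed
      moreover have "\<bar>b\<^sup>2 - a\<^sup>2\<bar> \<le> (a - b)\<^sup>2 + 2 * (\<bar>a - b\<bar> * \<bar>a\<bar>)"
      proof -
        have "b\<^sup>2 - a\<^sup>2 = (a - b)\<^sup>2 - 2 * ((a - b) * a)" by (simp add: power2_eq_square algebra_simps)
        then show ?thesis using abs_triangle_ineq4[of "(a - b)\<^sup>2" "2 * ((a - b) * a)"] by (simp add: abs_mult)
      qed
      ultimately show ?thesis by (simp add: algebra_simps)
    qed
    have "(LINT x:A|M. q x * (v n x)\<^sup>2) - (LINT x:A|M. q x * (u x)\<^sup>2) = (LINT x:A|M. q x * (v n x)\<^sup>2 - q x * (u x)\<^sup>2)"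
      by (rule set_integral_diff(2)[symmetric]) (intro qi u v, measurable)+
    also have "\<bar>\<dots>\<bar> \<le> (LINT x:A|M. Q' * (1 + 1 / \<delta>) * (u x - v n x)\<^sup>2 + Q' * \<delta> * (u x)\<^sup>2)"
    proof (rule set_integral_abs_bound)
      show "set_integrable M A (\<lambda>x. Q' * (1 + 1 / \<delta>) * (u x - v n x)\<^sup>2 + Q' * \<delta> * (u x)\<^sup>2)"
        using d[of n] u by (intro set_integral_add(1) set_integrable_mult_right) auto
      have "\<bar>q x * (v n x)\<^sup>2 - q x * (u x)\<^sup>2\<bar> \<le> Q' * (1 + 1 / \<delta>) * (u x - v n x)\<^sup>2 + Q' * \<delta> * (u x)\<^sup>2"
        if "x \<in> A" for x
      proof -
        have "\<bar>q x\<bar> * \<bar>(v n x)\<^sup>2 - (u x)\<^sup>2\<bar> \<le> Q' * ((1 + 1 / \<delta>) * (u x - v n x)\<^sup>2 + \<delta> * (u x)\<^sup>2)"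
          by (intro mult_mono q'[OF that] pt Q'0) auto
        also have "\<dots> = Q' * (1 + 1 / \<delta>) * (u x - v n x)\<^sup>2 + Q' * \<delta> * (u x)\<^sup>2"
          by (simp add: algebra_simps)
        finally show ?thesis
          unfolding right_diff_distrib[symmetric] abs_mult .
      qed
      then show "AE x in M. x \<in> A \<longrightarrow> \<bar>q x * (v n x)\<^sup>2 - q x * (u x)\<^sup>2\<bar>
          \<le> Q' * (1 + 1 / \<delta>) * (u x - v n x)\<^sup>2 + Q' * \<delta> * (u x)\<^sup>2" by simp
    qed
    also have "\<dots> = Q' * (1 + 1 / \<delta>) * (LINT x:A|M. (u x - v n x)\<^sup>2) + Q' * \<delta> * (LINT x:A|M. (u x)\<^sup>2)"
      using d u by (subst set_integral_add(2)) auto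
    finally show ?thesis .
  qed
  show ?thesis
  proof (rule LIMSEQ_I)
    fix e :: real assume "e > 0"
    define U where "U = (LINT x:A|M. (u x)\<^sup>2)"
    have "U \<ge> 0" unfolding U_def by (rule set_integral_sq_nonneg)
    \<comment> \<open>This makes the part that does not depend on n less than e/2; adding 1 keeps
      the denominator positive when Q' U = 0.\<close>
    define \<delta> where "\<delta> = e / (2 * (Q' * U + 1))"
    have "\<delta> > 0" using \<open>e > 0\<close> \<open>U \<ge> 0\<close> Q'0 by (auto simp: \<delta>_def intro!: divide_pos_pos add_nonneg_pos)
    have "Q' * \<delta> * U < e / 2"
    proof -
      have "Q' * \<delta> * U = e / 2 * (Q' * U / (Q' * U + 1))" by (simp add: \<delta>_def)
      also have "\<dots> < e / 2 * 1"
        using \<open>e > 0\<close> mult_nonneg_nonneg[OF Q'0 \<open>U \<ge> 0\<close>]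
        by (intro mult_strict_left_mono) (simp_all add: divide_less_eq)
      finally show ?thesis by simp
    qed
    have "(\<lambda>n. Q' * (1 + 1 / \<delta>) * (LINT x:A|M. (u x - v n x)\<^sup>2)) \<longlonglongrightarrow> Q' * (1 + 1 / \<delta>) * 0"
      by (intro tendsto_intros lim)
    then have "\<forall>\<^sub>F n in sequentially. Q' * (1 + 1 / \<delta>) * (LINT x:A|M. (u x - v n x)\<^sup>2) < e / 2"
      using \<open>e > 0\<close> by (intro order_tendstoD(2)[where y="Q' * (1 + 1 / \<delta>) * 0"]) auto
    then obtain N where N: "\<And>n. n \<ge> N \<Longrightarrow> Q' * (1 + 1 / \<delta>) * (LINT x:A|M. (u x - v n x)\<^sup>2) < e / 2"
      by (auto simp: eventually_sequentially)
    show "\<exists>N. \<forall>n\<ge>N. norm ((LINT x:A|M. q x * (v n x)\<^sup>2) - (LINT x:A|M. q x * (u x)\<^sup>2)) < e"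
    proof (intro exI[of _ N] allI impI)
      fix n assume "n \<ge> N"
      show "norm ((LINT x:A|M. q x * (v n x)\<^sup>2) - (LINT x:A|M. q x * (u x)\<^sup>2)) < e"
        using key[OF \<open>\<delta> > 0\<close>, of n] N[OF \<open>n \<ge> N\<close>] \<open>Q' * \<delta> * U < e / 2\<close> unfolding U_def real_norm_def by linarith
    qed
  qed
qed

section \<open>Integration along lines\<close>

text \<open>The last argument is the coordinate in direction k, the one integrated innermost.
  Permuting i, j, k selects which direction that is.\<close>

definition vec3 :: "3 \<Rightarrow> 3 \<Rightarrow> 3 \<Rightarrow> (real \<times> real) \<Rightarrow> real \<Rightarrow> real^3" where
  "vec3 i j k p c = fst p *\<^sub>R axis i 1 + snd p *\<^sub>R axis j 1 + c *\<^sub>R axis k 1"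

lemma vec3_nth:
  assumes "distinct [i, j, k]"
  shows "vec3 i j k p c $ i = fst p" "vec3 i j k p c $ j = snd p" "vec3 i j k p c $ k = c"
  using assms by (auto simp: vec3_def axis_def)

lemma UNIV_3_distinct:
  assumes "distinct [i, j, k :: 3]"
  shows "UNIV = {i, j, k}"
proof -
  have "card {i, j, k} = CARD(3)" using assms by simp
  then show ?thesis by (intro card_subset_eq[symmetric]) auto
qed

lemma all_3_distinct: "distinct [i, j, k :: 3] \<Longrightarrow> (\<forall>l. P l) \<longleftrightarrow> P i \<and> P j \<and> P k"
  using UNIV_3_distinct[of i j k] by (metis UNIV_I insertE singletonD)

lemma continuous_vec3: "continuous_on UNIV (\<lambda>x. vec3 i j k (fst x) (snd x))"
  unfolding vec3_def by (intro continuous_intros)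

lemma vec3_measurable [measurable]: "(\<lambda>x. vec3 i j k (fst x) (snd x)) \<in> borel_measurable borel"
  by (rule borel_measurable_continuous_onI[OF continuous_vec3])

text \<open>Lebesgue measure is determined by its values on boxes, and the preimage of a box is a
  product of three intervals, whatever the order of the coordinates.\<close>

lemma lborel_vec3:
  assumes d: "distinct [i, j, k]"
  shows "distr lborel borel (\<lambda>x. vec3 i j k (fst x) (snd x)) = (lborel :: (real^3) measure)"
proof (rule lborel_eqI[symmetric])
  fix l u :: "real^3" assume le: "\<And>b. b \<in> Basis \<Longrightarrow> l \<bullet> b \<le> u \<bullet> b"
  have le': "l $ m \<le> u $ m" for m using le[of "axis m 1"] by (simp add: inner_axis axis_in_Basis_iff)
  let ?V = "\<lambda>x. vec3 i j k (fst x) (snd x)"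
  have pre: "?V -` box l u = ({l$i<..<u$i} \<times> {l$j<..<u$j}) \<times> {l$k<..<u$k}"
    unfolding box_vec_eq_empty mem_box_cart
    by (auto simp: mem_box_cart all_3_distinct[OF d] vec3_nth[OF d])
  have "emeasure (distr lborel borel ?V) (box l u) = emeasure lborel (?V -` box l u)"
    by (subst emeasure_distr) auto
  also have "\<dots> = emeasure (lborel \<Otimes>\<^sub>M lborel) (({l$i<..<u$i} \<times> {l$j<..<u$j}) \<times> {l$k<..<u$k})"
    unfolding pre lborel_prod ..
  also have "\<dots> = emeasure lborel ({l$i<..<u$i} \<times> {l$j<..<u$j}) * emeasure lborel {l$k<..<u$k}"
    by (rule lborel.emeasure_pair_measure_Times) (auto intro!: borel_open open_Times)
  also have "emeasure lborel ({l$i<..<u$i} \<times> {l$j<..<u$j}) = emeasure (lborel \<Otimes>\<^sub>M lborel) ({l$i<..<u$i} \<times> {l$j<..<u$j})"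
    unfolding lborel_prod ..
  also have "\<dots> = emeasure lborel {l$i<..<u$i} * emeasure lborel {l$j<..<u$j}"
    by (rule lborel.emeasure_pair_measure_Times) auto
  also have "\<dots> * emeasure lborel {l$k<..<u$k} = ennreal ((u$i - l$i) * (u$j - l$j) * (u$k - l$k))"
    using le' by (simp add: ennreal_mult)
  also have "(u$i - l$i) * (u$j - l$j) * (u$k - l$k) = (\<Prod>m\<in>UNIV. (u - l) $ m)"
    unfolding UNIV_3_distinct[OF d] using d by auto
  also have "\<dots> = (\<Prod>b\<in>Basis. (u - l) \<bullet> b)"
  proof -
    have B: "(Basis :: (real^3) set) = (\<lambda>m. axis m 1) ` UNIV" by (auto simp: Basis_vec_def)
    have "inj (\<lambda>m::3. axis m (1::real))" by (auto simp: inj_on_def axis_eq_axis)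
    then have "(\<Prod>b\<in>(\<lambda>m::3. axis m 1) ` UNIV. (u - l) \<bullet> b) = (\<Prod>m\<in>UNIV. (u - l) \<bullet> axis m 1)"
      by (subst prod.reindex) simp_all
    then show ?thesis unfolding B by (simp add: inner_axis)
  qed
  finally show "emeasure (distr lborel borel ?V) (box l u) = (\<Prod>b\<in>Basis. (u - l) \<bullet> b)" .
qed simp

definition side :: "real \<Rightarrow> real \<Rightarrow> real \<Rightarrow> 3 \<Rightarrow> real" where
  "side L1 L2 h i = (if i = 1 then 2*pi*L1 else if i = 2 then 2*pi*L2 else h)"

lemma side_simps [simp]: "side L1 L2 h 1 = 2*pi*L1" "side L1 L2 h 2 = 2*pi*L2" "side L1 L2 h 3 = h"
  by (auto simp: side_def)

lemma cell_side: "cell L1 L2 h = {x. \<forall>i. 0 < x $ i \<and> x $ i < side L1 L2 h i}"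
  by (auto simp: cell_def forall_3)

text \<open>Besides the iterated integral, integrability of the inner integral is recorded: it is
  what permits comparing two cell integrals line by line in
  \<open>line_inequality_smooth\<close>.\<close>

lemma fubini_cell:
  fixes F :: "real^3 \<Rightarrow> real" and L1 L2 h :: real
  assumes d: "distinct [i, j, k]" and F: "continuous_on UNIV F"
  defines "R \<equiv> {0<..<side L1 L2 h i} \<times> {0<..<side L1 L2 h j}"
  shows "set_integrable lborel R (\<lambda>p. LINT c:{0<..<side L1 L2 h k}|lborel. F (vec3 i j k p c))" (is ?A)
    and "(LINT x:cell L1 L2 h|lborel. F x) =
      (LINT p:R|lborel. (LINT c:{0<..<side L1 L2 h k}|lborel. F (vec3 i j k p c)))" (is ?B)
proof -
  let ?V = "\<lambda>x. vec3 i j k (fst x) (snd x)"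
  let ?G = "\<lambda>x. indicator (cell L1 L2 h) x *\<^sub>R F x"
  have int: "integrable lborel ?G" using cell_integrable_continuous[OF F] by (simp add: set_integrable_def)
  have [measurable]: "F \<in> borel_measurable borel" using F by (rule borel_measurable_continuous_onI)
  have ind: "indicator (cell L1 L2 h) (vec3 i j k p c) = (indicator R p * indicator {0<..<side L1 L2 h k} c :: real)" for p c
    by (cases p) (auto simp: R_def cell_side all_3_distinct[OF d] vec3_nth[OF d] indicator_def)
  have "integrable (distr lborel borel ?V) ?G" unfolding lborel_vec3[OF d] by (rule int)
  then have i1: "integrable (lborel \<Otimes>\<^sub>M lborel) (\<lambda>x. ?G (?V x))"
    by (subst (asm) integrable_distr_eq) (auto simp: lborel_prod)
  have "integrable lborel (\<lambda>p. LINT c|lborel. ?G (?V (p, c)))"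
    using lborel_pair.integrable_fst'[OF i1] by simp
  moreover have inner: "(LINT c|lborel. ?G (?V (p, c))) = indicator R p *\<^sub>R (LINT c:{0<..<side L1 L2 h k}|lborel. F (vec3 i j k p c))" for p
    by (simp add: ind set_lebesgue_integral_def mult.assoc)
  ultimately show ?A by (simp add: set_integrable_def)
  have "(LINT x:cell L1 L2 h|lborel. F x) = integral\<^sup>L (distr lborel borel ?V) ?G"
    unfolding lborel_vec3[OF d] by (simp add: set_lebesgue_integral_def)
  also have "\<dots> = (LINT x|lborel. ?G (?V x))"
    by (rule integral_distr) auto
  also have "\<dots> = (LINT x|(lborel \<Otimes>\<^sub>M lborel). ?G (?V x))" unfolding lborel_prod ..
  also have "\<dots> = (LINT p|lborel. LINT c|lborel. ?G (?V (p, c)))"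
    using lborel_pair.integral_fst'[OF i1] by simp
  finally show ?B unfolding inner by (simp add: set_lebesgue_integral_def)
qed

section \<open>Invariance of cell integrals under horizontal shears\<close>

lemma set_integral_open_interval:
  fixes f :: "real \<Rightarrow> real"
  assumes "continuous_on {a..b} f"
  shows "(LINT x:{a<..<b}|lborel. f x) = integral {a..b} f"
proof -
  have "set_integrable lborel {a..b} f" using borel_integrable_atLeastAtMost'[OF assms] .
  then have "set_integrable lborel {a<..<b} f" by (rule set_integrable_subset) auto
  from set_borel_integral_eq_integral(2)[OF this] show ?thesis
    by (simp add: integral_open_interval_real)
qed

text \<open>For an antiderivative G, the function G(t + P) - G(t) has derivative f(t + P) - f(t) =
  0, so the integral over a full period does not depend on its starting point.\<close>

lemma periodic_integral_shift:
  fixes f :: "real \<Rightarrow> real"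
  assumes f: "continuous_on UNIV f" and P: "0 < P" "\<And>x. f (x + P) = f x"
  shows "(LINT x:{0<..<P}|lborel. f (x + c)) = (LINT x:{0<..<P}|lborel. f x)"
proof -
  \<comment> \<open>Large enough that all the integration intervals and a neighbourhood of them lie
    strictly inside, where G is differentiable in the two-sided sense.\<close>
  define A where "A = \<bar>c\<bar> + P + 2"
  obtain G where G: "\<And>x. x \<in> {-A..A} \<Longrightarrow> (G has_vector_derivative f x) (at x within {-A..A})"
    using antiderivative_continuous[of "-A" A f] f by (auto intro: continuous_on_subset)
  have G': "(G has_real_derivative f x) (at x)" if "x \<in> {-A<..<A}" for x
    using G[of x] that at_within_Icc_at[of "-A" x A] by (auto simp: has_real_derivative_iff_has_vector_derivative)
  have ftc: "integral {a..a+P} f = G (a + P) - G a" if "\<bar>a\<bar> \<le> \<bar>c\<bar>" for a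
  proof (rule integral_unique, rule fundamental_theorem_of_calculus)
    show "(G has_vector_derivative f x) (at x within {a..a+P})" if "x \<in> {a..a+P}" for x
    proof -
      have "x \<in> {-A<..<A}" using that \<open>\<bar>a\<bar> \<le> \<bar>c\<bar>\<close> by (auto simp: A_def)
      from G'[OF this] show ?thesis
        unfolding has_real_derivative_iff_has_vector_derivative by (rule has_vector_derivative_at_within)
    qed
  qed (use P in auto)
  have "G (c + P) - G c = G (0 + P) - G 0"
  proof (rule DERIV_isconst3[of "-\<bar>c\<bar> - 1" "\<bar>c\<bar> + 1" c 0 "\<lambda>t. G (t + P) - G t"])
    fix x assume x: "x \<in> {-\<bar>c\<bar> - 1<..<\<bar>c\<bar> + 1}"
    have "((\<lambda>t. G (t + P)) has_real_derivative f (x + P)) (at x)"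
      using G'[of "x + P"] x P by (auto simp: A_def DERIV_shift)
    from DERIV_diff[OF this G'[of x]] show "((\<lambda>t. G (t + P) - G t) has_real_derivative 0) (at x)"
      using x P by (auto simp: A_def)
  qed auto
  then have eq: "integral {c..c+P} f = integral {0..P} f" using ftc[of c] ftc[of 0] by simp
  have "(LINT x:{0<..<P}|lborel. f (x + c)) = integral {0..P} (\<lambda>x. f (x + c))"
    by (intro set_integral_open_interval continuous_on_compose2[OF f] continuous_intros) auto
  also have "\<dots> = G (P + c) - G (0 + c)"
  proof (rule integral_unique, rule fundamental_theorem_of_calculus)
    fix x assume x: "x \<in> {0..P}"
    have "x + c \<in> {-A<..<A}" using x by (auto simp: A_def)
    from G'[OF this] have "((\<lambda>x. G (x + c)) has_real_derivative f (x + c)) (at x)" by (simp add: DERIV_shift)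
    then show "((\<lambda>x. G (x + c)) has_vector_derivative f (x + c)) (at x within {0..P})"
      unfolding has_real_derivative_iff_has_vector_derivative by (rule has_vector_derivative_at_within)
  qed (use P in auto)
  also have "\<dots> = integral {c..c+P} f" using ftc[of c] by (simp add: add.commute)
  also have "\<dots> = (LINT x:{0<..<P}|lborel. f x)"
    unfolding eq by (rule set_integral_open_interval[symmetric]) (rule continuous_on_subset[OF f], simp)
  finally show ?thesis .
qed

lemma periodic_side:
  assumes "periodic L1 L2 F" "i \<noteq> 3"
  shows "F (x + side L1 L2 h i *\<^sub>R axis i 1) = F x"
proof -
  have "i = 1 \<or> i = 2" using assms(2) exhaust_3[of i] by auto
  then show ?thesis using assms(1) by (auto simp: periodic_def)
qed

text \<open>With x_3 and the other horizontal coordinate frozen, the shear is a translation in the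
  periodic direction i; integrating over that direction first makes it disappear.\<close>

lemma shear_invariance:
  fixes F :: "real^3 \<Rightarrow> real"
  assumes L: "0 < L1" "0 < L2" and F: "continuous_on UNIV F" "periodic L1 L2 F" and i: "i \<noteq> 3"
  shows "(LINT x:cell L1 L2 h|lborel. F (x + (v * x $ 3) *\<^sub>R axis i 1)) = (LINT x:cell L1 L2 h|lborel. F x)"
proof -
  obtain j :: 3 where d: "distinct [j, 3, i]"
  proof (cases "i = 1")
    case True then show ?thesis using that[of 2] by simp
  next
    case False then show ?thesis using that[of 1] i by simp
  qed
  let ?s = "side L1 L2 h"
  have pos: "0 < ?s i" using L i exhaust_3[of i] by auto
  have c1: "continuous_on UNIV (\<lambda>x. F (x + (v * x $ 3) *\<^sub>R axis i 1))"
    by (intro continuous_on_compose2[OF F(1)] continuous_intros) auto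
  have "(LINT c:{0<..<?s i}|lborel. F (vec3 j 3 i p c + (v * vec3 j 3 i p c $ 3) *\<^sub>R axis i 1))
      = (LINT c:{0<..<?s i}|lborel. F (vec3 j 3 i p c))" for p
  proof -
    have "vec3 j 3 i p c + (v * vec3 j 3 i p c $ 3) *\<^sub>R axis i 1 = vec3 j 3 i p (c + v * snd p)" for c
      by (simp add: vec3_nth[OF d]) (simp add: vec3_def scaleR_left_distrib)
    moreover have "(LINT c:{0<..<?s i}|lborel. F (vec3 j 3 i p (c + v * snd p))) = (LINT c:{0<..<?s i}|lborel. F (vec3 j 3 i p c))"
    proof (rule periodic_integral_shift[OF _ pos])
      show "continuous_on UNIV (\<lambda>c. F (vec3 j 3 i p c))"
        unfolding vec3_def by (intro continuous_on_compose2[OF F(1)] continuous_intros) auto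
      have "vec3 j 3 i p (x + ?s i) = vec3 j 3 i p x + ?s i *\<^sub>R axis i 1" for x
        by (simp add: vec3_def scaleR_left_distrib)
      then show "F (vec3 j 3 i p (x + ?s i)) = F (vec3 j 3 i p x)" for x
        using periodic_side[OF F(2) i] by simp
    qed
    ultimately show ?thesis by simp
  qed
  then show ?thesis
    unfolding fubini_cell(2)[OF d c1] fubini_cell(2)[OF d F(1)] by simp
qed

text \<open>The map x + x_3 (v - e_3) carries vertical lines to lines parallel to v and preserves
  heights. As v - e_3 is horizontal, the map is composed of shears along the two horizontal
  axes.\<close>

lemma double_shear_invariance:
  fixes F :: "real^3 \<Rightarrow> real"
  assumes L: "0 < L1" "0 < L2" and F: "continuous_on UNIV F" "periodic L1 L2 F" and v: "v $ 3 = 1"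
  shows "(LINT x:cell L1 L2 h|lborel. F (x + x $ 3 *\<^sub>R (v - axis 3 1))) = (LINT x:cell L1 L2 h|lborel. F x)"
proof -
  define G where "G x = F (x + (v$1 * x $ 3) *\<^sub>R axis 1 1)" for x
  have cG: "continuous_on UNIV G" unfolding G_def
    by (intro continuous_on_compose2[OF F(1)] continuous_intros) auto
  have pG: "periodic L1 L2 G"
    unfolding periodic_def
  proof (intro allI conjI)
    fix x :: "real^3"
    let ?y = "x + (v$1 * x$3) *\<^sub>R axis 1 1"
    have "G (x + (2*pi*L1) *\<^sub>R axis 1 1) = F (?y + (2*pi*L1) *\<^sub>R axis 1 1)"
      by (simp add: G_def axis_def algebra_simps)
    then show "G (x + (2*pi*L1) *\<^sub>R axis 1 1) = G x" using F(2) by (simp add: periodic_def G_def)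
    have "G (x + (2*pi*L2) *\<^sub>R axis 2 1) = F (?y + (2*pi*L2) *\<^sub>R axis 2 1)"
      by (simp add: G_def axis_def algebra_simps)
    then show "G (x + (2*pi*L2) *\<^sub>R axis 2 1) = G x" using F(2) by (simp add: periodic_def G_def)
  qed
  have v': "v - axis 3 1 = v$1 *\<^sub>R axis 1 1 + v$2 *\<^sub>R axis 2 1"
    using v by (auto simp: vec_eq_iff forall_3 axis_def)
  have "F (x + x $ 3 *\<^sub>R (v - axis 3 1)) = G (x + (v$2 * x $ 3) *\<^sub>R axis 2 1)" for x
    unfolding v' G_def by (simp add: axis_def[of 2] algebra_simps)
  then show ?thesis
    using shear_invariance[OF L cG pG, of 2 h "v$2"] shear_invariance[OF L F, of 1 h "v$1"]
    by (simp add: G_def)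
qed

text \<open>\<open>\<Psi> m\<close> is the \<open>m\<close>-th derivative of \<open>\<Psi> 0\<close>.\<close>

definition bump_seq :: "real \<Rightarrow> (nat \<Rightarrow> real \<Rightarrow> real) \<Rightarrow> bool" where
  "bump_seq h \<Psi> \<longleftrightarrow> (\<forall>m t. (\<Psi> m has_real_derivative \<Psi> (Suc m) t) (at t)) \<and>
     (\<exists>c d. 0 < c \<and> c < d \<and> d < h \<and> (\<forall>m t. t \<notin> {c<..<d} \<longrightarrow> \<Psi> m t = 0))"

definition dird :: "real^3 \<Rightarrow> (real^3 \<Rightarrow> real) \<Rightarrow> real^3 \<Rightarrow> real" where
  "dird v f x = (\<Sum>i\<in>UNIV. v $ i * pd i f x)"

section \<open>Test functions restricted to lines\<close>

lemma smooth_dird_pow: "smooth f \<Longrightarrow> smooth ((dird v ^^ m) f)"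
  by (induction m) (auto simp: dird_def[abs_def] intro!: smooth_sum_cmult smooth_pd)

lemma dird_pow_zero:
  assumes "open U" "\<And>x. x \<in> U \<Longrightarrow> f x = 0" "x \<in> U"
  shows "(dird v ^^ m) f x = 0"
  using assms(3)
proof (induction m arbitrary: x)
  case (Suc m)
  have "pd i ((dird v ^^ m) f) x = pd i (\<lambda>x. 0) x" for i
    by (rule pd_cong_open[OF assms(1) Suc.prems]) (use Suc.IH in auto)
  then show ?case by (simp add: dird_def[of v "(dird v ^^ m) f"])
qed (use assms in auto)

lemma periodic_pd:
  assumes "periodic L1 L2 f" shows "periodic L1 L2 (pd i f)"
proof -
  have *: "f (x + (2*pi*L1) *\<^sub>R axis 1 1 + y) = f (x + y)" "f (x + (2*pi*L2) *\<^sub>R axis 2 1 + y) = f (x + y)" for x y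
  proof -
    have "x + (2*pi*L1) *\<^sub>R axis 1 1 + y = (x + y) + (2*pi*L1) *\<^sub>R axis 1 1"
      "x + (2*pi*L2) *\<^sub>R axis 2 1 + y = (x + y) + (2*pi*L2) *\<^sub>R axis 2 1" by simp_all
    then show "f (x + (2*pi*L1) *\<^sub>R axis 1 1 + y) = f (x + y)" "f (x + (2*pi*L2) *\<^sub>R axis 2 1 + y) = f (x + y)"
      using assms[unfolded periodic_def, rule_format, of "x + y"] by metis+
  qed
  show ?thesis unfolding periodic_def pd_def * by simp
qed

text \<open>Membership in \<open>test_per\<close> constrains a function only inside the strip, so
  its restriction to a line may be nonzero beyond [0,h]. Cutting it off there yields a genuine bump
  and changes nothing on (0,h).\<close>

lemma line_bump_seq:
  assumes t: "test_per L1 L2 h \<phi>" and v: "v $ 3 = 1" and y: "y $ 3 = 0"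
  obtains \<Psi> where "bump_seq h \<Psi>" "\<And>m t. t \<in> {0<..<h} \<Longrightarrow> \<Psi> m t = (dird v ^^ m) \<phi> (y + t *\<^sub>R v)"
proof -
  obtain c d where cd: "0 < c" "c < d" "d < h" and z: "\<And>x. x \<in> strip h \<Longrightarrow> x$3 \<notin> {c<..<d} \<Longrightarrow> \<phi> x = 0"
    and s: "smooth \<phi>" using t by (auto simp: test_per_def)
  define u where "u m t = (dird v ^^ m) \<phi> (y + t *\<^sub>R v)" for m t
  have comp: "(y + t *\<^sub>R v) $ 3 = t" for t using v y by simp
  have du: "(u m has_real_derivative u (Suc m) t) (at t)" for m t
    unfolding u_def[abs_def] using line_derivative[of "(dird v ^^ m) \<phi>" y v t] smooth_dird_pow[OF s]
    by (simp add: dird_def[of v "(dird v ^^ m) \<phi>"] smooth_differentiable)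
  define U where "U = {x::real^3. 0 < x$3 \<and> x$3 < c} \<union> {x. d < x$3 \<and> x$3 < h}"
  have "open U" unfolding U_def
    by (intro open_Un open_Collect_conj open_Collect_less continuous_intros)
  moreover have "\<phi> x = 0" if "x \<in> U" for x
    using that cd by (intro z) (auto simp: U_def strip_def)
  ultimately have uz: "u m t = 0" if "0 < t \<and> t < c \<or> d < t \<and> t < h" for m t
    unfolding u_def using that comp[of t] by (intro dird_pow_zero[of U]) (auto simp: U_def)
  \<comment> \<open>The support interval is widened a little: the restriction and all its
    derivatives vanish on both added margins, so the cut produces no jump.\<close>
  define c' d' where "c' = c / 2" and "d' = (d + h) / 2"
  have cd': "0 < c'" "c' < c" "d < d'" "d' < h" using cd by (auto simp: c'_def d'_def)
  define \<Psi> where "\<Psi> m t = (if c' < t \<and> t < d' then u m t else 0)" for m t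
  have \<Psi>u: "\<Psi> m t = u m t" if "t \<in> {0<..<h}" for m t
    using that cd' cd uz[of t m] by (auto simp: \<Psi>_def)
  have "(\<Psi> m has_real_derivative \<Psi> (Suc m) t) (at t)" for m t
  proof (cases "t \<in> {0<..<h}")
    case True
    have "(u m has_real_derivative \<Psi> (Suc m) t) (at t)" using du[of m t] \<Psi>u[OF True] by simp
    moreover have "eventually (\<lambda>s. u m s = \<Psi> m s) (nhds t)"
      by (rule eventually_mono[OF eventually_nhds_in_open[of "{0<..<h}" t]]) (use True \<Psi>u in auto)
    ultimately show ?thesis using DERIV_cong_ev[OF refl _ refl] by blast
  next
    case False
    have "eventually (\<lambda>s. s \<in> - {c'..d'}) (nhds t)"
      using False cd' by (intro eventually_nhds_in_open) auto
    then have ev: "eventually (\<lambda>s. 0 = \<Psi> m s) (nhds t)"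
      by (rule eventually_mono) (auto simp: \<Psi>_def)
    have "((\<lambda>t. 0) has_real_derivative \<Psi> (Suc m) t) (at t)"
      using False cd' by (auto simp: \<Psi>_def)
    then show ?thesis using DERIV_cong_ev[OF refl ev refl] by simp
  qed
  moreover have "0 < c' \<and> c' < d' \<and> d' < h \<and> (\<forall>m t. t \<notin> {c'<..<d'} \<longrightarrow> \<Psi> m t = 0)"
    using cd cd' by (auto simp: \<Psi>_def)
  ultimately have "bump_seq h \<Psi>" unfolding bump_seq_def by blast
  then show ?thesis using that[of \<Psi>] \<Psi>u by (auto simp: u_def)
qed

text \<open>The shear turns the cell into a bundle of segments parallel to v, on each of which
  \<open>hyp\<close> applies. The weight depends on the height alone, hence is the same function on
  every segment, and v_3 = 1 makes the height the parameter of the segment.\<close>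

lemma line_inequality_smooth:
  assumes L: "0 < L1" "0 < L2" and q: "continuous_on UNIV q" and v: "v $ 3 = 1"
    and hyp: "\<And>\<Psi>. bump_seq h \<Psi> \<Longrightarrow>
      (LINT t:{0<..<h}|lborel. q t * (\<Psi> 0 t)\<^sup>2) \<le> \<kappa> * (LINT t:{0<..<h}|lborel. (\<Psi> 1 t)\<^sup>2)"
    and t: "test_per L1 L2 h \<phi>"
  shows "(LINT x:cell L1 L2 h|lborel. q (x$3) * (\<phi> x)\<^sup>2) \<le> \<kappa> * (LINT x:cell L1 L2 h|lborel. (dird v \<phi> x)\<^sup>2)"
proof -
  have s: "smooth \<phi>" and per: "periodic L1 L2 \<phi>" using t by (auto simp: test_per_def)
  have sd: "smooth (dird v \<phi>)" using smooth_dird_pow[OF s, where v=v and m=1] by simp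
  define F1 where "F1 x = q (x$3) * (\<phi> x)\<^sup>2" for x :: "real^3"
  define F2 where "F2 x = (dird v \<phi> x)\<^sup>2" for x :: "real^3"
  have c1: "continuous_on UNIV F1" unfolding F1_def
    by (intro continuous_on_mult continuous_on_power smooth_continuous[OF s] continuous_on_compose2[OF q] continuous_intros) auto
  have c2: "continuous_on UNIV F2" unfolding F2_def
    by (intro continuous_on_power smooth_continuous[OF sd])
  have "periodic L1 L2 F1" using per by (simp add: F1_def periodic_def axis_def)
  have "periodic L1 L2 F2" using periodic_pd[OF per] by (simp add: F2_def dird_def periodic_def)
  let ?S = "\<lambda>x. x + x $ 3 *\<^sub>R (v - axis 3 1)"
  let ?R = "{0<..<side L1 L2 h 1} \<times> {0<..<side L1 L2 h 2}"
  have d: "distinct [1, 2, 3 :: 3]" by simp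
  have cS: "continuous_on UNIV (\<lambda>x. F (?S x))" if "continuous_on UNIV F" for F :: "real^3 \<Rightarrow> real"
    by (intro continuous_on_compose2[OF that] continuous_intros) auto
  have S: "?S (vec3 1 2 3 p c) = vec3 1 2 3 p 0 + c *\<^sub>R v" for p c
    by (simp add: vec3_nth[OF d]) (simp add: vec3_def scaleR_right_diff_distrib)
  have "(LINT x:cell L1 L2 h|lborel. F1 x) = (LINT x:cell L1 L2 h|lborel. F1 (?S x))"
    by (rule double_shear_invariance[OF L c1 \<open>periodic L1 L2 F1\<close> v, symmetric])
  also have "\<dots> = (LINT p:?R|lborel. LINT c:{0<..<h}|lborel. F1 (vec3 1 2 3 p 0 + c *\<^sub>R v))"
    unfolding fubini_cell(2)[OF d cS[OF c1]] S by simp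
  also have "\<dots> \<le> (LINT p:?R|lborel. \<kappa> * (LINT c:{0<..<h}|lborel. F2 (vec3 1 2 3 p 0 + c *\<^sub>R v)))"
  proof (rule set_integral_mono)
    show "set_integrable lborel ?R (\<lambda>p. LINT c:{0<..<h}|lborel. F1 (vec3 1 2 3 p 0 + c *\<^sub>R v))"
      using fubini_cell(1)[OF d cS[OF c1], of L1 L2 h] unfolding S by simp
    show "set_integrable lborel ?R (\<lambda>p. \<kappa> * (LINT c:{0<..<h}|lborel. F2 (vec3 1 2 3 p 0 + c *\<^sub>R v)))"
      using fubini_cell(1)[OF d cS[OF c2], of L1 L2 h] unfolding S by simp
    fix p
    have y: "vec3 1 2 3 p 0 $ 3 = 0" by (simp add: vec3_nth[OF d])
    obtain \<Psi> where \<Psi>: "bump_seq h \<Psi>"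
      "\<And>m t. t \<in> {0<..<h} \<Longrightarrow> \<Psi> m t = (dird v ^^ m) \<phi> (vec3 1 2 3 p 0 + t *\<^sub>R v)"
      using line_bump_seq[OF t v y] by blast
    have "(LINT c:{0<..<h}|lborel. F1 (vec3 1 2 3 p 0 + c *\<^sub>R v)) = (LINT t:{0<..<h}|lborel. q t * (\<Psi> 0 t)\<^sup>2)"
      using \<Psi>(2)[of _ 0] y v by (intro set_lebesgue_integral_cong) (auto simp: F1_def)
    moreover have "(LINT c:{0<..<h}|lborel. F2 (vec3 1 2 3 p 0 + c *\<^sub>R v)) = (LINT t:{0<..<h}|lborel. (\<Psi> 1 t)\<^sup>2)"
      using \<Psi>(2)[of _ 1] by (intro set_lebesgue_integral_cong) (auto simp: F2_def)
    ultimately show "(LINT c:{0<..<h}|lborel. F1 (vec3 1 2 3 p 0 + c *\<^sub>R v)) \<le> \<kappa> * (LINT c:{0<..<h}|lborel. F2 (vec3 1 2 3 p 0 + c *\<^sub>R v))"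
      using hyp[OF \<Psi>(1)] by simp
  qed
  also have "\<dots> = \<kappa> * (LINT p:?R|lborel. (LINT c:{0<..<h}|lborel. F2 (vec3 1 2 3 p 0 + c *\<^sub>R v)))"
    by simp
  also have "(LINT p:?R|lborel. (LINT c:{0<..<h}|lborel. F2 (vec3 1 2 3 p 0 + c *\<^sub>R v))) = (LINT x:cell L1 L2 h|lborel. F2 (?S x))"
    unfolding fubini_cell(2)[OF d cS[OF c2]] S by simp
  also have "\<dots> = (LINT x:cell L1 L2 h|lborel. F2 x)"
    by (rule double_shear_invariance[OF L c2 \<open>periodic L1 L2 F2\<close> v])
  finally show ?thesis by (simp add: F1_def F2_def)
qed

section \<open>Volume-preserving perturbations\<close>

text \<open>The preimage of y is the fixed point of the contraction y - \<Theta> x, on the whole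
  space. Outside \<open>S\<close> the map is the identity, so by injectivity it cannot move a point
  across the boundary of \<open>S\<close> in either direction.\<close>

lemma homeomorphism_id_plus:
  fixes \<Theta> :: "'a::banach \<Rightarrow> 'a"
  assumes lip: "\<And>x y. norm (\<Theta> x - \<Theta> y) \<le> norm (x - y) / 2" and z: "\<And>x. x \<notin> S \<Longrightarrow> \<Theta> x = 0"
  shows "\<exists>g. homeomorphism S S (\<lambda>y. \<Theta> y + y) g"
proof -
  define T where "T y = \<Theta> y + y" for y
  have lower: "norm (x - y) \<le> 2 * norm (T x - T y)" for x y
  proof -
    have "norm (x - y) \<le> norm (T x - T y) + norm (\<Theta> x - \<Theta> y)"
      using norm_triangle_ineq4[of "T x - T y" "\<Theta> x - \<Theta> y"] by (simp add: T_def)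
    with lip[of x y] show ?thesis by simp
  qed
  have inj: "T x = T y \<Longrightarrow> x = y" for x y using lower[of x y] by simp
  have "\<exists>x. T x = y" for y
  proof -
    have "\<exists>!x. y - \<Theta> x = x"
      by (rule banach_fix_type[of "1/2"]) (use lip in \<open>auto simp: dist_norm norm_minus_commute\<close>)
    then obtain x where "y - \<Theta> x = x" by blast
    then have "T x = y" unfolding T_def by (metis add.commute diff_add_cancel)
    then show ?thesis ..
  qed
  then obtain g where Tg: "\<And>y. T (g y) = y" by metis
  have gT: "g (T x) = x" for x using inj Tg by blast
  have TS: "T x \<in> S" if "x \<in> S" for x
  proof (rule ccontr)
    assume "T x \<notin> S"
    then have "T (T x) = T x" using z by (simp add: T_def)
    then have "T x = x" by (rule inj)
    with \<open>T x \<notin> S\<close> that show False by simp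
  qed
  have gS: "g y \<in> S" if "y \<in> S" for y
    using that Tg[of y] z[of "g y"] by (metis T_def add.left_neutral)
  have "1-lipschitz_on S \<Theta>"
  proof (rule lipschitz_onI)
    show "dist (\<Theta> x) (\<Theta> y) \<le> 1 * dist x y" for x y
      using lip[of x y] norm_ge_zero[of "x - y"] unfolding dist_norm by linarith
  qed simp
  then have cT: "continuous_on S T"
    unfolding T_def[abs_def] by (intro continuous_intros lipschitz_on_continuous_on)
  have "2-lipschitz_on S g"
    by (rule lipschitz_onI) (use lower[of "g _" "g _"] Tg in \<open>auto simp: dist_norm\<close>)
  then have cg: "continuous_on S g" by (rule lipschitz_on_continuous_on)
  have "homeomorphism S S T g"
    unfolding homeomorphism_def
  proof (intro conjI)
    show "T ` S = S" using TS gS Tg by (auto simp: image_iff) metis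
    show "g ` S = S" using TS gS gT by (auto simp: image_iff) metis
  qed (use cT cg gT Tg in auto)
  then show ?thesis unfolding T_def[abs_def] by blast
qed

lemma bounded_pd_lipschitz:
  fixes f :: "real^3 \<Rightarrow> real"
  assumes diff: "\<And>x. f differentiable at x" and B: "\<And>i x. \<bar>pd i f x\<bar> \<le> B"
  shows "\<bar>f x - f y\<bar> \<le> 3 * B * norm (x - y)"
proof -
  let ?g = "\<lambda>t. f (y + t *\<^sub>R (x - y))"
  have "\<exists>z>0. z < 1 \<and> ?g 1 - ?g 0 = (1 - 0) * (\<Sum>i\<in>UNIV. (x - y) $ i * pd i f (y + z *\<^sub>R (x - y)))"
    by (rule MVT2, simp, rule line_derivative[OF diff])
  then obtain z where z: "f x - f y = (\<Sum>i\<in>UNIV. (x - y) $ i * pd i f (y + z *\<^sub>R (x - y)))" by auto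
  have "\<bar>f x - f y\<bar> \<le> (\<Sum>i\<in>(UNIV::3 set). norm (x - y) * B)"
    unfolding z
    by (intro order_trans[OF sum_abs] sum_mono) (unfold abs_mult, intro mult_mono B component_le_norm_cart, auto)
  then show ?thesis by (simp add: mult.commute mult.left_commute)
qed

text \<open>The nonzero vectors of the horizontal dual lattice: precisely those for which the sine
  and cosine of \<xi>\<cdot>x have the periods of the cell.\<close>

definition freq :: "real \<Rightarrow> real \<Rightarrow> real^3 \<Rightarrow> bool" where
  "freq L1 L2 \<xi> \<longleftrightarrow> \<xi> $ 3 = 0 \<and> \<xi> \<noteq> 0 \<and> (\<exists>(m::int) (n::int). \<xi> $ 1 = m / L1 \<and> \<xi> $ 2 = n / L2)"

lemma bump_seq_bounded:
  assumes "bump_seq h \<Psi>"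
  shows "\<exists>B. \<forall>t. \<bar>\<Psi> m t\<bar> \<le> B"
proof -
  obtain c d where z: "\<And>t. t \<notin> {c<..<d} \<Longrightarrow> \<Psi> m t = 0" using assms unfolding bump_seq_def by blast
  have "continuous_on {c..d} (\<Psi> m)"
    using assms unfolding bump_seq_def by (intro continuous_at_imp_continuous_on) (auto intro: DERIV_isCont)
  then have "bounded (\<Psi> m ` {c..d})" by (intro compact_imp_bounded compact_continuous_image) auto
  then obtain B where B: "\<And>t. t \<in> {c..d} \<Longrightarrow> \<bar>\<Psi> m t\<bar> \<le> B" unfolding bounded_iff by (metis imageI real_norm_def)
  have "\<bar>\<Psi> m t\<bar> \<le> max B 0" for t
    using B[of t] z[of t] by (cases "t \<in> {c<..<d}") auto
  then show ?thesis by blast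
qed

text \<open>The bound on \<open>\<epsilon>1\<close> makes the implicit equation for \<open>Z\<close> a contraction.\<close>

locale bump_flow =
  fixes L1 L2 h :: real and \<Psi> :: "nat \<Rightarrow> real \<Rightarrow> real" and \<xi> :: "real^3" and \<epsilon>1 :: real
  assumes L: "0 < L1" "0 < L2"
    and bump: "bump_seq h \<Psi>" and freq: "freq L1 L2 \<xi>"
    and \<epsilon>1: "0 < \<epsilon>1" "\<epsilon>1 \<le> 1" "\<And>t. \<epsilon>1 * \<bar>\<Psi> 1 t\<bar> \<le> 1 / 2"
begin

section \<open>The implicit height \<open>Z\<close> and its derivative\<close>

abbreviation "I \<equiv> {0<..<\<epsilon>1}"

lemma xi3 [simp]: "\<xi> $ 3 = 0" using freq by (simp add: freq_def)

lemma dPsi: "(\<Psi> m has_real_derivative \<Psi> (Suc m) t) (at t)"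
  using bump by (simp add: bump_seq_def)

lemma dPsi01: "(\<Psi> 0 has_real_derivative \<Psi> 1 t) (at t)" "(\<Psi> 1 has_real_derivative \<Psi> 2 t) (at t)"
  using dPsi[of 0] dPsi[of 1] by (simp_all add: numeral_2_eq_2)

lemma Psi_lipschitz:
  assumes "\<And>t. \<bar>\<Psi> (Suc m) t\<bar> \<le> B"
  shows "\<bar>\<Psi> m a - \<Psi> m b\<bar> \<le> B * \<bar>a - b\<bar>"
  using field_differentiable_bound[of UNIV "\<Psi> m" "\<Psi> (Suc m)" B a b] dPsi assms by auto

lemma contraction:
  assumes "\<epsilon> \<in> I"
  shows "\<bar>\<epsilon> * \<Psi> 0 a * cos s - \<epsilon> * \<Psi> 0 b * cos s\<bar> \<le> 1 / 2 * \<bar>a - b\<bar>"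
proof -
  have "\<bar>\<Psi> 0 a - \<Psi> 0 b\<bar> \<le> 1 / (2 * \<epsilon>1) * \<bar>a - b\<bar>"
    using \<epsilon>1 by (intro Psi_lipschitz) (auto simp: field_simps)
  then have "\<epsilon> * \<bar>\<Psi> 0 a - \<Psi> 0 b\<bar> * \<bar>cos s\<bar> \<le> \<epsilon>1 * (1 / (2 * \<epsilon>1) * \<bar>a - b\<bar>) * 1"
    using assms \<epsilon>1 by (intro mult_mono) auto
  then show ?thesis
    using assms \<epsilon>1 by (simp add: abs_mult left_diff_distrib[symmetric] right_diff_distrib[symmetric])
qed

definition Z :: "real \<Rightarrow> real^3 \<Rightarrow> real" where
  "Z \<epsilon> x = (THE z. x $ 3 - \<epsilon> * \<Psi> 0 z * cos (\<xi> \<bullet> x) = z)"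

lemma Z_unique:
  assumes "\<epsilon> \<in> I"
  shows "\<exists>!z. x $ 3 - \<epsilon> * \<Psi> 0 z * cos (\<xi> \<bullet> x) = z"
proof (rule banach_fix_type[of "1/2"])
  show "\<forall>a b. dist (x $ 3 - \<epsilon> * \<Psi> 0 a * cos (\<xi> \<bullet> x)) (x $ 3 - \<epsilon> * \<Psi> 0 b * cos (\<xi> \<bullet> x)) \<le> 1 / 2 * dist a b"
    using contraction[OF assms] by (auto simp: dist_real_def abs_minus_commute)
qed auto

lemma Z_eq: "\<epsilon> \<in> I \<Longrightarrow> Z \<epsilon> x = x $ 3 - \<epsilon> * \<Psi> 0 (Z \<epsilon> x) * cos (\<xi> \<bullet> x)"
  unfolding Z_def using theI'[OF Z_unique, of \<epsilon> x] by simp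

lemma Z_eqI: "\<epsilon> \<in> I \<Longrightarrow> x $ 3 - \<epsilon> * \<Psi> 0 z * cos (\<xi> \<bullet> x) = z \<Longrightarrow> Z \<epsilon> x = z"
  unfolding Z_def by (rule the1_equality[OF Z_unique])

text \<open>Continuity is established separately because the rule for the derivative of an inverse
  function presupposes it.\<close>

lemma Z_continuous:
  assumes e: "\<epsilon> \<in> I"
  shows "continuous (at x) (Z \<epsilon>)"
proof -
  obtain B where B: "\<And>t. \<bar>\<Psi> 0 t\<bar> \<le> B" using bump_seq_bounded[OF bump] by blast
  have bd: "norm (Z \<epsilon> y - Z \<epsilon> x) \<le> 2 * \<bar>y $ 3 - x $ 3\<bar> + 2 * (\<epsilon> * (B * \<bar>cos (\<xi> \<bullet> y) - cos (\<xi> \<bullet> x)\<bar>))" for y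
  proof -
    have "\<epsilon> * (\<bar>\<Psi> 0 (Z \<epsilon> x)\<bar> * \<bar>cos (\<xi> \<bullet> y) - cos (\<xi> \<bullet> x)\<bar>) \<le> \<epsilon> * (B * \<bar>cos (\<xi> \<bullet> y) - cos (\<xi> \<bullet> x)\<bar>)"
      using e B by (intro mult_left_mono mult_right_mono) auto
    then have 1: "\<bar>\<epsilon> * \<Psi> 0 (Z \<epsilon> x) * cos (\<xi> \<bullet> y) - \<epsilon> * \<Psi> 0 (Z \<epsilon> x) * cos (\<xi> \<bullet> x)\<bar> \<le> \<epsilon> * (B * \<bar>cos (\<xi> \<bullet> y) - cos (\<xi> \<bullet> x)\<bar>)"
      using e by (simp add: right_diff_distrib[symmetric] abs_mult mult.assoc)
    have 2: "2 * \<bar>\<epsilon> * \<Psi> 0 (Z \<epsilon> y) * cos (\<xi> \<bullet> y) - \<epsilon> * \<Psi> 0 (Z \<epsilon> x) * cos (\<xi> \<bullet> y)\<bar> \<le> \<bar>Z \<epsilon> y - Z \<epsilon> x\<bar>"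
      using contraction[OF e, of "Z \<epsilon> y" "\<xi> \<bullet> y" "Z \<epsilon> x"] by simp
    \<comment> \<open>By the contraction estimate, half of |b - a| appears on the right and is
      absorbed on the left, which doubles the remaining terms.\<close>
    have "\<bar>b - a\<bar> \<le> 2 * \<bar>y3 - x3\<bar> + 2 * K"
      if "\<bar>q - p\<bar> \<le> K" "2 * \<bar>r - q\<bar> \<le> \<bar>b - a\<bar>" "a = x3 - p" "b = y3 - r" for a b x3 y3 p q r K :: real
    proof -
      have eq: "b - a = (y3 - x3) - ((r - q) + (q - p))" using that(3,4) by simp
      show ?thesis
        using that(1,2) abs_triangle_ineq4[of "y3 - x3" "(r - q) + (q - p)"] abs_triangle_ineq[of "r - q" "q - p"]
        unfolding eq by linarith
    qed
    from this[OF 1 2 Z_eq[OF e, of x] Z_eq[OF e, of y]] show ?thesis by simp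
  qed
  have lim: "((\<lambda>y. 2 * \<bar>y $ 3 - x $ 3\<bar> + 2 * (\<epsilon> * (B * \<bar>cos (\<xi> \<bullet> y) - cos (\<xi> \<bullet> x)\<bar>))) \<longlongrightarrow>
      2 * \<bar>x $ 3 - x $ 3\<bar> + 2 * (\<epsilon> * (B * \<bar>cos (\<xi> \<bullet> x) - cos (\<xi> \<bullet> x)\<bar>))) (at x)"
    by (intro tendsto_intros)
  have "((\<lambda>y. Z \<epsilon> y - Z \<epsilon> x) \<longlongrightarrow> 0) (at x)"
    by (rule Lim_null_comparison[OF always_eventually]) (rule allI, rule bd, use lim in simp)
  then show ?thesis by (simp add: continuous_at LIM_zero_iff)
qed

text \<open>This is the partial derivative of \<open>Z\<close> in x_3, and thus the Jacobian
  determinant of replacing the height x_3 by \<open>Z\<close> while keeping the horizontal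
  position.\<close>

definition E :: "real \<Rightarrow> real^3 \<Rightarrow> real" where
  "E \<epsilon> x = 1 / (1 + \<epsilon> * \<Psi> 1 (Z \<epsilon> x) * cos (\<xi> \<bullet> x))"

lemma E_denom:
  assumes e: "\<epsilon> \<in> I"
  shows "1 / 2 \<le> 1 + \<epsilon> * \<Psi> 1 t * cos s"
proof -
  have "\<epsilon> * \<bar>\<Psi> 1 t\<bar> * \<bar>cos s\<bar> \<le> \<epsilon>1 * \<bar>\<Psi> 1 t\<bar> * 1"
    using e by (intro mult_mono) auto
  then have "\<bar>\<epsilon> * \<Psi> 1 t * cos s\<bar> \<le> 1 / 2" using \<epsilon>1(3)[of t] e by (simp add: abs_mult)
  then show ?thesis by linarith
qed

lemma E_mult: "\<epsilon> \<in> I \<Longrightarrow> E \<epsilon> x * (1 + \<epsilon> * \<Psi> 1 (Z \<epsilon> x) * cos (\<xi> \<bullet> x)) = 1"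
  using E_denom[of \<epsilon> "Z \<epsilon> x" "\<xi> \<bullet> x"] by (simp add: E_def)

text \<open>\<open>Z\<close> is the third component of the inverse of \<open>y \<mapsto> y + \<epsilon> \<Psi>\<^sub>0(y\<^sub>3) cos(\<xi>\<cdot>y) e\<^sub>3\<close>.\<close>

lemma Z_has_derivative:
  assumes e: "\<epsilon> \<in> I"
  shows "(Z \<epsilon> has_derivative
     (\<lambda>v. E \<epsilon> x * (v $ 3 + \<epsilon> * \<Psi> 0 (Z \<epsilon> x) * sin (\<xi> \<bullet> x) * (\<xi> \<bullet> v)))) (at x)"
proof -
  define A where "A y = y + (\<epsilon> * \<Psi> 0 (y $ 3) * cos (\<xi> \<bullet> y)) *\<^sub>R axis 3 1" for y :: "real^3"
  define g where "g x = x + (Z \<epsilon> x - x $ 3) *\<^sub>R axis 3 1" for x :: "real^3"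
  define c s where "c = cos (\<xi> \<bullet> x)" and "s = sin (\<xi> \<bullet> x)"
  define A' where "A' v = v + (\<epsilon> * (\<Psi> 1 (Z \<epsilon> x) * v $ 3 * c - \<Psi> 0 (Z \<epsilon> x) * s * (\<xi> \<bullet> v))) *\<^sub>R axis 3 1" for v :: "real^3"
  define g' where "g' v = v + (E \<epsilon> x * (v $ 3 + \<epsilon> * \<Psi> 0 (Z \<epsilon> x) * s * (\<xi> \<bullet> v)) - v $ 3) *\<^sub>R axis 3 1" for v :: "real^3"
  have xi_axis: "\<xi> \<bullet> axis 3 1 = 0" by (simp add: inner_axis)
  have g3: "g y $ 3 = Z \<epsilon> y" and gxi: "\<xi> \<bullet> g y = \<xi> \<bullet> y" for y
    by (simp_all add: g_def inner_add_right inner_axis)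
  have "((\<lambda>y::real^3. y $ 3) has_derivative (\<lambda>v. v $ 3)) (at (g x))"
    by (rule bounded_linear_imp_has_derivative[OF bounded_linear_vec_nth])
  from has_derivative_compose[OF this, of "\<Psi> 0" "(*) (\<Psi> 1 (Z \<epsilon> x))"]
  have "((\<lambda>y. \<Psi> 0 (y $ 3)) has_derivative (\<lambda>v. \<Psi> 1 (Z \<epsilon> x) * v $ 3)) (at (g x))"
    using dPsi01(1)[of "Z \<epsilon> x"] g3 by (simp add: has_field_derivative_def)
  then have "(A has_derivative A') (at (g x))"
    unfolding A_def[abs_def] A'_def[abs_def]
    by (auto intro!: derivative_eq_intros simp: g3 gxi c_def s_def algebra_simps)
  moreover have "bounded_linear g'"
    unfolding g'_def by (intro bounded_linear_intros bounded_linear_vec_nth)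
  moreover have "g' \<circ> A' = id"
  proof
    fix v
    have "A' v $ 3 + \<epsilon> * \<Psi> 0 (Z \<epsilon> x) * s * (\<xi> \<bullet> A' v) = v $ 3 * (1 + \<epsilon> * \<Psi> 1 (Z \<epsilon> x) * c)"
      by (simp add: A'_def inner_add_right inner_axis algebra_simps)
    then have "E \<epsilon> x * (A' v $ 3 + \<epsilon> * \<Psi> 0 (Z \<epsilon> x) * s * (\<xi> \<bullet> A' v)) = v $ 3"
      using E_mult[OF e, of x] by (simp add: c_def mult.left_commute)
    then have "g' (A' v) = A' v + (v $ 3 - A' v $ 3) *\<^sub>R axis 3 1" by (simp add: g'_def)
    also have "\<dots> = v" by (simp add: A'_def vec_eq_iff axis_def)
    finally show "(g' \<circ> A') v = id v" by simp
  qed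
  moreover have "continuous (at x) g"
    unfolding g_def[abs_def] by (intro continuous_intros Z_continuous e)
  moreover have "A (g z) = z" for z
    using Z_eq[OF e, of z] unfolding A_def g3 gxi by (simp add: g_def vec_eq_iff axis_def)
  ultimately have "(g has_derivative g') (at x)"
    by (intro has_derivative_inverse_basic[of A A' g x g' UNIV]) auto
  from bounded_linear.has_derivative[OF bounded_linear_vec_nth this, of 3]
  have "((\<lambda>y. g y $ 3) has_derivative (\<lambda>v. g' v $ 3)) (at x)" .
  then show ?thesis by (simp add: g3 g'_def s_def)
qed

lemma Z_differentiable: "\<epsilon> \<in> I \<Longrightarrow> Z \<epsilon> differentiable at x"
  using Z_has_derivative by (auto simp: differentiable_def)

lemma pd_Z: "\<epsilon> \<in> I \<Longrightarrow>
  pd i (Z \<epsilon>) x = E \<epsilon> x * ((if i = 3 then 1 else 0) + \<epsilon> * \<Psi> 0 (Z \<epsilon> x) * sin (\<xi> \<bullet> x) * \<xi> $ i)"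
  by (subst pd_eq_derivative[OF Z_has_derivative]) (simp_all add: inner_axis, simp add: axis_def)

definition Q :: "nat \<Rightarrow> real \<Rightarrow> real^3 \<Rightarrow> real" where
  "Q m \<epsilon> x = (\<Psi> m (Z \<epsilon> x) - \<Psi> m (x $ 3)) / \<epsilon>"

text \<open>The difference quotients \<open>Q m\<close> in \<open>\<epsilon>\<close> are generators: the factor \<open>1/\<epsilon>\<close> cancels in their
  partial derivatives because \<open>E = 1 - \<epsilon> \<Psi>\<^sub>1(Z) cos(\<xi>\<cdot>x) E\<close>.\<close>

definition gens :: "(real \<Rightarrow> real^3 \<Rightarrow> real) set" where
  "gens = range (\<lambda>m \<epsilon> x. \<Psi> m (Z \<epsilon> x)) \<union> range (\<lambda>m \<epsilon> x. \<Psi> m (x $ 3)) \<union> range Q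
     \<union> {E, \<lambda>\<epsilon> x. cos (\<xi> \<bullet> x), \<lambda>\<epsilon> x. sin (\<xi> \<bullet> x)}"

lemma alg_gens:
  "(\<lambda>\<epsilon> x. \<Psi> m (Z \<epsilon> x)) \<in> alg I gens" "(\<lambda>\<epsilon> x. \<Psi> m (x $ 3)) \<in> alg I gens"
  "(\<lambda>\<epsilon> x. Q m \<epsilon> x) \<in> alg I gens" "(\<lambda>\<epsilon> x. E \<epsilon> x) \<in> alg I gens"
  "(\<lambda>\<epsilon> x. cos (\<xi> \<bullet> x)) \<in> alg I gens" "(\<lambda>\<epsilon> x. sin (\<xi> \<bullet> x)) \<in> alg I gens"
  "(\<lambda>\<epsilon> x. \<epsilon>) \<in> alg I gens"
  by (auto intro!: alg.gen alg.const[where B=\<epsilon>1] simp: gens_def)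

lemmas alg_intros = alg_gens alg_const alg.add alg.mult alg_diff alg_uminus

section \<open>Closure of the generators under differentiation\<close>

lemma pd_Psi_Z: "\<epsilon> \<in> I \<Longrightarrow> pd i (\<lambda>x. \<Psi> m (Z \<epsilon> x)) x = \<Psi> (Suc m) (Z \<epsilon> x) * pd i (Z \<epsilon>) x"
  by (rule pd_compose[OF Z_differentiable dPsi])

lemma differentiable_Psi_Z: "\<epsilon> \<in> I \<Longrightarrow> (\<lambda>x. \<Psi> m (Z \<epsilon> x)) differentiable at x"
  by (rule differentiable_compose_real[OF Z_differentiable dPsi])

lemma differentiable_Psi_coord: "(\<lambda>x. \<Psi> m (x $ 3)) differentiable at (x :: real^3)"
  by (rule differentiable_compose_real[OF differentiable_coord dPsi])

lemma pd_Psi_coord: "pd i (\<lambda>x. \<Psi> m (x $ 3)) x = \<Psi> (Suc m) (x $ 3) * (if i = 3 then 1 else 0)"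
  by (simp only: pd_compose[OF differentiable_coord dPsi] pd_coord)

lemma differentiable_trig:
  "(\<lambda>x. cos (\<xi> \<bullet> x)) differentiable at x" "(\<lambda>x. sin (\<xi> \<bullet> x)) differentiable at x"
  by (rule differentiable_compose_real[OF differentiable_inner_left DERIV_cos]
      differentiable_compose_real[OF differentiable_inner_left DERIV_sin])+

lemma pd_trig:
  "pd i (\<lambda>x. cos (\<xi> \<bullet> x)) x = - sin (\<xi> \<bullet> x) * \<xi> $ i" "pd i (\<lambda>x. sin (\<xi> \<bullet> x)) x = cos (\<xi> \<bullet> x) * \<xi> $ i"
  by (simp_all only: pd_compose[OF differentiable_inner_left DERIV_cos]
      pd_compose[OF differentiable_inner_left DERIV_sin] pd_inner)

text \<open>\<open>Z\<close> grows like x_3 and is unbounded, so it cannot be a generator itself; it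
  enters only through bounded functions of it and through its partial derivatives.\<close>

lemma alg_pd_Z: "(\<lambda>\<epsilon>. pd i (Z \<epsilon>)) \<in> alg I gens"
proof -
  have "(\<lambda>\<epsilon> x. E \<epsilon> x * ((if i = 3 then 1 else 0) + \<epsilon> * \<Psi> 0 (Z \<epsilon> x) * sin (\<xi> \<bullet> x) * \<xi> $ i)) \<in> alg I gens"
    by (intro alg_intros)
  then show ?thesis by (rule alg.cong) (auto simp: pd_Z)
qed

lemma gens_Psi_Z: "(\<lambda>\<epsilon>. pd i (\<lambda>x. \<Psi> m (Z \<epsilon> x))) \<in> alg I gens"
  by (rule alg.cong[OF alg.mult[OF alg_gens(1) alg_pd_Z]]) (auto simp: pd_Psi_Z)

lemma gens_E: "(\<lambda>\<epsilon>. pd i (E \<epsilon>)) \<in> alg I gens" and differentiable_E: "\<epsilon> \<in> I \<Longrightarrow> E \<epsilon> differentiable at x"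
proof -
  have d: "(\<lambda>x. 1 + \<epsilon> * \<Psi> 1 (Z \<epsilon> x) * cos (\<xi> \<bullet> x)) differentiable at x" if "\<epsilon> \<in> I" for \<epsilon> x
    by (intro derivative_intros differentiable_Psi_Z[OF that] differentiable_trig)
  have inv: "((\<lambda>t::real. 1 / t) has_real_derivative - (1 / t\<^sup>2)) (at t)" if "t \<noteq> 0" for t
    using that by (auto intro!: derivative_eq_intros simp: power2_eq_square)
  have nz: "1 + \<epsilon> * \<Psi> 1 (Z \<epsilon> x) * cos (\<xi> \<bullet> x) \<noteq> 0" if "\<epsilon> \<in> I" for \<epsilon> x
    using E_denom[OF that, of "Z \<epsilon> x" "\<xi> \<bullet> x"] by linarith
  show "\<epsilon> \<in> I \<Longrightarrow> E \<epsilon> differentiable at x"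
    unfolding E_def[abs_def] by (rule differentiable_compose_real[OF d inv[OF nz]])
  have "pd i (E \<epsilon>) x = - (E \<epsilon> x * E \<epsilon> x) * (\<epsilon> * (\<Psi> 2 (Z \<epsilon> x) * pd i (Z \<epsilon>) x * cos (\<xi> \<bullet> x)
      - \<Psi> 1 (Z \<epsilon> x) * sin (\<xi> \<bullet> x) * \<xi> $ i))" if e: "\<epsilon> \<in> I" for \<epsilon> x
  proof -
    have "pd i (E \<epsilon>) x = - (1 / (1 + \<epsilon> * \<Psi> 1 (Z \<epsilon> x) * cos (\<xi> \<bullet> x))\<^sup>2) * pd i (\<lambda>x. 1 + \<epsilon> * \<Psi> 1 (Z \<epsilon> x) * cos (\<xi> \<bullet> x)) x"
      unfolding E_def[abs_def] by (rule pd_compose[OF d[OF e] inv[OF nz[OF e]]])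
    also have "pd i (\<lambda>x. 1 + \<epsilon> * \<Psi> 1 (Z \<epsilon> x) * cos (\<xi> \<bullet> x)) x =
       \<epsilon> * \<Psi> 1 (Z \<epsilon> x) * (- sin (\<xi> \<bullet> x) * \<xi> $ i) + \<epsilon> * (\<Psi> 2 (Z \<epsilon> x) * pd i (Z \<epsilon>) x) * cos (\<xi> \<bullet> x)"
      using differentiable_Psi_Z[OF e] differentiable_trig
      by (simp add: pd_add pd_mult pd_trig pd_cmult pd_Psi_Z[OF e] derivative_intros numeral_2_eq_2)
    finally show ?thesis by (simp add: E_def[of \<epsilon> x] power2_eq_square algebra_simps)
  qed
  then have eq: "\<forall>\<epsilon>\<in>I. pd i (E \<epsilon>) = (\<lambda>x. - (E \<epsilon> x * E \<epsilon> x) * (\<epsilon> * (\<Psi> 2 (Z \<epsilon> x) * pd i (Z \<epsilon>) x * cos (\<xi> \<bullet> x)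
      - \<Psi> 1 (Z \<epsilon> x) * sin (\<xi> \<bullet> x) * \<xi> $ i)))" by auto
  show "(\<lambda>\<epsilon>. pd i (E \<epsilon>)) \<in> alg I gens"
    by (rule alg.cong[OF _ eq]) (intro alg_intros alg_pd_Z)
qed

lemma differentiable_Q: "\<epsilon> \<in> I \<Longrightarrow> Q m \<epsilon> differentiable at x"
  unfolding Q_def[abs_def]
  by (intro derivative_intros differentiable_Psi_Z differentiable_Psi_coord) auto

lemma gens_Q: "(\<lambda>\<epsilon>. pd i (Q m \<epsilon>)) \<in> alg I gens"
proof -
  have "pd i (Q m \<epsilon>) x = (if i = 3 then 1 else 0) * (Q (Suc m) \<epsilon> x - \<Psi> (Suc m) (Z \<epsilon> x) * \<Psi> 1 (Z \<epsilon> x) * cos (\<xi> \<bullet> x) * E \<epsilon> x)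
      + \<Psi> (Suc m) (Z \<epsilon> x) * E \<epsilon> x * \<Psi> 0 (Z \<epsilon> x) * sin (\<xi> \<bullet> x) * \<xi> $ i" if e: "\<epsilon> \<in> I" for \<epsilon> x
  proof -
    have ne: "\<epsilon> \<noteq> 0" using e by auto
    have "Q m \<epsilon> = (\<lambda>x. (1 / \<epsilon>) * (\<Psi> m (Z \<epsilon> x) + (- 1) * \<Psi> m (x $ 3)))" by (auto simp: Q_def)
    then have "pd i (Q m \<epsilon>) x = (1 / \<epsilon>) * (\<Psi> (Suc m) (Z \<epsilon> x) * pd i (Z \<epsilon>) x + (- 1) * (\<Psi> (Suc m) (x $ 3) * (if i = 3 then 1 else 0)))"
      using differentiable_Psi_Z[OF e] differentiable_Psi_coord
      by (simp only: pd_cmult pd_add pd_Psi_Z[OF e] pd_Psi_coord differentiable_add differentiable_mult differentiable_const)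
    also have "\<dots> = (1 / \<epsilon>) * ((if i = 3 then 1 else 0) * (E \<epsilon> x * \<Psi> (Suc m) (Z \<epsilon> x) - \<Psi> (Suc m) (x $ 3)))
      + \<Psi> (Suc m) (Z \<epsilon> x) * E \<epsilon> x * \<Psi> 0 (Z \<epsilon> x) * sin (\<xi> \<bullet> x) * \<xi> $ i"
      using ne unfolding pd_Z[OF e] by (simp add: field_simps)
    also have "E \<epsilon> x * \<Psi> (Suc m) (Z \<epsilon> x) - \<Psi> (Suc m) (x $ 3) =
        \<epsilon> * (Q (Suc m) \<epsilon> x - \<Psi> (Suc m) (Z \<epsilon> x) * \<Psi> 1 (Z \<epsilon> x) * cos (\<xi> \<bullet> x) * E \<epsilon> x)"
    proof -
      have "E \<epsilon> x = 1 - \<epsilon> * \<Psi> 1 (Z \<epsilon> x) * cos (\<xi> \<bullet> x) * E \<epsilon> x"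
        using E_mult[OF e, of x] by (simp add: algebra_simps)
      then have "E \<epsilon> x * \<Psi> (Suc m) (Z \<epsilon> x) = (1 - \<epsilon> * \<Psi> 1 (Z \<epsilon> x) * cos (\<xi> \<bullet> x) * E \<epsilon> x) * \<Psi> (Suc m) (Z \<epsilon> x)"
        by simp
      moreover have "\<epsilon> * Q (Suc m) \<epsilon> x = \<Psi> (Suc m) (Z \<epsilon> x) - \<Psi> (Suc m) (x $ 3)" using ne by (simp add: Q_def)
      ultimately show ?thesis by (simp add: algebra_simps)
    qed
    finally show ?thesis using ne by simp
  qed
  then have eq: "\<forall>\<epsilon>\<in>I. pd i (Q m \<epsilon>) = (\<lambda>x. (if i = 3 then 1 else 0) * (Q (Suc m) \<epsilon> x - \<Psi> (Suc m) (Z \<epsilon> x) * \<Psi> 1 (Z \<epsilon> x) * cos (\<xi> \<bullet> x) * E \<epsilon> x)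
      + \<Psi> (Suc m) (Z \<epsilon> x) * E \<epsilon> x * \<Psi> 0 (Z \<epsilon> x) * sin (\<xi> \<bullet> x) * \<xi> $ i)" by auto
  show ?thesis by (rule alg.cong[OF _ eq]) (intro alg_intros)
qed

text \<open>\<open>Z\<close> differs from x_3 by at most \<epsilon> times the supremum of |\<Psi>
  0|, and \<Psi> m is Lipschitz, so the division by \<epsilon> is compensated.\<close>

lemma Q_bounded: "\<exists>B. \<forall>\<epsilon>\<in>I. \<forall>x. \<bar>Q m \<epsilon> x\<bar> \<le> B"
proof -
  obtain B C where B: "\<And>t. \<bar>\<Psi> 0 t\<bar> \<le> B" and C: "\<And>t. \<bar>\<Psi> (Suc m) t\<bar> \<le> C"
    using bump_seq_bounded[OF bump] by meson
  have "0 \<le> B" "0 \<le> C" using B[of 0] C[of 0] by linarith+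
  have "\<bar>Q m \<epsilon> x\<bar> \<le> C * B" if e: "\<epsilon> \<in> I" for \<epsilon> x
  proof -
    have "\<bar>Z \<epsilon> x - x $ 3\<bar> = \<epsilon> * \<bar>\<Psi> 0 (Z \<epsilon> x)\<bar> * \<bar>cos (\<xi> \<bullet> x)\<bar>"
    proof -
      have "Z \<epsilon> x - x $ 3 = - (\<epsilon> * \<Psi> 0 (Z \<epsilon> x) * cos (\<xi> \<bullet> x))" using Z_eq[OF e, of x] by linarith
      then show ?thesis using e by (simp add: abs_mult)
    qed
    also have "\<dots> \<le> \<epsilon> * B * 1" using e B \<open>0 \<le> B\<close> by (intro mult_mono) auto
    finally have "C * \<bar>Z \<epsilon> x - x $ 3\<bar> \<le> C * (\<epsilon> * B * 1)" using \<open>0 \<le> C\<close> by (intro mult_left_mono)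
    then have "\<bar>\<Psi> m (Z \<epsilon> x) - \<Psi> m (x $ 3)\<bar> \<le> C * (\<epsilon> * B * 1)"
      using Psi_lipschitz[OF C, of "Z \<epsilon> x" "x $ 3"] by linarith
    then show ?thesis using e by (simp add: Q_def field_simps)
  qed
  then show ?thesis by blast
qed

lemma gens_closed: "pd_closed I gens"
  unfolding pd_closed_def
proof (intro ballI)
  fix F assume "F \<in> gens"
  then consider m where "F = (\<lambda>\<epsilon> x. \<Psi> m (Z \<epsilon> x))" | m where "F = (\<lambda>\<epsilon> x. \<Psi> m (x $ 3))"
    | m where "F = Q m" | "F = E" | "F = (\<lambda>\<epsilon> x. cos (\<xi> \<bullet> x))" | "F = (\<lambda>\<epsilon> x. sin (\<xi> \<bullet> x))"
    by (auto simp: gens_def)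
  then show "(\<exists>B. \<forall>p\<in>I. \<forall>x. \<bar>F p x\<bar> \<le> B) \<and> (\<forall>p\<in>I. \<forall>x. F p differentiable at x) \<and>
     (\<forall>i. (\<lambda>p. pd i (F p)) \<in> alg I gens)"
  proof cases
    case 1
    show ?thesis unfolding 1 using bump_seq_bounded[OF bump, of m] gens_Psi_Z differentiable_Psi_Z by blast
  next
    case 2
    have "(\<lambda>p. pd i (\<lambda>x. \<Psi> m (x $ 3))) \<in> alg I gens" for i
      by (rule alg.cong[of "\<lambda>\<epsilon> x. \<Psi> (Suc m) (x $ 3) * (if i = 3 then 1 else 0)"])
        (intro alg_intros, simp only: pd_Psi_coord fun_eq_iff, simp)
    then show ?thesis unfolding 2 using bump_seq_bounded[OF bump, of m] differentiable_Psi_coord by blast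
  next
    case 3
    show ?thesis unfolding 3 using Q_bounded gens_Q differentiable_Q by auto
  next
    case 4
    have "\<bar>E \<epsilon> x\<bar> \<le> 2" if "\<epsilon> \<in> I" for \<epsilon> x
      using E_denom[OF that, of "Z \<epsilon> x" "\<xi> \<bullet> x"] by (simp add: E_def field_simps)
    then show ?thesis unfolding 4 using gens_E differentiable_E by blast
  next
    case 5
    have "(\<lambda>p. pd i (\<lambda>x. cos (\<xi> \<bullet> x))) \<in> alg I gens" for i
      by (rule alg.cong[of "\<lambda>\<epsilon> x. - sin (\<xi> \<bullet> x) * \<xi> $ i"]) (intro alg_intros, simp only: pd_trig fun_eq_iff, simp)
    then show ?thesis unfolding 5 using differentiable_trig abs_cos_le_one by blast
  next
    case 6
    have "(\<lambda>p. pd i (\<lambda>x. sin (\<xi> \<bullet> x))) \<in> alg I gens" for i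
      by (rule alg.cong[of "\<lambda>\<epsilon> x. cos (\<xi> \<bullet> x) * \<xi> $ i"]) (intro alg_intros, simp only: pd_trig fun_eq_iff, simp)
    then show ?thesis unfolding 6 using differentiable_trig abs_sin_le_one by blast
  qed
qed

end

section \<open>Scaling of Sobolev norms and of divergence-free fields\<close>

lemma smooth_cmult: "smooth f \<Longrightarrow> smooth (\<lambda>x. c * f x)"
  by (simp add: smooth_def Ck_cmult)

lemma pds_cmult: "smooth f \<Longrightarrow> pds \<alpha> (\<lambda>x. c * f x) = (\<lambda>x. c * pds \<alpha> f x)"
proof (induction \<alpha>)
  case (Cons i \<alpha>)
  then have "pds \<alpha> (\<lambda>x. c * f x) = (\<lambda>x. c * pds \<alpha> f x)" by simp
  then show ?case using Cons.prems by (auto intro!: pd_cmult smooth_differentiable smooth_pds)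
qed simp

lemma Hk_sqnorm_cmult:
  assumes "smooth f"
  shows "Hk_sqnorm L1 L2 h k (\<lambda>x. c * f x) = c\<^sup>2 * Hk_sqnorm L1 L2 h k f"
  unfolding Hk_sqnorm_eq[OF hk_family_smooth[OF assms]] Hk_sqnorm_eq[OF hk_family_smooth[OF smooth_cmult[OF assms]]]
  by (simp add: pds_cmult[OF assms] power_mult_distrib sum_distrib_left)

lemma Hk_norm_scaleR:
  assumes "\<And>j. smooth (\<lambda>x. f x $ j)"
  shows "Hk_norm L1 L2 h k (\<lambda>x. c *\<^sub>R f x) = \<bar>c\<bar> * Hk_norm L1 L2 h k f"
  unfolding Hk_norm_def
  by (simp add: Hk_sqnorm_cmult[OF assms] sum_distrib_left[symmetric] real_sqrt_mult)

lemma cell_integrable_const: "set_integrable lborel (cell L1 L2 h) (\<lambda>x. c :: real)"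
  by (intro cell_integrable_continuous continuous_intros)

lemma cell_integral_const: "(LINT x:cell L1 L2 h|lborel. c :: real) = measure lborel (cell L1 L2 h) * c"
  unfolding set_lebesgue_integral_def by (simp add: mult.commute)

lemma Hk_sqnorm_bound:
  assumes "smooth f" "\<And>\<alpha> x. length \<alpha> \<le> k \<Longrightarrow> \<bar>pds \<alpha> f x\<bar> \<le> B"
  shows "Hk_sqnorm L1 L2 h k f \<le> card {\<alpha>::3 list. length \<alpha> \<le> k} * (measure lborel (cell L1 L2 h) * B\<^sup>2)"
proof -
  have "(LINT x:cell L1 L2 h|lborel. (pds \<alpha> f x)\<^sup>2) \<le> measure lborel (cell L1 L2 h) * B\<^sup>2" if "length \<alpha> \<le> k" for \<alpha>
  proof -
    have "(LINT x:cell L1 L2 h|lborel. (pds \<alpha> f x)\<^sup>2) \<le> (LINT x:cell L1 L2 h|lborel. B\<^sup>2)"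
    proof (rule set_integral_mono)
      show "set_integrable lborel (cell L1 L2 h) (\<lambda>x. (pds \<alpha> f x)\<^sup>2)"
        by (intro cell_integrable_continuous continuous_on_power smooth_continuous smooth_pds assms)
      show "(pds \<alpha> f x)\<^sup>2 \<le> B\<^sup>2" for x using assms(2)[OF that, of x] by (simp add: abs_le_square_iff[symmetric])
    qed (rule cell_integrable_const)
    then show ?thesis by (simp add: cell_integral_const)
  qed
  then show ?thesis
    unfolding Hk_sqnorm_eq[OF hk_family_smooth[OF assms(1)]]
    using sum_bounded_above[of "{\<alpha>::3 list. length \<alpha> \<le> k}" _ "measure lborel (cell L1 L2 h) * B\<^sup>2"] by simp
qed

lemma Csigma_scaleR:
  assumes "Csigma L1 L2 h w"
  shows "Csigma L1 L2 h (\<lambda>x. a *\<^sub>R w x)"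
proof -
  have s: "smooth (\<lambda>x. w x $ j)" for j using assms by (simp add: Csigma_def)
  have "(\<Sum>j\<in>UNIV. pd j (\<lambda>y. (a *\<^sub>R w y) $ j) x) = a * (\<Sum>j\<in>UNIV. pd j (\<lambda>y. w y $ j) x)" for x
    by (simp add: pd_cmult[OF smooth_differentiable[OF s]] sum_distrib_left)
  then show ?thesis
    using assms s unfolding Csigma_def periodic_def
    by (elim conjE exE) (intro conjI exI, auto intro!: smooth_cmult)
qed

lemma pd_diff:
  fixes f g :: "real^3 \<Rightarrow> real"
  assumes "f differentiable at x" "g differentiable at x"
  shows "pd i (\<lambda>x. f x - g x) x = pd i f x - pd i g x"
proof -
  have "(\<lambda>x. (- 1) * g x) differentiable at x" using assms(2) by simp
  from pd_add[OF assms(1) this] show ?thesis using pd_cmult[OF assms(2), of i "- 1"] by simp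
qed

text \<open>A combination of two products is the common shape of the components of the field
  \<open>w\<close> and of the displacement \<open>\<Theta>\<close>, so one rule differentiates
  both.\<close>

lemma pd_bilinear:
  fixes f g u t :: "real^3 \<Rightarrow> real"
  assumes d: "f differentiable at x" "g differentiable at x" "u differentiable at x" "t differentiable at x"
  shows "pd i (\<lambda>x. a * (f x * g x) + b * (u x * t x)) x =
    a * (f x * pd i g x + pd i f x * g x) + b * (u x * pd i t x + pd i u x * t x)"
proof -
  have 1: "(\<lambda>x. f x * g x) differentiable at x" "(\<lambda>x. u x * t x) differentiable at x"
    using d by (auto intro: differentiable_mult)
  then have 2: "(\<lambda>x. a * (f x * g x)) differentiable at x" "(\<lambda>x. b * (u x * t x)) differentiable at x"
    by (auto intro: differentiable_mult)
  show ?thesis unfolding pd_add[OF 2] pd_cmult[OF 1(1)] pd_cmult[OF 1(2)] pd_mult[OF d(1,2)] pd_mult[OF d(3,4)] ..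
qed

section \<open>The mode, its corrector and the volume-preserving map\<close>

context bump_flow begin

text \<open>Normalised by p\<cdot>\<xi> = 1, so that moving by t p raises the phase \<xi>\<cdot>x by
  exactly t.\<close>

definition p :: "real^3" where "p = (1 / (\<xi> \<bullet> \<xi>)) *\<^sub>R \<xi>"

lemma xi_pos: "0 < \<xi> \<bullet> \<xi>" using freq by (simp add: freq_def)

lemma p_xi: "p \<bullet> \<xi> = 1" "p $ 3 = 0" "p \<bullet> p = 1 / (\<xi> \<bullet> \<xi>)"
  using xi_pos by (simp_all add: p_def)

lemma p_xi_sum: "p $ 1 * \<xi> $ 1 + p $ 2 * \<xi> $ 2 = 1"
  using p_xi(1) by (simp add: inner_vec_def sum_3)

text \<open>The phase moves with speed \<Psi> 1 (x_3) sin(\<xi>\<cdot>x) and the height with speed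
  -\<Psi> 0 (x_3) cos(\<xi>\<cdot>x): Hamilton's equations for \<Psi> 0 (x_3)
  sin(\<xi>\<cdot>x).\<close>

definition w :: "real^3 \<Rightarrow> real^3" where
  "w x = (\<Psi> 1 (x $ 3) * sin (\<xi> \<bullet> x)) *\<^sub>R p - (\<Psi> 0 (x $ 3) * cos (\<xi> \<bullet> x)) *\<^sub>R axis 3 1"

text \<open>Since \<Psi> m (x_3) + \<epsilon> Q m = \<Psi> m (Z), adding \<epsilon> v to w evaluates
  the profiles at the new height \<open>Z\<close>. This splits the displacement exactly into first
  order and remainder, with no Taylor expansion.\<close>

definition v :: "real \<Rightarrow> real^3 \<Rightarrow> real^3" where
  "v \<epsilon> x = (Q 1 \<epsilon> x * sin (\<xi> \<bullet> x)) *\<^sub>R p - (Q 0 \<epsilon> x * cos (\<xi> \<bullet> x)) *\<^sub>R axis 3 1"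

definition \<Theta> :: "real \<Rightarrow> real^3 \<Rightarrow> real^3" where
  "\<Theta> \<epsilon> x = \<epsilon> *\<^sub>R w x + \<epsilon>\<^sup>2 *\<^sub>R v \<epsilon> x"

lemma w_nth: "w x $ j = \<Psi> 1 (x $ 3) * sin (\<xi> \<bullet> x) * p $ j - \<Psi> 0 (x $ 3) * cos (\<xi> \<bullet> x) * axis 3 1 $ j"
  by (simp add: w_def)

lemma v_nth: "v \<epsilon> x $ j = Q 1 \<epsilon> x * sin (\<xi> \<bullet> x) * p $ j - Q 0 \<epsilon> x * cos (\<xi> \<bullet> x) * axis 3 1 $ j"
  by (simp add: v_def)

lemma w_alg: "(\<lambda>\<epsilon> x. w x $ j) \<in> alg I gens"
  unfolding w_nth by (intro alg_intros)

lemma v_alg: "(\<lambda>\<epsilon> x. v \<epsilon> x $ j) \<in> alg I gens"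
  unfolding v_nth by (intro alg_intros)

lemma half_in_I: "\<epsilon>1 / 2 \<in> I" using \<epsilon>1 by auto

lemma w_smooth: "smooth (\<lambda>x. w x $ j)"
  using alg_smooth[OF gens_closed w_alg half_in_I] .

lemma v_smooth: "\<epsilon> \<in> I \<Longrightarrow> smooth (\<lambda>x. v \<epsilon> x $ j)"
  using alg_smooth[OF gens_closed v_alg] .

lemma Theta_alg: "(\<lambda>\<epsilon> x. \<Theta> \<epsilon> x $ j) \<in> alg I gens"
  unfolding \<Theta>_def power2_eq_square by (simp, intro alg_intros w_alg v_alg)

lemma Theta_smooth: "\<epsilon> \<in> I \<Longrightarrow> smooth (\<lambda>x. \<Theta> \<epsilon> x $ j)"
  using alg_smooth[OF gens_closed Theta_alg] .

lemma trig_periodic: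
  assumes "y = (2*pi*L1) *\<^sub>R axis 1 1 \<or> y = (2*pi*L2) *\<^sub>R axis 2 1"
  shows "cos (\<xi> \<bullet> (x + y)) = cos (\<xi> \<bullet> x)" "sin (\<xi> \<bullet> (x + y)) = sin (\<xi> \<bullet> x)" "(x + y) $ 3 = x $ 3"
proof -
  obtain m n :: int where mn: "\<xi> $ 1 = m / L1" "\<xi> $ 2 = n / L2" using freq unfolding freq_def by blast
  have "\<exists>k::int. \<xi> \<bullet> y = 2 * pi * k"
    using assms mn L by (auto simp: inner_axis)
  then obtain k :: int where "\<xi> \<bullet> y = 2 * pi * k" ..
  then show "cos (\<xi> \<bullet> (x + y)) = cos (\<xi> \<bullet> x)" "sin (\<xi> \<bullet> (x + y)) = sin (\<xi> \<bullet> x)"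
    by (simp_all add: inner_add_right cos_add sin_add sin_int_2pin cos_int_2pin)
  show "(x + y) $ 3 = x $ 3" using assms by (auto simp: axis_def)
qed

lemma Z_periodic:
  assumes "y = (2*pi*L1) *\<^sub>R axis 1 1 \<or> y = (2*pi*L2) *\<^sub>R axis 2 1"
  shows "Z \<epsilon> (x + y) = Z \<epsilon> x"
  unfolding Z_def trig_periodic[OF assms] ..

lemma periodic_w: "periodic L1 L2 w"
  unfolding periodic_def w_def by (simp only: trig_periodic disj_comms simp_thms)

lemma periodic_v: "periodic L1 L2 (v \<epsilon>)"
  unfolding periodic_def v_def Q_def by (simp only: trig_periodic Z_periodic simp_thms)

lemma periodic_Theta: "periodic L1 L2 (\<Theta> \<epsilon>)"
  using periodic_w periodic_v[of \<epsilon>] by (simp add: periodic_def \<Theta>_def)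

text \<open>At a height where \<Psi> 0 vanishes, x_3 itself solves the implicit equation, so Z = x_3
  by uniqueness and the displacement is zero there. The interval is therefore the same for all
  \<epsilon>.\<close>

lemma support:
  "\<exists>c d. 0 < c \<and> c < d \<and> d < h \<and> (\<forall>x. x $ 3 \<notin> {c<..<d} \<longrightarrow> w x = 0 \<and> (\<forall>\<epsilon>\<in>I. \<Theta> \<epsilon> x = 0))"
proof -
  obtain c d where cd: "0 < c" "c < d" "d < h" and z: "\<And>m t. t \<notin> {c<..<d} \<Longrightarrow> \<Psi> m t = 0"
    using bump unfolding bump_seq_def by blast
  have w0: "w x = 0" if "x $ 3 \<notin> {c<..<d}" for x using z[OF that] by (simp add: w_def)
  have T0: "\<Theta> \<epsilon> x = 0" if e: "\<epsilon> \<in> I" and x: "x $ 3 \<notin> {c<..<d}" for \<epsilon> x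
  proof -
    have "Z \<epsilon> x = x $ 3" using z[OF x] by (intro Z_eqI[OF e]) simp
    then show ?thesis using w0[OF x] by (simp add: \<Theta>_def v_def Q_def)
  qed
  show ?thesis using cd w0 T0 by blast
qed

lemma pd_w: "pd i (\<lambda>x. w x $ j) x =
   p $ j * ((if i = 3 then 1 else 0) * \<Psi> 2 (x $ 3) * sin (\<xi> \<bullet> x) + \<Psi> 1 (x $ 3) * cos (\<xi> \<bullet> x) * \<xi> $ i)
   - (if j = 3 then 1 else 0) * ((if i = 3 then 1 else 0) * \<Psi> 1 (x $ 3) * cos (\<xi> \<bullet> x) - \<Psi> 0 (x $ 3) * sin (\<xi> \<bullet> x) * \<xi> $ i)"
proof -
  have eq: "(\<lambda>x. w x $ j) = (\<lambda>x. p $ j * (\<Psi> 1 (x $ 3) * sin (\<xi> \<bullet> x)) + (- (if j = 3 then 1 else 0)) * (\<Psi> 0 (x $ 3) * cos (\<xi> \<bullet> x)))"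
    by (auto simp: w_nth axis_def fun_eq_iff)
  show ?thesis
    unfolding eq pd_bilinear[OF differentiable_Psi_coord differentiable_trig(2) differentiable_Psi_coord differentiable_trig(1)]
      pd_Psi_coord pd_trig
    by (simp add: numeral_2_eq_2 algebra_simps)
qed

lemma dird_w: "dird M (\<lambda>x. w x $ j) x =
   p $ j * (M $ 3 * \<Psi> 2 (x $ 3) * sin (\<xi> \<bullet> x) + (M \<bullet> \<xi>) * \<Psi> 1 (x $ 3) * cos (\<xi> \<bullet> x))
   - (if j = 3 then 1 else 0) * (M $ 3 * \<Psi> 1 (x $ 3) * cos (\<xi> \<bullet> x) - (M \<bullet> \<xi>) * \<Psi> 0 (x $ 3) * sin (\<xi> \<bullet> x))"
  unfolding dird_def pd_w by (simp add: sum_3 inner_vec_def algebra_simps)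

lemma divergence_free_w: "(\<Sum>j\<in>UNIV. pd j (\<lambda>y. w y $ j) x) = 0"
proof -
  have "(\<Sum>j\<in>UNIV. pd j (\<lambda>y. w y $ j) x) =
    \<Psi> 1 (x $ 3) * cos (\<xi> \<bullet> x) * (p $ 1 * \<xi> $ 1 + p $ 2 * \<xi> $ 2) - \<Psi> 1 (x $ 3) * cos (\<xi> \<bullet> x)"
    unfolding pd_w by (simp add: sum_3 p_xi(2) algebra_simps)
  then show ?thesis by (simp add: p_xi_sum)
qed

lemma Csigma_w: "Csigma L1 L2 h w"
proof -
  obtain c d where "0 < c" "c < d" "d < h" "\<forall>x. x $ 3 \<notin> {c<..<d} \<longrightarrow> w x = 0 \<and> (\<forall>\<epsilon>\<in>I. \<Theta> \<epsilon> x = 0)"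
    using support by blast
  then show ?thesis
    unfolding Csigma_def using w_smooth periodic_w divergence_free_w
    by (intro conjI exI[of _ c] exI[of _ d]) auto
qed

lemma test_per_Theta: "\<epsilon> \<in> I \<Longrightarrow> test_per L1 L2 h (\<lambda>x. \<Theta> \<epsilon> x $ j)"
proof -
  assume e: "\<epsilon> \<in> I"
  obtain c d where cd: "0 < c" "c < d" "d < h" "\<forall>x. x $ 3 \<notin> {c<..<d} \<longrightarrow> w x = 0 \<and> (\<forall>\<epsilon>\<in>I. \<Theta> \<epsilon> x = 0)"
    using support by blast
  have "periodic L1 L2 (\<lambda>x. \<Theta> \<epsilon> x $ j)" using periodic_Theta[of \<epsilon>] by (simp add: periodic_def)
  moreover have "\<Theta> \<epsilon> x $ j = 0" if "x $ 3 \<notin> {c<..<d}" for x using cd(4) e that by simp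
  ultimately show ?thesis
    unfolding test_per_def using Theta_smooth[OF e, of j] cd(1-3) by blast
qed

text \<open>The right-hand side has the shape of \<open>pd_bilinear\<close>; hence the factor 1.\<close>

lemma Theta_eq:
  assumes e: "\<epsilon> \<in> I"
  shows "\<Theta> \<epsilon> x $ j = (\<epsilon> * p $ j) * (\<Psi> 1 (Z \<epsilon> x) * sin (\<xi> \<bullet> x)) + (if j = 3 then 1 else 0) * ((Z \<epsilon> x - x $ 3) * 1)"
proof -
  have ne: "\<epsilon> \<noteq> 0" using e by auto
  have Q: "\<epsilon>\<^sup>2 * Q m \<epsilon> x = \<epsilon> * (\<Psi> m (Z \<epsilon> x) - \<Psi> m (x $ 3))" for m
    using ne by (simp add: Q_def power2_eq_square)
  have "\<Theta> \<epsilon> x $ j = \<epsilon> * w x $ j + (\<epsilon>\<^sup>2 * Q 1 \<epsilon> x) * sin (\<xi> \<bullet> x) * p $ j - (\<epsilon>\<^sup>2 * Q 0 \<epsilon> x) * cos (\<xi> \<bullet> x) * axis 3 1 $ j"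
    by (simp add: \<Theta>_def v_nth algebra_simps)
  also have "\<dots> = \<epsilon> * (p $ j * (\<Psi> 1 (Z \<epsilon> x) * sin (\<xi> \<bullet> x))) - (\<epsilon> * \<Psi> 0 (Z \<epsilon> x) * cos (\<xi> \<bullet> x)) * axis 3 1 $ j"
    unfolding Q by (simp add: w_nth algebra_simps)
  also have "\<epsilon> * \<Psi> 0 (Z \<epsilon> x) * cos (\<xi> \<bullet> x) = x $ 3 - Z \<epsilon> x" using Z_eq[OF e, of x] by linarith
  finally show ?thesis by (simp add: axis_def)
qed

lemma pd_Theta:
  assumes e: "\<epsilon> \<in> I"
  shows "pd i (\<lambda>x. \<Theta> \<epsilon> x $ j) x =
    \<epsilon> * (p $ j * (\<Psi> 1 (Z \<epsilon> x) * (cos (\<xi> \<bullet> x) * \<xi> $ i) + \<Psi> 2 (Z \<epsilon> x) * pd i (Z \<epsilon>) x * sin (\<xi> \<bullet> x)))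
    + (if j = 3 then 1 else 0) * (pd i (Z \<epsilon>) x - (if i = 3 then 1 else 0))"
proof -
  have d: "(\<lambda>x. Z \<epsilon> x - x $ 3) differentiable at x"
    by (intro differentiable_diff Z_differentiable[OF e] differentiable_coord)
  show ?thesis
    unfolding Theta_eq[OF e] pd_bilinear[OF differentiable_Psi_Z[OF e] differentiable_trig(2) d differentiable_const]
      pd_diff[OF Z_differentiable[OF e] differentiable_coord] pd_Psi_Z[OF e] pd_trig pd_coord
    by (simp add: numeral_2_eq_2 algebra_simps)
qed

text \<open>The map is a composition: replacing x_3 by \<open>Z\<close> has determinant
  \<open>E\<close>, and the horizontal shift along p at fixed \<open>Z\<close> has determinant 1 +
  \<epsilon> \<Psi> 1 (Z) cos(\<xi>\<cdot>x) because p\<cdot>\<xi> = 1. The two factors are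
  reciprocal.\<close>

lemma det_Theta:
  assumes e: "\<epsilon> \<in> I"
  shows "det (\<chi> i j. (if i = j then 1 else 0) + pd j (\<lambda>y. \<Theta> \<epsilon> y $ i) x) = (1::real)"
proof -
  define a b d where "a = \<epsilon> * \<Psi> 1 (Z \<epsilon> x) * cos (\<xi> \<bullet> x)" and "b = \<epsilon> * \<Psi> 2 (Z \<epsilon> x) * sin (\<xi> \<bullet> x)"
    and "d = \<epsilon> * \<Psi> 0 (Z \<epsilon> x) * sin (\<xi> \<bullet> x)"
  define e' where "e' = E \<epsilon> x"
  have ea: "e' * (1 + a) = 1" using E_mult[OF e, of x] by (simp add: e'_def a_def)
  have Z: "pd i (Z \<epsilon>) x = e' * ((if i = 3 then 1 else 0) + d * \<xi> $ i)" for i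
    unfolding pd_Z[OF e] by (simp add: e'_def d_def)
  have entry: "pd j (\<lambda>y. \<Theta> \<epsilon> y $ i) x = p $ i * (a * \<xi> $ j + b * pd j (Z \<epsilon>) x)
     + (if i = 3 then 1 else 0) * (pd j (Z \<epsilon>) x - (if j = 3 then 1 else 0))" for i j
    unfolding pd_Theta[OF e] by (simp add: a_def b_def algebra_simps)
  have "det (\<chi> i j. (if i = j then 1 else 0) + pd j (\<lambda>y. \<Theta> \<epsilon> y $ i) x) = e' * (1 + a * (p $ 1 * \<xi> $ 1 + p $ 2 * \<xi> $ 2))"
    unfolding entry Z det_3 by (simp add: p_xi(2) algebra_simps)
  then show ?thesis using ea by (simp add: p_xi_sum)
qed

text \<open>The displacement is \<epsilon> times w + \<epsilon> v, a member of the algebra, whose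
  first derivatives are bounded uniformly in \<epsilon>.\<close>

lemma Theta_lipschitz: "\<exists>B>0. \<forall>\<epsilon>\<in>I. \<forall>x y. norm (\<Theta> \<epsilon> x - \<Theta> \<epsilon> y) \<le> \<epsilon> * B * norm (x - y)"
proof -
  have alg: "(\<lambda>\<epsilon> x. w x $ j + \<epsilon> * v \<epsilon> x $ j) \<in> alg I gens" for j
    by (intro alg_intros w_alg v_alg)
  have "\<forall>j. \<exists>B. \<forall>\<epsilon>\<in>I. \<forall>i x. \<bar>pd i (\<lambda>x. w x $ j + \<epsilon> * v \<epsilon> x $ j) x\<bar> \<le> B"
  proof
    fix j
    obtain B where B: "\<forall>\<epsilon>\<in>I. \<forall>\<alpha>. length \<alpha> \<le> 1 \<longrightarrow> (\<forall>x. \<bar>pds \<alpha> (\<lambda>x. w x $ j + \<epsilon> * v \<epsilon> x $ j) x\<bar> \<le> B)"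
      using alg_pds_bounded[OF gens_closed alg] by blast
    show "\<exists>B. \<forall>\<epsilon>\<in>I. \<forall>i x. \<bar>pd i (\<lambda>x. w x $ j + \<epsilon> * v \<epsilon> x $ j) x\<bar> \<le> B"
    proof (intro exI[of _ B] ballI allI)
      fix \<epsilon> i x assume "\<epsilon> \<in> I"
      then show "\<bar>pd i (\<lambda>x. w x $ j + \<epsilon> * v \<epsilon> x $ j) x\<bar> \<le> B" using B[rule_format, of \<epsilon> "[i]" x] by simp
    qed
  qed
  then obtain B where B: "\<And>j \<epsilon> i x. \<epsilon> \<in> I \<Longrightarrow> \<bar>pd i (\<lambda>x. w x $ j + \<epsilon> * v \<epsilon> x $ j) x\<bar> \<le> B j" by metis
  define C where "C = (\<Sum>j\<in>UNIV. 3 * \<bar>B j\<bar>) + 1"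
  have "C > 0" unfolding C_def by (intro add_nonneg_pos sum_nonneg) auto
  moreover have "norm (\<Theta> \<epsilon> x - \<Theta> \<epsilon> y) \<le> \<epsilon> * C * norm (x - y)" if e: "\<epsilon> \<in> I" for \<epsilon> x y
  proof -
    have "\<bar>(\<Theta> \<epsilon> x - \<Theta> \<epsilon> y) $ j\<bar> \<le> \<epsilon> * (3 * \<bar>B j\<bar> * norm (x - y))" for j
    proof -
      have "\<bar>(w x $ j + \<epsilon> * v \<epsilon> x $ j) - (w y $ j + \<epsilon> * v \<epsilon> y $ j)\<bar> \<le> 3 * \<bar>B j\<bar> * norm (x - y)"
        using order_trans[OF B[OF e, of _ j] abs_ge_self] alg_differentiable[OF gens_closed alg e, of j]
        by (intro bounded_pd_lipschitz)
      then have "\<epsilon> * \<bar>(w x $ j + \<epsilon> * v \<epsilon> x $ j) - (w y $ j + \<epsilon> * v \<epsilon> y $ j)\<bar> \<le> \<epsilon> * (3 * \<bar>B j\<bar> * norm (x - y))"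
        using e by (intro mult_left_mono) auto
      moreover have "(\<Theta> \<epsilon> x - \<Theta> \<epsilon> y) $ j = \<epsilon> * ((w x $ j + \<epsilon> * v \<epsilon> x $ j) - (w y $ j + \<epsilon> * v \<epsilon> y $ j))"
        by (simp add: \<Theta>_def power2_eq_square algebra_simps)
      ultimately show ?thesis using e by (simp add: abs_mult)
    qed
    then have "norm (\<Theta> \<epsilon> x - \<Theta> \<epsilon> y) \<le> (\<Sum>j\<in>UNIV. \<epsilon> * (3 * \<bar>B j\<bar> * norm (x - y)))"
      by (intro order_trans[OF norm_le_l1_cart] sum_mono)
    also have "\<dots> = \<epsilon> * ((\<Sum>j\<in>UNIV. 3 * \<bar>B j\<bar>) * norm (x - y))"
      by (simp add: sum_distrib_left sum_distrib_right)
    also have "\<dots> \<le> \<epsilon> * (C * norm (x - y))"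
      using e by (intro mult_left_mono mult_right_mono) (auto simp: C_def)
    finally show ?thesis by (simp add: mult.assoc)
  qed
  ultimately show ?thesis by blast
qed

lemma Hk1_0star_Theta: "\<exists>\<epsilon>2>0. \<epsilon>2 \<le> \<epsilon>1 \<and> (\<forall>\<epsilon>\<in>{0<..<\<epsilon>2}. \<forall>k. Hk1_0star L1 L2 h k (\<Theta> \<epsilon>))"
proof -
  obtain B where B: "B > 0" "\<And>\<epsilon> x y. \<epsilon> \<in> I \<Longrightarrow> norm (\<Theta> \<epsilon> x - \<Theta> \<epsilon> y) \<le> \<epsilon> * B * norm (x - y)"
    using Theta_lipschitz by blast
  \<comment> \<open>Below this threshold the Lipschitz constant \<epsilon> B is at most 1/2, as
    \<open>homeomorphism_id_plus\<close> demands. The threshold does not depend on k, since the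
    displacement is smooth.\<close>
  define \<epsilon>2 where "\<epsilon>2 = min \<epsilon>1 (1 / (2 * B))"
  have "\<epsilon>2 > 0" using B(1) \<epsilon>1 by (simp add: \<epsilon>2_def)
  moreover have "Hk1_0star L1 L2 h k (\<Theta> \<epsilon>)" if "\<epsilon> \<in> {0<..<\<epsilon>2}" for \<epsilon> k
  proof -
    have e: "\<epsilon> \<in> I" using that by (auto simp: \<epsilon>2_def)
    have "\<epsilon> * B \<le> 1 / 2" using that B(1) by (auto simp: \<epsilon>2_def field_simps)
    obtain c d where cd: "0 < c" "c < d" "d < h" "\<forall>x. x $ 3 \<notin> {c<..<d} \<longrightarrow> w x = 0 \<and> (\<forall>\<epsilon>\<in>I. \<Theta> \<epsilon> x = 0)"
      using support by blast
    have "\<exists>g. homeomorphism (cstrip h) (cstrip h) (\<lambda>y. \<Theta> \<epsilon> y + y) g"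
    proof (rule homeomorphism_id_plus)
      show "norm (\<Theta> \<epsilon> x - \<Theta> \<epsilon> y) \<le> norm (x - y) / 2" for x y
        using B(2)[OF e, of x y] mult_right_mono[OF \<open>\<epsilon> * B \<le> 1 / 2\<close>, of "norm (x - y)"] by simp
      show "\<Theta> \<epsilon> x = 0" if "x \<notin> cstrip h" for x
        using that cd e by (auto simp: cstrip_def)
    qed
    moreover have "H10_vec L1 L2 h (\<Theta> \<epsilon>)"
      unfolding H10_vec_def using H10_test_per test_per_Theta[OF e] by blast
    moreover have "Hk_vec L1 L2 h k (\<Theta> \<epsilon>)"
      unfolding Hk_vec_def using test_per_Theta[OF e] by (auto intro!: Hk_smooth simp: test_per_def)
    moreover have "AE x in lborel. x \<in> strip h \<longrightarrow>
        det (\<chi> i j. (if i = j then 1 else 0) + wpd h (\<lambda>y. \<Theta> \<epsilon> y $ i) j x) = (1::real)"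
    proof -
      have "AE x in lborel. \<forall>i j. x \<in> strip h \<longrightarrow> wpd h (\<lambda>y. \<Theta> \<epsilon> y $ i) j x = pd j (\<lambda>y. \<Theta> \<epsilon> y $ i) x"
        using wpd_AE[OF weak_pd_smooth[OF Theta_smooth[OF e]]]
        by (simp only: AE_all_countable) blast
      then show ?thesis
        by (rule AE_mp) (use det_Theta[OF e] in \<open>auto intro!: AE_I2\<close>)
    qed
    ultimately show ?thesis by (simp add: Hk1_0star_def)
  qed
  ultimately show ?thesis by (intro exI[of _ \<epsilon>2]) (auto simp: \<epsilon>2_def)
qed

text \<open>The cell has finite measure, so the uniform sup bounds on derivatives supplied by the
  algebra become a Sobolev bound that does not see \<epsilon>.\<close>

lemma Hk_norm_v_bounded: "\<exists>B. \<forall>\<epsilon>\<in>I. Hk_norm L1 L2 h k (v \<epsilon>) \<le> B"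
proof -
  have "\<forall>j. \<exists>B. \<forall>\<epsilon>\<in>I. Hk_sqnorm L1 L2 h k (\<lambda>x. v \<epsilon> x $ j) \<le> B"
  proof
    fix j
    obtain B where "\<forall>\<epsilon>\<in>I. \<forall>\<alpha>. length \<alpha> \<le> k \<longrightarrow> (\<forall>x. \<bar>pds \<alpha> (\<lambda>x. v \<epsilon> x $ j) x\<bar> \<le> B)"
      using alg_pds_bounded[OF gens_closed v_alg] by blast
    then show "\<exists>B. \<forall>\<epsilon>\<in>I. Hk_sqnorm L1 L2 h k (\<lambda>x. v \<epsilon> x $ j) \<le> B"
      using Hk_sqnorm_bound[OF v_smooth] by blast
  qed
  then obtain B where "\<And>j \<epsilon>. \<epsilon> \<in> I \<Longrightarrow> Hk_sqnorm L1 L2 h k (\<lambda>x. v \<epsilon> x $ j) \<le> B j" by metis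
  then have "Hk_norm L1 L2 h k (v \<epsilon>) \<le> sqrt (\<Sum>j\<in>UNIV. B j)" if "\<epsilon> \<in> I" for \<epsilon>
    unfolding Hk_norm_def using that by (intro real_sqrt_le_mono sum_mono)
  then show ?thesis by blast
qed

end

section \<open>Inequalities in the Sobolev space and trigonometric integrals\<close>

text \<open>The energy is written with the chosen derivatives \<open>wpd\<close>; this exchanges
  them for a family with square-integrable members, on which limits and estimates can
  operate.\<close>

lemma set_integral_wpd:
  assumes D: "hk_family L1 L2 h 1 f D"
  shows "(LINT x:cell L1 L2 h|lborel. (\<Sum>i\<in>UNIV. M $ i * wpd h f i x)\<^sup>2) =
    (LINT x:cell L1 L2 h|lborel. (\<Sum>i\<in>UNIV. M $ i * D [i] x)\<^sup>2)"
proof (rule set_integral_cong_AE')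
  have wk: "weak_pd h f i (D [i])" for i
    using D unfolding hk_family_def by (metis One_nat_def less_Suc0 list.size(3))
  have "weak_pd h f i (wpd h f i)" for i
    unfolding wpd_def by (rule someI[of "weak_pd h f i"]) (rule wk)
  then have m [measurable]: "(\<lambda>x. indicator (strip h) x *\<^sub>R wpd h f i x) \<in> borel_measurable lborel" for i
    using loc_int_measurable by (auto simp: weak_pd_def set_borel_measurable_def)
  \<comment> \<open>Nothing is known about \<open>wpd\<close> outside the strip, so measurability is
    shown for its truncation, which agrees with it on the cell.\<close>
  have "(\<lambda>x. indicator (cell L1 L2 h) x *\<^sub>R (\<Sum>i\<in>UNIV. M $ i * (indicator (strip h) x *\<^sub>R wpd h f i x))\<^sup>2) \<in> borel_measurable lborel"
    by measurable
  also have "(\<lambda>x. indicator (cell L1 L2 h) x *\<^sub>R (\<Sum>i\<in>UNIV. M $ i * (indicator (strip h) x *\<^sub>R wpd h f i x))\<^sup>2) =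
    (\<lambda>x. indicator (cell L1 L2 h) x *\<^sub>R (\<Sum>i\<in>UNIV. M $ i * wpd h f i x)\<^sup>2)"
    using cell_subset_strip[of L1 L2 h] by (auto simp: fun_eq_iff indicator_def)
  finally show "set_borel_measurable lborel (cell L1 L2 h) (\<lambda>x. (\<Sum>i\<in>UNIV. M $ i * wpd h f i x)\<^sup>2)"
    by (simp add: set_borel_measurable_def)
  have [measurable]: "D [i] \<in> borel_measurable lborel" for i using D by (auto simp: hk_family_def)
  show "set_borel_measurable lborel (cell L1 L2 h) (\<lambda>x. (\<Sum>i\<in>UNIV. M $ i * D [i] x)\<^sup>2)"
    unfolding set_borel_measurable_def by measurable
  have "AE x in lborel. \<forall>i. x \<in> cell L1 L2 h \<longrightarrow> wpd h f i x = D [i] x"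
    unfolding AE_all_countable using AE_cell[OF wpd_AE[OF wk]] by blast
  then show "AE x in lborel. x \<in> cell L1 L2 h \<longrightarrow> (\<Sum>i\<in>UNIV. M $ i * wpd h f i x)\<^sup>2 = (\<Sum>i\<in>UNIV. M $ i * D [i] x)\<^sup>2"
    by (rule AE_mp) (auto intro!: AE_I2)
qed

text \<open>Both sides are continuous under H^1 convergence: the left by \<open>L2_tendsto\<close>
  with the bounded weight q, the right with weight 1, after Cauchy-Schwarz over the three directions
  shows that the derivatives along v converge in L^2.\<close>

lemma line_inequality:
  assumes L: "0 < L1" "0 < L2" and q: "continuous_on UNIV q" and v: "v $ 3 = 1"
    and hyp: "\<And>\<Psi>. bump_seq h \<Psi> \<Longrightarrow>
      (LINT t:{0<..<h}|lborel. q t * (\<Psi> 0 t)\<^sup>2) \<le> \<kappa> * (LINT t:{0<..<h}|lborel. (\<Psi> 1 t)\<^sup>2)"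
    and f: "H10 L1 L2 h f"
  shows "(LINT x:cell L1 L2 h|lborel. q (x$3) * (f x)\<^sup>2)
    \<le> \<kappa> * (LINT x:cell L1 L2 h|lborel. (\<Sum>i\<in>UNIV. v $ i * wpd h f i x)\<^sup>2)"
proof -
  let ?C = "cell L1 L2 h"
  obtain D \<phi> where D: "hk_family L1 L2 h 1 f D" and t: "\<And>n. test_per L1 L2 h (\<phi> n)"
    and lim0: "(\<lambda>n. LINT x:?C|lborel. (f x - \<phi> n x)\<^sup>2) \<longlonglongrightarrow> 0"
    and lim1: "\<And>i. (\<lambda>n. LINT x:?C|lborel. (D [i] x - pd i (\<phi> n) x)\<^sup>2) \<longlonglongrightarrow> 0"
    using H10_approx[OF f] by blast
  have s: "smooth (\<phi> n)" for n using t by (simp add: test_per_def)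
  have cd: "continuous_on UNIV (pd i (\<phi> n))" for i n by (intro smooth_continuous smooth_pd s)
  have [measurable]: "\<phi> n \<in> borel_measurable borel" "pd i (\<phi> n) \<in> borel_measurable borel" for n i
    by (intro borel_measurable_continuous_onI smooth_continuous s smooth_pd)+
  have D0: "D [] = f" using D by (simp add: hk_family_def)
  have Dm: "D \<alpha> \<in> borel_measurable lborel" "set_integrable lborel ?C (\<lambda>x. (D \<alpha> x)\<^sup>2)" if "length \<alpha> \<le> 1" for \<alpha>
    using D that by (auto simp: hk_family_def)
  have [measurable]: "D [i] \<in> borel_measurable borel" "f \<in> borel_measurable borel" for i
    using Dm(1)[of "[i]"] Dm(1)[of "[]"] D0 by auto
  have [measurable]: "q \<in> borel_measurable borel" by (rule borel_measurable_continuous_onI[OF q])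
  obtain Q where Q: "\<And>x. x \<in> ?C \<Longrightarrow> \<bar>q (x $ 3)\<bar> \<le> Q"
  proof -
    have "compact (q ` {0..h})" by (rule compact_continuous_image[OF continuous_on_subset[OF q]]) auto
    then obtain Q where Q: "\<forall>y\<in>q ` {0..h}. norm y \<le> Q" using compact_imp_bounded bounded_iff by blast
    show ?thesis by (rule that[of Q]) (use Q in \<open>auto simp: cell_def\<close>)
  qed
  define u where "u x = (\<Sum>i\<in>UNIV. v $ i * D [i] x)" for x
  have A: "(\<lambda>n. LINT x:?C|lborel. q (x $ 3) * (\<phi> n x)\<^sup>2) \<longlonglongrightarrow> (LINT x:?C|lborel. q (x $ 3) * (f x)\<^sup>2)"
  proof (rule L2_tendsto[OF _ _ _ _ _ _ Q lim0])
    show "set_integrable lborel ?C (\<lambda>x. (f x)\<^sup>2)" using Dm(2)[of "[]"] D0 by simp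
    show "set_integrable lborel ?C (\<lambda>x. (\<phi> n x)\<^sup>2)" for n
      by (intro cell_integrable_continuous continuous_on_power smooth_continuous s)
    show "(\<lambda>x. q (x $ 3)) \<in> borel_measurable lborel" "f \<in> borel_measurable lborel" "cell L1 L2 h \<in> sets lborel"
      "\<phi> n \<in> borel_measurable lborel" for n by measurable
  qed
  have CS: "(\<Sum>i\<in>UNIV. v $ i * b i)\<^sup>2 \<le> (\<Sum>i\<in>UNIV. (v $ i)\<^sup>2) * (\<Sum>i\<in>UNIV. (b i)\<^sup>2)" for b :: "3 \<Rightarrow> real"
    by (rule Cauchy_Schwarz_ineq_sum)
  have int_d: "set_integrable lborel ?C (\<lambda>x. (D [i] x - pd i (\<phi> n) x)\<^sup>2)" for i n
    by (intro set_integrable_sq_diff Dm cell_integrable_continuous continuous_on_power cd) auto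
  have int_u: "set_integrable lborel ?C (\<lambda>x. (u x)\<^sup>2)"
    unfolding set_integrable_def
  proof (rule Bochner_Integration.integrable_bound)
    show "integrable lborel (\<lambda>x. (\<Sum>i\<in>UNIV. (v $ i)\<^sup>2) * (\<Sum>i\<in>UNIV. indicator ?C x *\<^sub>R (D [i] x)\<^sup>2))"
      using Dm(2)[of "[_]"] by (intro integrable_mult_right Bochner_Integration.integrable_sum) (auto simp: set_integrable_def)
    show "AE x in lborel. norm (indicator ?C x *\<^sub>R (u x)\<^sup>2) \<le> norm ((\<Sum>i\<in>UNIV. (v $ i)\<^sup>2) * (\<Sum>i\<in>UNIV. indicator ?C x *\<^sub>R (D [i] x)\<^sup>2))"
    proof (intro AE_I2)
      fix x
      have "0 \<le> (\<Sum>i\<in>UNIV. (v $ i)\<^sup>2) * (\<Sum>i\<in>UNIV. (D [i] x)\<^sup>2)" by (intro mult_nonneg_nonneg sum_nonneg) auto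
      then show "norm (indicator ?C x *\<^sub>R (u x)\<^sup>2) \<le> norm ((\<Sum>i\<in>UNIV. (v $ i)\<^sup>2) * (\<Sum>i\<in>UNIV. indicator ?C x *\<^sub>R (D [i] x)\<^sup>2))"
        using CS[of "\<lambda>i. D [i] x"] by (cases "x \<in> ?C") (auto simp: u_def)
    qed
  qed (unfold u_def, measurable)
  have "(\<lambda>n. LINT x:?C|lborel. (u x - dird v (\<phi> n) x)\<^sup>2) \<longlonglongrightarrow> 0"
  proof (rule tendsto_sandwich[OF _ _ tendsto_const])
    show "\<forall>\<^sub>F n in sequentially. 0 \<le> (LINT x:?C|lborel. (u x - dird v (\<phi> n) x)\<^sup>2)"
      by (intro always_eventually allI set_integral_sq_nonneg)
    have "(LINT x:?C|lborel. (u x - dird v (\<phi> n) x)\<^sup>2)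
        \<le> (\<Sum>i\<in>UNIV. (v $ i)\<^sup>2) * (\<Sum>i\<in>UNIV. LINT x:?C|lborel. (D [i] x - pd i (\<phi> n) x)\<^sup>2)" for n
    proof -
      have sumint: "set_integrable lborel ?C (\<lambda>x. \<Sum>i\<in>UNIV. (D [i] x - pd i (\<phi> n) x)\<^sup>2)"
        using int_d unfolding set_integrable_def scaleR_sum_right by (intro Bochner_Integration.integrable_sum) auto
      have "\<bar>LINT x:?C|lborel. (u x - dird v (\<phi> n) x)\<^sup>2\<bar>
        \<le> (LINT x:?C|lborel. (\<Sum>i\<in>UNIV. (v $ i)\<^sup>2) * (\<Sum>i\<in>UNIV. (D [i] x - pd i (\<phi> n) x)\<^sup>2))"
      proof (rule set_integral_abs_bound)
        show "set_integrable lborel ?C (\<lambda>x. (\<Sum>i\<in>UNIV. (v $ i)\<^sup>2) * (\<Sum>i\<in>UNIV. (D [i] x - pd i (\<phi> n) x)\<^sup>2))"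
          using sumint by simp
        have "u x - dird v (\<phi> n) x = (\<Sum>i\<in>UNIV. v $ i * (D [i] x - pd i (\<phi> n) x))" for x
          by (simp add: u_def dird_def right_diff_distrib sum_subtractf)
        then show "AE x in lborel. x \<in> ?C \<longrightarrow> \<bar>(u x - dird v (\<phi> n) x)\<^sup>2\<bar>
            \<le> (\<Sum>i\<in>UNIV. (v $ i)\<^sup>2) * (\<Sum>i\<in>UNIV. (D [i] x - pd i (\<phi> n) x)\<^sup>2)"
          using CS by simp
      qed
      also have "\<dots> = (\<Sum>i\<in>UNIV. (v $ i)\<^sup>2) * (LINT x:?C|lborel. \<Sum>i\<in>UNIV. (D [i] x - pd i (\<phi> n) x)\<^sup>2)"
        by simp
      also have "(LINT x:?C|lborel. \<Sum>i\<in>UNIV. (D [i] x - pd i (\<phi> n) x)\<^sup>2) = (\<Sum>i\<in>UNIV. LINT x:?C|lborel. (D [i] x - pd i (\<phi> n) x)\<^sup>2)"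
        using int_d unfolding set_integrable_def set_lebesgue_integral_def scaleR_sum_right
        by (intro Bochner_Integration.integral_sum) auto
      finally show ?thesis by linarith
    qed
    then show "\<forall>\<^sub>F n in sequentially. (LINT x:?C|lborel. (u x - dird v (\<phi> n) x)\<^sup>2)
        \<le> (\<Sum>i\<in>UNIV. (v $ i)\<^sup>2) * (\<Sum>i\<in>UNIV. LINT x:?C|lborel. (D [i] x - pd i (\<phi> n) x)\<^sup>2)" by simp
    have "(\<lambda>n. (\<Sum>i\<in>UNIV. (v $ i)\<^sup>2) * (\<Sum>i\<in>UNIV. LINT x:?C|lborel. (D [i] x - pd i (\<phi> n) x)\<^sup>2))
        \<longlonglongrightarrow> (\<Sum>i\<in>UNIV. (v $ i)\<^sup>2) * (\<Sum>i\<in>(UNIV::3 set). 0)"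
      by (intro tendsto_intros lim1)
    then show "(\<lambda>n. (\<Sum>i\<in>UNIV. (v $ i)\<^sup>2) * (\<Sum>i\<in>UNIV. LINT x:?C|lborel. (D [i] x - pd i (\<phi> n) x)\<^sup>2)) \<longlonglongrightarrow> 0" by simp
  qed
  then have "(\<lambda>n. LINT x:?C|lborel. 1 * (dird v (\<phi> n) x)\<^sup>2) \<longlonglongrightarrow> (LINT x:?C|lborel. 1 * (u x)\<^sup>2)"
  proof (rule L2_tendsto[where Q=1, rotated -1])
    show "u \<in> borel_measurable lborel" unfolding u_def by measurable
    show "dird v (\<phi> n) \<in> borel_measurable lborel" for n unfolding dird_def by measurable
    show "set_integrable lborel ?C (\<lambda>x. (dird v (\<phi> n) x)\<^sup>2)" for n
      unfolding dird_def by (intro cell_integrable_continuous continuous_intros cd)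
  qed (use int_u in auto)
  then have B: "(\<lambda>n. \<kappa> * (LINT x:?C|lborel. (dird v (\<phi> n) x)\<^sup>2)) \<longlonglongrightarrow> \<kappa> * (LINT x:?C|lborel. (u x)\<^sup>2)"
    by (intro tendsto_mult_left) simp
  have "(LINT x:?C|lborel. q (x $ 3) * (f x)\<^sup>2) \<le> \<kappa> * (LINT x:?C|lborel. (u x)\<^sup>2)"
    by (rule LIMSEQ_le[OF A B]) (use line_inequality_smooth[OF L q v hyp t] in auto)
  then show ?thesis unfolding set_integral_wpd[OF D] u_def .
qed

section \<open>Poincare inequality along a transversal direction\<close>

lemma bump_seq_continuous: "bump_seq h \<Psi> \<Longrightarrow> continuous_on A (\<Psi> m)"
  unfolding bump_seq_def by (intro continuous_at_imp_continuous_on) (auto intro: DERIV_isCont)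

text \<open>Integrate the derivative of \<open>t \<Psi>\<^sub>0(t)\<^sup>2\<close> over \<open>(0,h)\<close>.\<close>

lemma bump_poincare:
  assumes h: "0 < h" and b: "bump_seq h \<Psi>"
  shows "(LINT t:{0<..<h}|lborel. 1 * (\<Psi> 0 t)\<^sup>2) \<le> 4 * h\<^sup>2 * (LINT t:{0<..<h}|lborel. (\<Psi> 1 t)\<^sup>2)"
proof -
  have d: "(\<Psi> 0 has_real_derivative \<Psi> 1 t) (at t)" for t using b by (simp add: bump_seq_def)
  have c0: "continuous_on A (\<Psi> 0)" and c1: "continuous_on A (\<Psi> 1)" for A by (rule bump_seq_continuous[OF b])+
  have h0: "\<Psi> 0 h = 0" using b unfolding bump_seq_def by auto
  have "((\<lambda>t. (\<Psi> 0 t)\<^sup>2 + 2 * (t * \<Psi> 0 t * \<Psi> 1 t)) has_integral h * (\<Psi> 0 h)\<^sup>2 - 0 * (\<Psi> 0 0)\<^sup>2) {0..h}"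
  proof (rule fundamental_theorem_of_calculus)
    fix t assume "t \<in> {0..h}"
    have "((\<lambda>t. t * (\<Psi> 0 t)\<^sup>2) has_real_derivative (\<Psi> 0 t)\<^sup>2 + 2 * (t * \<Psi> 0 t * \<Psi> 1 t)) (at t)"
      by (rule derivative_eq_intros d refl)+ (simp add: algebra_simps)
    then show "((\<lambda>t. t * (\<Psi> 0 t)\<^sup>2) has_vector_derivative (\<Psi> 0 t)\<^sup>2 + 2 * (t * \<Psi> 0 t * \<Psi> 1 t)) (at t within {0..h})"
      unfolding has_real_derivative_iff_has_vector_derivative by (rule has_vector_derivative_at_within)
  qed (use h in simp)
  then have "integral {0..h} (\<lambda>t. (\<Psi> 0 t)\<^sup>2 + 2 * (t * \<Psi> 0 t * \<Psi> 1 t)) = 0" by (simp add: h0 integral_unique)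
  \<comment> \<open>Completing the square of \<Psi> 0 + 2 t \<Psi> 1 keeps half of the first square;
    with t \<le> h this produces the constant 4 h^2.\<close>
  moreover have "integral {0..h} (\<lambda>t. 1 / 2 * (\<Psi> 0 t)\<^sup>2 - 2 * h\<^sup>2 * (\<Psi> 1 t)\<^sup>2) \<le> integral {0..h} (\<lambda>t. (\<Psi> 0 t)\<^sup>2 + 2 * (t * \<Psi> 0 t * \<Psi> 1 t))"
  proof (rule integral_le)
    show "1 / 2 * (\<Psi> 0 t)\<^sup>2 - 2 * h\<^sup>2 * (\<Psi> 1 t)\<^sup>2 \<le> (\<Psi> 0 t)\<^sup>2 + 2 * (t * \<Psi> 0 t * \<Psi> 1 t)" if "t \<in> {0..h}" for t
    proof -
      have "0 \<le> (\<Psi> 0 t + 2 * t * \<Psi> 1 t)\<^sup>2 / 2" by simp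
      also have "\<dots> = 1 / 2 * (\<Psi> 0 t)\<^sup>2 + 2 * (t * \<Psi> 0 t * \<Psi> 1 t) + 2 * t\<^sup>2 * (\<Psi> 1 t)\<^sup>2"
        by (simp add: power2_eq_square algebra_simps)
      finally have *: "0 \<le> 1 / 2 * (\<Psi> 0 t)\<^sup>2 + 2 * (t * \<Psi> 0 t * \<Psi> 1 t) + 2 * t\<^sup>2 * (\<Psi> 1 t)\<^sup>2" .
      have "t\<^sup>2 * (\<Psi> 1 t)\<^sup>2 \<le> h\<^sup>2 * (\<Psi> 1 t)\<^sup>2" using that by (intro mult_right_mono power_mono) auto
      with * show ?thesis by linarith
    qed
  qed (intro integrable_continuous_real continuous_intros c0 c1)+
  moreover have "integral {0..h} (\<lambda>t. 1 / 2 * (\<Psi> 0 t)\<^sup>2 - 2 * h\<^sup>2 * (\<Psi> 1 t)\<^sup>2)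
      = 1 / 2 * integral {0..h} (\<lambda>t. (\<Psi> 0 t)\<^sup>2) - 2 * h\<^sup>2 * integral {0..h} (\<lambda>t. (\<Psi> 1 t)\<^sup>2)"
    by (subst Henstock_Kurzweil_Integration.integral_diff)
      (auto intro!: integrable_continuous_real continuous_intros bump_seq_continuous[OF b])
  ultimately have "integral {0..h} (\<lambda>t. (\<Psi> 0 t)\<^sup>2) \<le> 4 * h\<^sup>2 * integral {0..h} (\<lambda>t. (\<Psi> 1 t)\<^sup>2)" by simp
  then show ?thesis
    by (simp add: set_integral_open_interval continuous_intros bump_seq_continuous[OF b])
qed

text \<open>The line inequality with weight 1. Any direction transversal to the walls works; with v
  = M / M_3 it bounds the L^2 norm by the magnetic term of the energy.\<close>

lemma poincare:
  assumes "0 < L1" "0 < L2" "0 < h" "v $ 3 = 1" "H10 L1 L2 h f"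
  shows "(LINT x:cell L1 L2 h|lborel. (f x)\<^sup>2)
    \<le> 4 * h\<^sup>2 * (LINT x:cell L1 L2 h|lborel. (\<Sum>i\<in>UNIV. v $ i * wpd h f i x)\<^sup>2)"
  using line_inequality[OF assms(1,2) continuous_on_const assms(4) bump_poincare[OF assms(3)] assms(5)] by simp

section \<open>Integrals of trigonometric profiles over the cell\<close>

lemma cell_integral_height:
  assumes L: "0 < L1" "0 < L2" and u: "continuous_on UNIV u"
  shows "(LINT x:cell L1 L2 h|lborel. u (x $ 3)) = 4 * pi\<^sup>2 * L1 * L2 * (LINT t:{0<..<h}|lborel. u t)"
proof -
  have d: "distinct [1, 2, 3 :: 3]" by simp
  have c: "continuous_on UNIV (\<lambda>x::real^3. u (x $ 3))"
    by (intro continuous_on_compose2[OF u] continuous_intros) auto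
  have m: "measure lborel ({0<..<2*pi*L1} \<times> {0<..<2*pi*L2}) = (2*pi*L1) * (2*pi*L2)"
  proof -
    define a b where "a = 2*pi*L1" and "b = 2*pi*L2"
    have "0 < a" "0 < b" using L by (auto simp: a_def b_def)
    have "emeasure lborel ({0<..<a} \<times> {0<..<b}) = emeasure (lborel \<Otimes>\<^sub>M lborel) ({0<..<a} \<times> {0<..<b})"
      unfolding lborel_prod ..
    also have "\<dots> = ennreal (a * b)"
      using \<open>0 < a\<close> \<open>0 < b\<close> by (subst lborel.emeasure_pair_measure_Times) (auto simp: ennreal_mult)
    finally have "measure lborel ({0<..<a} \<times> {0<..<b}) = a * b"
      using \<open>0 < a\<close> \<open>0 < b\<close> by (simp add: measure_def)
    then show ?thesis by (simp add: a_def b_def)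
  qed
  have "{0<..<2*pi*L1} \<times> {0<..<2*pi*L2} \<in> sets borel" by (intro borel_open open_Times) auto
  then have "(LINT p:({0<..<2*pi*L1} \<times> {0<..<2*pi*L2})|lborel. c0) = (2*pi*L1) * (2*pi*L2) * c0" for c0 :: real
    unfolding set_lebesgue_integral_def by (simp add: m)
  then show ?thesis
    unfolding fubini_cell(2)[OF d c] by (simp add: vec3_nth[OF d] power2_eq_square)
qed

text \<open>In a horizontal direction i with nonzero \<xi>_i the phase runs through a whole number
  of periods across the cell, so integrating first over that direction already gives 0.\<close>

lemma cell_integral_oscillating:
  assumes L: "0 < L1" "0 < L2" and u: "continuous_on UNIV u" and f: "freq L1 L2 \<xi>"
  shows "(LINT x:cell L1 L2 h|lborel. u (x $ 3) * cos (2 * (\<xi> \<bullet> x) + \<theta>)) = 0"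
proof -
  obtain m n :: int where mn: "\<xi> $ 1 = m / L1" "\<xi> $ 2 = n / L2" "\<xi> $ 3 = 0" "\<xi> \<noteq> 0"
    using f unfolding freq_def by blast
  have "\<xi> $ 1 \<noteq> 0 \<or> \<xi> $ 2 \<noteq> 0" using mn(3,4) by (auto simp: vec_eq_iff forall_3)
  then obtain i j where d: "distinct [j, 3, i]" and nz: "\<xi> $ i \<noteq> 0"
  proof
    assume "\<xi> $ 1 \<noteq> 0" then show thesis using that[of 2 1] by simp
  next
    assume "\<xi> $ 2 \<noteq> 0" then show thesis using that[of 1 2] by simp
  qed
  have i: "i = 1 \<or> i = 2" using d exhaust_3[of i] by auto
  let ?s = "side L1 L2 h i"
  have "0 < ?s" using i L by auto
  have "\<exists>k::int. \<xi> $ i * ?s = 2 * pi * k" using i mn L by auto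
  then obtain k :: int where k: "\<xi> $ i * ?s = 2 * pi * k" ..
  have c: "continuous_on UNIV (\<lambda>x::real^3. u (x $ 3) * cos (2 * (\<xi> \<bullet> x) + \<theta>))"
    by (intro continuous_intros continuous_on_compose2[OF u]) auto
  have "(LINT c:{0<..<?s}|lborel. u (vec3 j 3 i p c $ 3) * cos (2 * (\<xi> \<bullet> vec3 j 3 i p c) + \<theta>)) = 0" for p
  proof -
    define a where "a = 2 * (\<xi> $ j * fst p) + \<theta>"
    have eq: "2 * (\<xi> \<bullet> vec3 j 3 i p c) + \<theta> = a + 2 * \<xi> $ i * c" for c
      by (simp add: a_def vec3_def inner_add_right inner_axis mn(3) algebra_simps)
    have "(LINT c:{0<..<?s}|lborel. cos (a + 2 * \<xi> $ i * c)) = integral {0..?s} (\<lambda>c. cos (a + 2 * \<xi> $ i * c))"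
      by (intro set_integral_open_interval continuous_intros)
    also have "\<dots> = sin (a + 2 * \<xi> $ i * ?s) / (2 * \<xi> $ i) - sin (a + 2 * \<xi> $ i * 0) / (2 * \<xi> $ i)"
    proof (rule integral_unique, rule fundamental_theorem_of_calculus)
      fix x
      have "((\<lambda>c. sin (a + 2 * \<xi> $ i * c) / (2 * \<xi> $ i)) has_real_derivative cos (a + 2 * \<xi> $ i * x)) (at x)"
        using nz by (auto intro!: derivative_eq_intros)
      then show "((\<lambda>c. sin (a + 2 * \<xi> $ i * c) / (2 * \<xi> $ i)) has_vector_derivative cos (a + 2 * \<xi> $ i * x)) (at x within {0..?s})"
        unfolding has_real_derivative_iff_has_vector_derivative by (rule has_vector_derivative_at_within)
    qed (use \<open>0 < ?s\<close> in simp)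
    also have "sin (a + 2 * \<xi> $ i * ?s) = sin a"
    proof -
      have eq: "a + 2 * \<xi> $ i * ?s = a + 2 * pi * real_of_int (2 * k)" using k by (simp add: algebra_simps)
      show ?thesis unfolding eq sin_add sin_int_2pin cos_int_2pin by simp
    qed
    finally show ?thesis unfolding eq by (simp add: vec3_nth[OF d])
  qed
  then show ?thesis unfolding fubini_cell(2)[OF d c] by simp
qed

text \<open>By the double-angle formulas only the mean 1/2 of each squared trigonometric factor
  survives. The cross term is written as a cosine with phase -pi/2, so that one oscillation lemma
  covers both discarded terms.\<close>

lemma cell_integral_trig:
  assumes L: "0 < L1" "0 < L2" and f: "freq L1 L2 \<xi>"
    and q: "continuous_on UNIV q" and ab: "continuous_on UNIV a" "continuous_on UNIV b"
  shows "(LINT x:cell L1 L2 h|lborel. q (x $ 3) * (a (x $ 3) * cos (\<xi> \<bullet> x) + b (x $ 3) * sin (\<xi> \<bullet> x))\<^sup>2)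
    = 2 * pi\<^sup>2 * L1 * L2 * (LINT t:{0<..<h}|lborel. q t * ((a t)\<^sup>2 + (b t)\<^sup>2))"
proof -
  let ?C = "cell L1 L2 h"
  define u1 u2 u3 where "u1 t = q t * ((a t)\<^sup>2 + (b t)\<^sup>2) / 2" and "u2 t = q t * ((a t)\<^sup>2 - (b t)\<^sup>2) / 2"
    and "u3 t = q t * (a t * b t)" for t
  have c: "continuous_on UNIV u1" "continuous_on UNIV u2" "continuous_on UNIV u3"
    unfolding u1_def u2_def u3_def by (intro continuous_intros ab q; simp)+
  have c': "continuous_on UNIV (\<lambda>x::real^3. u (x $ 3))" if "continuous_on UNIV u" for u :: "real \<Rightarrow> real"
    by (intro continuous_on_compose2[OF that] continuous_intros) auto
  have pt: "q (x $ 3) * (a (x $ 3) * cos (\<xi> \<bullet> x) + b (x $ 3) * sin (\<xi> \<bullet> x))\<^sup>2 =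
     u1 (x $ 3) + u2 (x $ 3) * cos (2 * (\<xi> \<bullet> x) + 0) + u3 (x $ 3) * cos (2 * (\<xi> \<bullet> x) + (- (pi / 2)))" for x
  proof -
    define C S where "C = cos (\<xi> \<bullet> x)" and "S = sin (\<xi> \<bullet> x)"
    have one: "S\<^sup>2 = 1 - C\<^sup>2" unfolding C_def S_def by (simp add: sin_squared_eq)
    have 1: "cos (2 * (\<xi> \<bullet> x) + 0) = 2 * C\<^sup>2 - 1" unfolding C_def by (simp add: cos_double_cos)
    have 2: "cos (2 * (\<xi> \<bullet> x) + (- (pi / 2))) = 2 * S * C" unfolding C_def S_def by (simp add: cos_diff sin_double)
    have "(a (x $ 3) * C + b (x $ 3) * S)\<^sup>2 = (a (x $ 3))\<^sup>2 * C\<^sup>2 + (b (x $ 3))\<^sup>2 * S\<^sup>2 + a (x $ 3) * b (x $ 3) * (2 * S * C)"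
      by (simp add: power2_eq_square algebra_simps)
    moreover have "q (x $ 3) * ((a (x $ 3))\<^sup>2 * C\<^sup>2 + (b (x $ 3))\<^sup>2 * S\<^sup>2 + a (x $ 3) * b (x $ 3) * (2 * S * C))
        = u1 (x $ 3) + u2 (x $ 3) * (2 * C\<^sup>2 - 1) + u3 (x $ 3) * (2 * S * C)"
      unfolding one u1_def u2_def u3_def by (simp add: field_simps)
    ultimately have "q (x $ 3) * (a (x $ 3) * C + b (x $ 3) * S)\<^sup>2 = u1 (x $ 3) + u2 (x $ 3) * (2 * C\<^sup>2 - 1) + u3 (x $ 3) * (2 * S * C)"
      by simp
    then show ?thesis unfolding 1 2 C_def S_def .
  qed
  have i1: "set_integrable lborel ?C (\<lambda>x. u1 (x $ 3))" by (intro cell_integrable_continuous c' c)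
  have i2: "set_integrable lborel ?C (\<lambda>x. u (x $ 3) * cos (2 * (\<xi> \<bullet> x) + \<theta>))" if "continuous_on UNIV u" for u \<theta>
    by (intro cell_integrable_continuous continuous_on_mult c' that continuous_intros)
  have "(LINT x:?C|lborel. q (x $ 3) * (a (x $ 3) * cos (\<xi> \<bullet> x) + b (x $ 3) * sin (\<xi> \<bullet> x))\<^sup>2) = (LINT x:?C|lborel. u1 (x $ 3))"
    unfolding pt
    by (subst set_integral_add(2)[OF set_integral_add(1)[OF i1 i2[OF c(2)]] i2[OF c(3)]], subst set_integral_add(2)[OF i1 i2[OF c(2)]])
      (simp add: cell_integral_oscillating[OF L c(2) f, of h 0, simplified] cell_integral_oscillating[OF L c(3) f, of h "- (pi / 2)", simplified])
  also have "\<dots> = 4 * pi\<^sup>2 * L1 * L2 * (LINT t:{0<..<h}|lborel. u1 t)" by (rule cell_integral_height[OF L c(1)])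
  also have "(LINT t:{0<..<h}|lborel. u1 t) = (LINT t:{0<..<h}|lborel. q t * ((a t)\<^sup>2 + (b t)\<^sup>2)) / 2"
    by (simp add: u1_def)
  finally show ?thesis by simp
qed

section \<open>The critical number\<close>

lemma interval_integrable_continuous:
  fixes f :: "real \<Rightarrow> real"
  assumes "continuous_on UNIV f"
  shows "set_integrable lborel {a<..<b} f"
  by (rule set_integrable_subset[OF borel_integrable_atLeastAtMost'[of a b, OF continuous_on_subset[OF assms]]]) auto

lemma interval_integral_abs_bound:
  fixes f :: "real \<Rightarrow> real"
  assumes "\<And>x. min a b < x \<Longrightarrow> x < max a b \<Longrightarrow> \<bar>f x\<bar> \<le> B"
  shows "\<bar>LBINT x = ereal a..ereal b. f x\<bar> \<le> B * \<bar>b - a\<bar>"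
proof -
  have *: "\<bar>LINT x:{c<..<d}|lborel. f x\<bar> \<le> B * (d - c)" if "c \<le> d" "\<And>x. c < x \<Longrightarrow> x < d \<Longrightarrow> \<bar>f x\<bar> \<le> B" for c d
  proof -
    have "\<bar>LINT x:{c<..<d}|lborel. f x\<bar> \<le> (LINT x:{c<..<d}|lborel. B)"
      by (rule set_integral_abs_bound[OF interval_integrable_continuous]) (use that in auto)
    also have "\<dots> = B * (d - c)" using that by (simp add: set_lebesgue_integral_def)
    finally show ?thesis .
  qed
  show ?thesis
    using *[of a b] *[of b a] assms unfolding interval_lebesgue_integral_def by (cases "a \<le> b") auto
qed

lemma bump_flow_exists:
  assumes "0 < L1" "0 < L2" "bump_seq h \<Psi>" "freq L1 L2 \<xi>"
  shows "\<exists>\<epsilon>1. bump_flow L1 L2 h \<Psi> \<xi> \<epsilon>1"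
proof -
  obtain B where B: "\<And>t. \<bar>\<Psi> 1 t\<bar> \<le> B" using bump_seq_bounded[OF assms(3)] by blast
  have "B \<ge> 0" using B[of 0] by linarith
  define \<epsilon>1 where "\<epsilon>1 = 1 / (2 * (B + 1))"
  have "\<epsilon>1 * \<bar>\<Psi> 1 t\<bar> \<le> 1 / 2" for t
  proof -
    have "\<epsilon>1 * \<bar>\<Psi> 1 t\<bar> \<le> \<epsilon>1 * (B + 1)" using B[of t] \<open>B \<ge> 0\<close> by (intro mult_left_mono) (auto simp: \<epsilon>1_def)
    also have "\<dots> = 1 / 2" using \<open>B \<ge> 0\<close> by (simp add: \<epsilon>1_def field_simps)
    finally show ?thesis .
  qed
  moreover have "0 < \<epsilon>1" "\<epsilon>1 \<le> 1" using \<open>B \<ge> 0\<close> by (auto simp: \<epsilon>1_def field_simps)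
  ultimately have "bump_flow L1 L2 h \<Psi> \<xi> \<epsilon>1" using assms by unfold_locales auto
  then show ?thesis ..
qed

lemma set_integral_wpd_smooth:
  assumes "smooth f"
  shows "(LINT x:cell L1 L2 h|lborel. (\<Sum>i\<in>UNIV. M $ i * wpd h f i x)\<^sup>2) = (LINT x:cell L1 L2 h|lborel. (dird M f x)\<^sup>2)"
  unfolding set_integral_wpd[OF hk_family_smooth[OF assms]] by (simp add: dird_def)

lemma sum_axis_mult: "(\<Sum>i\<in>UNIV. axis k 1 $ i * f i) = (f k :: real)" for k :: "'n::finite"
  by (simp add: axis_def if_distrib[of "\<lambda>z. z * _"] cong: if_cong)

section \<open>Quadratic integrals of the mode \<open>w\<close>\<close>

context bump_flow begin

lemma integral_w3:
  assumes "continuous_on UNIV q"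
  shows "(LINT x:cell L1 L2 h|lborel. q (x $ 3) * (w x $ 3)\<^sup>2) = 2 * pi\<^sup>2 * L1 * L2 * (LINT t:{0<..<h}|lborel. q t * (\<Psi> 0 t)\<^sup>2)"
proof -
  have "w x $ 3 = (- \<Psi> 0 (x $ 3)) * cos (\<xi> \<bullet> x) + 0 * sin (\<xi> \<bullet> x)" for x by (simp add: w_nth p_xi(2) axis_def)
  then show ?thesis
    using cell_integral_trig[OF L freq assms, of "\<lambda>t. - \<Psi> 0 t" "\<lambda>t. 0" h]
    by (simp add: continuous_intros bump_seq_continuous[OF bump])
qed

definition In :: "nat \<Rightarrow> real" where "In m = (LINT t:{0<..<h}|lborel. (\<Psi> m t)\<^sup>2)"

text \<open>The quotient by \<xi>\<cdot>\<xi> is the contribution of the two horizontal components,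
  through |p|^2 = 1/|\<xi>|^2. The other two terms come from the vertical component; the one with
  (M\<cdot>\<xi>)^2 is what small divisors must control.\<close>

lemma integral_dird_w:
  "(\<Sum>j\<in>UNIV. LINT x:cell L1 L2 h|lborel. (dird M (\<lambda>x. w x $ j) x)\<^sup>2) =
    2 * pi\<^sup>2 * L1 * L2 * ((M $ 3)\<^sup>2 * In 1 + (M \<bullet> \<xi>)\<^sup>2 * In 0 + ((M $ 3)\<^sup>2 * In 2 + (M \<bullet> \<xi>)\<^sup>2 * In 1) / (\<xi> \<bullet> \<xi>))"
proof -
  have int: "set_integrable lborel {0<..<h} (\<lambda>t. c * (\<Psi> m t)\<^sup>2)" for c m
    by (intro interval_integrable_continuous continuous_intros bump_seq_continuous[OF bump])
  have comb: "(LINT t:{0<..<h}|lborel. (c * \<Psi> m t)\<^sup>2 + (d * \<Psi> n t)\<^sup>2) = c\<^sup>2 * In m + d\<^sup>2 * In n" for c d m n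
    unfolding power_mult_distrib In_def by (subst set_integral_add(2)[OF int int]) simp
  have j: "(LINT x:cell L1 L2 h|lborel. (dird M (\<lambda>x. w x $ j) x)\<^sup>2) =
      2 * pi\<^sup>2 * L1 * L2 * ((p $ j * (M \<bullet> \<xi>))\<^sup>2 * In 1 + (p $ j * M $ 3)\<^sup>2 * In 2)" if "j \<noteq> 3" for j
  proof -
    have "(dird M (\<lambda>x. w x $ j) x)\<^sup>2 = 1 * (((p $ j * (M \<bullet> \<xi>)) * \<Psi> 1 (x $ 3)) * cos (\<xi> \<bullet> x) + ((p $ j * M $ 3) * \<Psi> 2 (x $ 3)) * sin (\<xi> \<bullet> x))\<^sup>2" for x
      using that unfolding dird_w by (simp add: algebra_simps)
    then show ?thesis
      using cell_integral_trig[OF L freq continuous_on_const, of "\<lambda>t. (p $ j * (M \<bullet> \<xi>)) * \<Psi> 1 t" "\<lambda>t. (p $ j * M $ 3) * \<Psi> 2 t" h 1]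
      unfolding mult_1_left comb by (simp add: continuous_intros bump_seq_continuous[OF bump])
  qed
  have 3: "(LINT x:cell L1 L2 h|lborel. (dird M (\<lambda>x. w x $ 3) x)\<^sup>2) = 2 * pi\<^sup>2 * L1 * L2 * ((- M $ 3)\<^sup>2 * In 1 + (M \<bullet> \<xi>)\<^sup>2 * In 0)"
  proof -
    have "(dird M (\<lambda>x. w x $ 3) x)\<^sup>2 = 1 * (((- M $ 3) * \<Psi> 1 (x $ 3)) * cos (\<xi> \<bullet> x) + ((M \<bullet> \<xi>) * \<Psi> 0 (x $ 3)) * sin (\<xi> \<bullet> x))\<^sup>2" for x
      unfolding dird_w by (simp add: algebra_simps p_xi(2))
    then show ?thesis
      using cell_integral_trig[OF L freq continuous_on_const, of "\<lambda>t. (- M $ 3) * \<Psi> 1 t" "\<lambda>t. (M \<bullet> \<xi>) * \<Psi> 0 t" h 1]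
      unfolding mult_1_left comb by (simp add: continuous_intros bump_seq_continuous[OF bump])
  qed
  have pp: "(p $ 1)\<^sup>2 + (p $ 2)\<^sup>2 = 1 / (\<xi> \<bullet> \<xi>)"
    using p_xi(2,3) by (simp add: inner_vec_def sum_3 power2_eq_square)
  have "(\<Sum>j\<in>UNIV. LINT x:cell L1 L2 h|lborel. (dird M (\<lambda>x. w x $ j) x)\<^sup>2) =
    2 * pi\<^sup>2 * L1 * L2 * ((M $ 3)\<^sup>2 * In 1 + (M \<bullet> \<xi>)\<^sup>2 * In 0 + ((M $ 3)\<^sup>2 * In 2 + (M \<bullet> \<xi>)\<^sup>2 * In 1) * ((p $ 1)\<^sup>2 + (p $ 2)\<^sup>2))"
    unfolding sum_3 j[of 1, simplified] j[of 2, simplified] 3 by (simp add: power_mult_distrib algebra_simps)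
  then show ?thesis unfolding pp by simp
qed

lemma test_per_w: "test_per L1 L2 h (\<lambda>x. w x $ j)"
proof -
  obtain c d where cd: "0 < c" "c < d" "d < h" "\<forall>x. x $ 3 \<notin> {c<..<d} \<longrightarrow> w x = 0 \<and> (\<forall>\<epsilon>\<in>I. \<Theta> \<epsilon> x = 0)"
    using support by blast
  have "periodic L1 L2 (\<lambda>x. w x $ j)" using periodic_w by (simp add: periodic_def)
  then show ?thesis unfolding test_per_def using w_smooth[of j] cd
    by (intro conjI exI[of _ c] exI[of _ d]) auto
qed

lemma H1sigma_w: "H1sigma L1 L2 h w"
proof -
  have "AE x in lborel. \<forall>j. x \<in> strip h \<longrightarrow> wpd h (\<lambda>y. w y $ j) j x = pd j (\<lambda>y. w y $ j) x"
    unfolding AE_all_countable using wpd_AE[OF weak_pd_smooth[OF w_smooth]] by blast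
  then have "AE x in lborel. x \<in> strip h \<longrightarrow> (\<Sum>j\<in>UNIV. wpd h (\<lambda>y. w y $ j) j x) = 0"
    by (rule AE_mp) (use divergence_free_w in \<open>auto intro!: AE_I2\<close>)
  then show ?thesis
    unfolding H1sigma_def H10_vec_def using H10_test_per[OF test_per_w] by blast
qed

lemma nontrivial_w:
  assumes "0 < In 0"
  shows "nontrivial L1 L2 h w"
  unfolding nontrivial_def
proof
  assume *: "AE x in lborel. x \<in> cell L1 L2 h \<longrightarrow> w x = 0"
  have [measurable]: "(\<lambda>x. w x $ 3) \<in> borel_measurable borel"
    by (intro borel_measurable_continuous_onI smooth_continuous w_smooth)
  have "(LINT x:cell L1 L2 h|lborel. 1 * (w x $ 3)\<^sup>2) = (LINT x:cell L1 L2 h|lborel. 0)"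
    by (rule set_integral_cong_AE') (use * in \<open>auto simp: set_borel_measurable_def elim!: AE_mp\<close>)
  then show False using assms L integral_w3[OF continuous_on_const, of 1] by (simp add: In_def)
qed

end

locale profile =
  fixes L1 L2 h g lam :: real and \<rho> :: "real \<Rightarrow> real"
  assumes pos: "0 < L1" "0 < L2" "0 < h" "0 < g" "0 < lam"
    and d1: "\<And>x. (\<rho> has_real_derivative deriv \<rho> x) (at x)"
    and d2: "\<And>x. (deriv \<rho> has_real_derivative deriv (deriv \<rho>) x) (at x)"
    and c2: "continuous_on UNIV (deriv (deriv \<rho>))"
    and x0: "\<exists>x0\<in>{0<..<h}. 0 < deriv \<rho> x0"
begin

section \<open>Bounds for the density profile and the cubic remainder\<close>

lemma rho_cont: "continuous_on A (deriv \<rho>)"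
  by (intro continuous_at_imp_continuous_on) (auto intro: DERIV_isCont d2)

definition R :: real where "R = (SOME R. 0 < R \<and> (\<forall>t\<in>{0..h}. \<bar>deriv \<rho> t\<bar> \<le> R))"

lemma R: "0 < R" "t \<in> {0..h} \<Longrightarrow> \<bar>deriv \<rho> t\<bar> \<le> R"
proof -
  have "compact (deriv \<rho> ` {0..h})" by (rule compact_continuous_image[OF rho_cont]) auto
  then obtain B where B: "0 < B" "\<forall>y\<in>deriv \<rho> ` {0..h}. norm y \<le> B"
    using compact_imp_bounded bounded_pos by blast
  then have "\<exists>R. 0 < R \<and> (\<forall>t\<in>{0..h}. \<bar>deriv \<rho> t\<bar> \<le> R)" by auto
  from someI_ex[OF this] show "0 < R" "t \<in> {0..h} \<Longrightarrow> \<bar>deriv \<rho> t\<bar> \<le> R" unfolding R_def by blast+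
qed

text \<open>The argument y_3 + z in \<open>NN\<close> can leave [0,h], but by no more than 1 for
  displacements of size at most 1; hence the enlarged interval.\<close>

definition K :: real where "K = (SOME R. 0 < R \<and> (\<forall>t\<in>{-1..h+1}. \<bar>deriv (deriv \<rho>) t\<bar> \<le> R))"

lemma K: "0 < K" "t \<in> {-1..h+1} \<Longrightarrow> \<bar>deriv (deriv \<rho>) t\<bar> \<le> K"
proof -
  have "compact (deriv (deriv \<rho>) ` {-1..h+1})"
    by (rule compact_continuous_image[OF continuous_on_subset[OF c2]]) auto
  then obtain B where B: "0 < B" "\<forall>y\<in>deriv (deriv \<rho>) ` {-1..h+1}. norm y \<le> B"
    using compact_imp_bounded bounded_pos by blast
  then have "\<exists>R. 0 < R \<and> (\<forall>t\<in>{-1..h+1}. \<bar>deriv (deriv \<rho>) t\<bar> \<le> R)" by auto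
  from someI_ex[OF this] show "0 < K" "t \<in> {-1..h+1} \<Longrightarrow> \<bar>deriv (deriv \<rho>) t\<bar> \<le> K" unfolding K_def by blast+
qed

text \<open>The kernel is at most |\<eta>| K, and it is integrated twice over intervals of length at
  most |\<eta>|. The result is cubic, hence a small multiple of \<eta>^2 when \<eta> is
  small.\<close>

lemma NN_integral_bound:
  assumes "\<bar>\<eta>\<bar> \<le> 1" "0 < s" "s < h"
  shows "\<bar>LBINT \<tau> = ereal 0..ereal \<eta>. NN g \<rho> \<tau> s\<bar> \<le> g * K * \<bar>\<eta>\<bar> ^ 3"
proof -
  have "\<bar>NN g \<rho> \<tau> s\<bar> \<le> g * (K * \<eta>\<^sup>2)" if "min 0 \<eta> < \<tau>" "\<tau> < max 0 \<eta>" for \<tau>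
  proof -
    have \<tau>: "\<bar>\<tau>\<bar> \<le> \<bar>\<eta>\<bar>" using that by (auto simp: min_def max_def split: if_splits)
    have "\<bar>(\<tau> - z) * deriv (deriv \<rho>) (s + z)\<bar> \<le> \<bar>\<eta>\<bar> * K" if z: "min 0 \<tau> < z" "z < max 0 \<tau>" for z
      unfolding abs_mult
    proof (intro mult_mono)
      show "\<bar>\<tau> - z\<bar> \<le> \<bar>\<eta>\<bar>" using z \<tau> by (auto simp: min_def max_def split: if_splits)
      show "\<bar>deriv (deriv \<rho>) (s + z)\<bar> \<le> K"
        using z \<tau> assms by (intro K(2)) (auto simp: min_def max_def split: if_splits)
    qed auto
    from interval_integral_abs_bound[of 0 \<tau> "\<lambda>z. (\<tau> - z) * deriv (deriv \<rho>) (s + z)", OF this]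
    have "\<bar>LBINT z = ereal 0..ereal \<tau>. (\<tau> - z) * deriv (deriv \<rho>) (s + z)\<bar> \<le> \<bar>\<eta>\<bar> * K * \<bar>\<tau>\<bar>" by simp
    also have "\<dots> \<le> \<bar>\<eta>\<bar> * K * \<bar>\<eta>\<bar>" using \<tau> K(1) by (intro mult_left_mono) auto
    also have "\<dots> = K * \<eta>\<^sup>2" by (simp add: power2_eq_square mult.commute mult.left_commute)
    finally show ?thesis unfolding NN_def abs_mult using pos by (intro mult_mono) auto
  qed
  from interval_integral_abs_bound[of 0 \<eta> "\<lambda>\<tau>. NN g \<rho> \<tau> s", OF this]
  have "\<bar>LBINT \<tau> = ereal 0..ereal \<eta>. NN g \<rho> \<tau> s\<bar> \<le> g * (K * \<eta>\<^sup>2) * \<bar>\<eta>\<bar>" by simp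
  also have "\<dots> = g * K * \<bar>\<eta>\<bar> ^ 3" by (simp add: power3_eq_cube power2_eq_square)
  finally show ?thesis .
qed

section \<open>The quotients behind the critical number\<close>

definition num :: "(real^3 \<Rightarrow> real^3) \<Rightarrow> real" where
  "num w = (LINT x:cell L1 L2 h|lborel. deriv \<rho> (x$3) * (w x $ 3)\<^sup>2)"

definition den :: "(real^3 \<Rightarrow> real^3) \<Rightarrow> 3 \<Rightarrow> real" where
  "den w j = (LINT x:cell L1 L2 h|lborel. (wpd h (\<lambda>y. w y $ j) 3 x)\<^sup>2)"

definition S :: "real set" where
  "S = {g * num w / (lam * (\<Sum>j\<in>UNIV. den w j)) | w. H1sigma L1 L2 h w \<and> nontrivial L1 L2 h w}"

lemma mN_eq: "mN L1 L2 h g lam \<rho> = sqrt (Sup S)"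
  unfolding mN_def S_def num_def den_def ..

lemma den_nonneg: "0 \<le> den w j" unfolding den_def by (rule set_integral_sq_nonneg)

text \<open>Casts the vertical derivative as the derivative along e_3, the form in which the line
  inequality and the Poincare inequality apply.\<close>

lemma den_axis: "den w j = (LINT x:cell L1 L2 h|lborel. (\<Sum>i\<in>UNIV. axis 3 1 $ i * wpd h (\<lambda>y. w y $ j) i x)\<^sup>2)"
  unfolding den_def sum_axis_mult ..

lemma weight_bound:
  assumes "set_integrable lborel (cell L1 L2 h) (\<lambda>x. (f x)\<^sup>2)"
  shows "\<bar>LINT x:cell L1 L2 h|lborel. deriv \<rho> (x$3) * (f x)\<^sup>2\<bar> \<le> R * (LINT x:cell L1 L2 h|lborel. (f x)\<^sup>2)"
proof -
  have "\<bar>LINT x:cell L1 L2 h|lborel. deriv \<rho> (x$3) * (f x)\<^sup>2\<bar> \<le> (LINT x:cell L1 L2 h|lborel. R * (f x)\<^sup>2)"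
  proof (rule set_integral_abs_bound)
    show "set_integrable lborel (cell L1 L2 h) (\<lambda>x. R * (f x)\<^sup>2)" using assms by simp
    have "\<bar>deriv \<rho> (x $ 3) * (f x)\<^sup>2\<bar> \<le> R * (f x)\<^sup>2" if "x \<in> cell L1 L2 h" for x
      using that by (simp add: abs_mult) (intro mult_right_mono R, auto simp: cell_def)
    then show "AE x in lborel. x \<in> cell L1 L2 h \<longrightarrow> \<bar>deriv \<rho> (x $ 3) * (f x)\<^sup>2\<bar> \<le> R * (f x)\<^sup>2" by simp
  qed
  then show ?thesis by simp
qed

lemma H10_sq_integrable: "H10 L1 L2 h f \<Longrightarrow> set_integrable lborel (cell L1 L2 h) (\<lambda>x. (f x)\<^sup>2)"
  unfolding H10_def Hk_def hk_family_def by (metis list.size(3) zero_le)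

text \<open>The numerator involves w_3 alone, so the vertical Poincare inequality for w_3 together
  with boundedness of the density gradient suffices. Boundedness matters because the supremum is
  otherwise meaningless.\<close>

lemma S_bdd: "bdd_above S"
proof (rule bdd_aboveI)
  fix s assume "s \<in> S"
  then obtain w where s: "s = g * num w / (lam * (\<Sum>j\<in>UNIV. den w j))" and w: "H1sigma L1 L2 h w"
    by (auto simp: S_def)
  let ?d = "\<Sum>j\<in>UNIV. den w j"
  have w3: "H10 L1 L2 h (\<lambda>x. w x $ 3)" using w by (simp add: H1sigma_def H10_vec_def)
  have "(LINT x:cell L1 L2 h|lborel. (w x $ 3)\<^sup>2) \<le> 4 * h\<^sup>2 * den w 3"
    unfolding den_axis by (rule poincare[OF pos(1-3) _ w3]) (simp add: axis_def)
  then have "R * (LINT x:cell L1 L2 h|lborel. (w x $ 3)\<^sup>2) \<le> R * (4 * h\<^sup>2 * den w 3)"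
    using R(1) by (intro mult_left_mono) auto
  moreover have "den w 3 \<le> ?d" by (rule member_le_sum) (auto intro: den_nonneg)
  then have "R * (4 * h\<^sup>2 * den w 3) \<le> R * (4 * h\<^sup>2 * ?d)"
    using R(1) by (intro mult_left_mono) auto
  ultimately have "num w \<le> R * (4 * h\<^sup>2 * ?d)"
    using weight_bound[OF H10_sq_integrable[OF w3]] unfolding num_def by linarith
  then have n: "g * num w \<le> g * R * (4 * h\<^sup>2) * ?d" using pos by (simp add: mult.assoc)
  have "0 \<le> ?d" by (intro sum_nonneg den_nonneg)
  show "s \<le> g * R * (4 * h\<^sup>2) / lam"
  proof (cases "?d = 0")
    \<comment> \<open>Division by zero yields 0, so such a quotient is harmless.\<close>
    case True
    then show ?thesis using s pos R(1) by simp
  next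
    case False
    with \<open>0 \<le> ?d\<close> have "0 < ?d" by simp
    then have "g * num w / (lam * ?d) \<le> g * R * (4 * h\<^sup>2) * ?d / (lam * ?d)"
      using n pos by (intro divide_right_mono) auto
    then show ?thesis using s \<open>0 < ?d\<close> by simp
  qed
qed

lemma weight_bound_1:
  assumes "bump_seq h \<Psi>"
  shows "\<bar>LINT t:{0<..<h}|lborel. deriv \<rho> t * (\<Psi> 0 t)\<^sup>2\<bar> \<le> R * (LINT t:{0<..<h}|lborel. (\<Psi> 0 t)\<^sup>2)"
proof -
  have "\<bar>LINT t:{0<..<h}|lborel. deriv \<rho> t * (\<Psi> 0 t)\<^sup>2\<bar> \<le> (LINT t:{0<..<h}|lborel. R * (\<Psi> 0 t)\<^sup>2)"
  proof (rule set_integral_abs_bound)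
    show "set_integrable lborel {0<..<h} (\<lambda>t. R * (\<Psi> 0 t)\<^sup>2)"
      by (intro interval_integrable_continuous continuous_intros bump_seq_continuous[OF assms])
    have "\<bar>deriv \<rho> t * (\<Psi> 0 t)\<^sup>2\<bar> \<le> R * (\<Psi> 0 t)\<^sup>2" if "t \<in> {0<..<h}" for t
      using that by (simp add: abs_mult) (intro mult_right_mono R, auto)
    then show "AE t in lborel. t \<in> {0<..<h} \<longrightarrow> \<bar>deriv \<rho> t * (\<Psi> 0 t)\<^sup>2\<bar> \<le> R * (\<Psi> 0 t)\<^sup>2" by simp
  qed
  then show ?thesis by simp
qed

text \<open>The mode \<open>w\<close> is a competitor; the common factor 2 pi^2 L1 L2 cancels. What
  distinguishes its quotient from the one-dimensional one is the second-derivative term divided by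
  |\<xi>|^2.\<close>

lemma bump_ratio_in_S:
  assumes b: "bump_seq h \<Psi>" and f: "freq L1 L2 \<xi>" and p: "0 < (LINT t:{0<..<h}|lborel. (\<Psi> 0 t)\<^sup>2)"
  shows "g * (LINT t:{0<..<h}|lborel. deriv \<rho> t * (\<Psi> 0 t)\<^sup>2) /
      (lam * ((LINT t:{0<..<h}|lborel. (\<Psi> 1 t)\<^sup>2) + (LINT t:{0<..<h}|lborel. (\<Psi> 2 t)\<^sup>2) / (\<xi> \<bullet> \<xi>))) \<in> S"
proof -
  obtain \<epsilon>1 where "bump_flow L1 L2 h \<Psi> \<xi> \<epsilon>1" using bump_flow_exists[OF pos(1,2) b f] ..
  then interpret bump_flow L1 L2 h \<Psi> \<xi> \<epsilon>1 .
  have n: "num w = 2 * pi\<^sup>2 * L1 * L2 * (LINT t:{0<..<h}|lborel. deriv \<rho> t * (\<Psi> 0 t)\<^sup>2)"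
    unfolding num_def by (rule integral_w3[OF rho_cont])
  have "(\<Sum>j\<in>UNIV. den w j) = (\<Sum>j\<in>UNIV. LINT x:cell L1 L2 h|lborel. (dird (axis 3 1) (\<lambda>x. w x $ j) x)\<^sup>2)"
    unfolding den_axis set_integral_wpd_smooth[OF w_smooth] ..
  also have "\<dots> = 2 * pi\<^sup>2 * L1 * L2 * (In 1 + In 2 / (\<xi> \<bullet> \<xi>))"
    unfolding integral_dird_w by (simp add: inner_axis')
  finally have d: "(\<Sum>j\<in>UNIV. den w j) = 2 * pi\<^sup>2 * L1 * L2 * (In 1 + In 2 / (\<xi> \<bullet> \<xi>))" .
  have "g * num w / (lam * (\<Sum>j\<in>UNIV. den w j)) \<in> S"
    unfolding S_def using H1sigma_w nontrivial_w p by (auto simp: In_def)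
  moreover have "g * num w / (lam * (\<Sum>j\<in>UNIV. den w j)) =
      g * (LINT t:{0<..<h}|lborel. deriv \<rho> t * (\<Psi> 0 t)\<^sup>2) / (lam * (In 1 + In 2 / (\<xi> \<bullet> \<xi>)))"
    unfolding n d using pos by (simp add: mult.left_commute[of _ "2 * pi\<^sup>2 * L1 * L2"])
  ultimately show ?thesis by (simp add: In_def)
qed

lemma freq_axis: "0 < n \<Longrightarrow> freq L1 L2 ((real n / L1) *\<^sub>R axis 1 1)"
  unfolding freq_def using pos
  by (intro conjI exI[of _ "int n"] exI[of _ 0]) (simp_all add: axis_eq_0_iff, simp_all add: axis_def)

text \<open>A product of two flat functions is concentrated near x_0, where the density gradient is
  positive. Viewed as a function on space depending on the height only, it obtains its whole
  sequence of derivatives from \<open>line_bump_seq\<close> along the vertical axis.\<close>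

lemma bump_positive: "\<exists>\<Psi>. bump_seq h \<Psi> \<and> 0 < (LINT t:{0<..<h}|lborel. deriv \<rho> t * (\<Psi> 0 t)\<^sup>2)"
proof -
  obtain x0 where x0: "0 < x0" "x0 < h" "0 < deriv \<rho> x0" using x0 by auto
  have "isCont (deriv \<rho>) x0" using d2 by (rule DERIV_isCont)
  then have "eventually (\<lambda>x. 0 < deriv \<rho> x) (nhds x0)"
    using x0(3) order_tendstoD(1)[of "deriv \<rho>" "deriv \<rho> x0" "nhds x0" 0] by (simp add: continuous_at tendsto_nhds_iff)
  then obtain \<delta> where \<delta>: "0 < \<delta>" "\<And>x. \<bar>x - x0\<bar> < \<delta> \<Longrightarrow> 0 < deriv \<rho> x"
    unfolding eventually_nhds_metric by (auto simp: dist_real_def)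
  \<comment> \<open>Small enough for positivity of the density gradient on the support and for the
    support to stay inside (0,h).\<close>
  define r where "r = min (\<delta> / 2) (min (x0 / 2) ((h - x0) / 2))"
  have r: "0 < r" "r < \<delta>" "r < x0" "r < h - x0" using x0 \<delta>(1) by (auto simp: r_def min_def)
  define a b where "a = x0 - r" and "b = x0 + r"
  define \<phi> where "\<phi> x = flat 1 (1 * (x $ 3) + (- a)) * flat 1 ((- 1) * (x $ 3) + b)" for x :: "real^3"
  have "(\<lambda>p. \<phi>) \<in> alg (UNIV::unit set) flat_gens"
  proof -
    have "(\<lambda>p x. flat 1 (c * (x $ i) + d)) \<in> flat_gens" for c d i unfolding flat_gens_def by blast
    then show ?thesis unfolding \<phi>_def by (intro alg.mult alg.gen)
  qed
  from alg_smooth[OF flat_gens_closed this, of "()"] have "smooth \<phi>" by simp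
  moreover have "periodic L1 L2 \<phi>" by (simp add: periodic_def \<phi>_def axis_def)
  moreover have "\<phi> x = 0" if "x $ 3 \<notin> {a<..<b}" for x using that by (auto simp: \<phi>_def flat_def)
  moreover have "0 < a" "a < b" "b < h" using r by (auto simp: a_def b_def)
  ultimately have "test_per L1 L2 h \<phi>" unfolding test_per_def by blast
  moreover have "axis 3 1 $ 3 = (1::real)" "(0::real^3) $ 3 = 0" by simp_all
  ultimately obtain \<Psi> where \<Psi>: "bump_seq h \<Psi>"
    "\<And>m t. t \<in> {0<..<h} \<Longrightarrow> \<Psi> m t = (dird (axis 3 1) ^^ m) \<phi> (0 + t *\<^sub>R axis 3 1)"
    using line_bump_seq[of L1 L2 h \<phi> "axis 3 1" 0] by blast
  have \<Psi>0: "\<Psi> 0 t = flat 1 (t - a) * flat 1 (b - t)" if "t \<in> {0<..<h}" for t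
    using \<Psi>(2)[OF that, of 0] by (simp add: \<phi>_def algebra_simps)
  have cont: "continuous_on {0..h} (\<lambda>t. deriv \<rho> t * (\<Psi> 0 t)\<^sup>2)"
    by (intro continuous_intros rho_cont bump_seq_continuous[OF \<Psi>(1)])
  have ends: "\<Psi> 0 0 = 0" "\<Psi> 0 h = 0" using \<Psi>(1) unfolding bump_seq_def by auto
  have nn: "0 \<le> deriv \<rho> t * (\<Psi> 0 t)\<^sup>2" if "t \<in> {0..h}" for t
  proof (cases "t \<in> {0<..<h} \<and> a < t \<and> t < b")
    case True
    then have "0 < deriv \<rho> t" using r by (intro \<delta>(2)) (auto simp: a_def b_def)
    then show ?thesis by simp
  next
    case False
    have "\<Psi> 0 t = 0"
    proof (cases "t \<in> {0<..<h}")
      case True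
      then show ?thesis using False \<Psi>0[OF True] by (auto simp: flat_def)
    next
      case False
      then have "t = 0 \<or> t = h" using that by auto
      then show ?thesis using ends by auto
    qed
    then show ?thesis by simp
  qed
  have "integral {0..h} (\<lambda>t. deriv \<rho> t * (\<Psi> 0 t)\<^sup>2) \<noteq> 0"
  proof
    assume "integral {0..h} (\<lambda>t. deriv \<rho> t * (\<Psi> 0 t)\<^sup>2) = 0"
    then have "\<forall>t\<in>{0..h}. deriv \<rho> t * (\<Psi> 0 t)\<^sup>2 = 0"
      using integral_eq_0_iff[OF cont pos(3) nn] by simp
    moreover have "x0 \<in> {0..h}" using x0 by simp
    ultimately have "deriv \<rho> x0 * (\<Psi> 0 x0)\<^sup>2 = 0" by blast
    moreover have "0 < \<Psi> 0 x0" using \<Psi>0[of x0] x0 r by (auto simp: a_def b_def intro!: mult_pos_pos flat_1_pos)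
    ultimately show False using x0 by simp
  qed
  moreover have "0 \<le> integral {0..h} (\<lambda>t. deriv \<rho> t * (\<Psi> 0 t)\<^sup>2)"
    by (rule integral_nonneg[OF integrable_continuous_real[OF cont] nn])
  ultimately have "0 < (LINT t:{0<..<h}|lborel. deriv \<rho> t * (\<Psi> 0 t)\<^sup>2)"
    unfolding set_integral_open_interval[OF cont] by simp
  with \<Psi>(1) show ?thesis by blast
qed

lemma bump_sq_pos:
  assumes "bump_seq h \<Psi>" "0 < (LINT t:{0<..<h}|lborel. deriv \<rho> t * (\<Psi> 0 t)\<^sup>2)"
  shows "0 < (LINT t:{0<..<h}|lborel. (\<Psi> 0 t)\<^sup>2)" "0 < (LINT t:{0<..<h}|lborel. (\<Psi> 1 t)\<^sup>2)"
proof -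
  have "0 < R * (LINT t:{0<..<h}|lborel. (\<Psi> 0 t)\<^sup>2)" using weight_bound_1[OF assms(1)] assms(2) by linarith
  then show 1: "0 < (LINT t:{0<..<h}|lborel. (\<Psi> 0 t)\<^sup>2)" using R(1) by (simp add: zero_less_mult_iff)
  with bump_poincare[OF pos(3) assms(1)] have "0 < 4 * h\<^sup>2 * (LINT t:{0<..<h}|lborel. (\<Psi> 1 t)\<^sup>2)" by simp
  then show "0 < (LINT t:{0<..<h}|lborel. (\<Psi> 1 t)\<^sup>2)" using pos(3) by (simp add: zero_less_mult_iff)
qed

lemma Sup_S_pos: "S \<noteq> {}" "0 < Sup S"
proof -
  obtain \<Psi> where \<Psi>: "bump_seq h \<Psi>" "0 < (LINT t:{0<..<h}|lborel. deriv \<rho> t * (\<Psi> 0 t)\<^sup>2)"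
    using bump_positive by blast
  let ?\<xi> = "(real 1 / L1) *\<^sub>R axis 1 1 :: real^3"
  let ?r = "g * (LINT t:{0<..<h}|lborel. deriv \<rho> t * (\<Psi> 0 t)\<^sup>2) /
      (lam * ((LINT t:{0<..<h}|lborel. (\<Psi> 1 t)\<^sup>2) + (LINT t:{0<..<h}|lborel. (\<Psi> 2 t)\<^sup>2) / (?\<xi> \<bullet> ?\<xi>)))"
  have rS: "?r \<in> S" by (rule bump_ratio_in_S[OF \<Psi>(1) freq_axis bump_sq_pos(1)[OF \<Psi>]]) simp
  then show "S \<noteq> {}" by blast
  have "0 \<le> (LINT t:{0<..<h}|lborel. (\<Psi> 2 t)\<^sup>2) / (?\<xi> \<bullet> ?\<xi>)"
    by (intro divide_nonneg_nonneg set_integral_sq_nonneg) simp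
  then have "0 < ?r" using \<Psi>(2) pos bump_sq_pos(2)[OF \<Psi>]
    by (intro divide_pos_pos mult_pos_pos add_pos_nonneg)
  then show "0 < Sup S" using cSup_upper[OF rS S_bdd] by linarith
qed

text \<open>The quotient of each mode is at most \<open>Sup S\<close>, and letting the frequency
  grow removes the second-derivative term. A nonpositive left side is settled by the sign of the
  right one.\<close>

lemma bump_inequality:
  assumes b: "bump_seq h \<Psi>"
  shows "(LINT t:{0<..<h}|lborel. deriv \<rho> t * (\<Psi> 0 t)\<^sup>2) \<le> lam * Sup S / g * (LINT t:{0<..<h}|lborel. (\<Psi> 1 t)\<^sup>2)"
proof (cases "0 < (LINT t:{0<..<h}|lborel. deriv \<rho> t * (\<Psi> 0 t)\<^sup>2)")
  case False
  have "0 \<le> lam * Sup S / g * (LINT t:{0<..<h}|lborel. (\<Psi> 1 t)\<^sup>2)"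
    using pos Sup_S_pos(2) by (intro mult_nonneg_nonneg set_integral_sq_nonneg) auto
  with False show ?thesis by linarith
next
  case True
  let ?J = "LINT t:{0<..<h}|lborel. deriv \<rho> t * (\<Psi> 0 t)\<^sup>2"
  let ?I1 = "LINT t:{0<..<h}|lborel. (\<Psi> 1 t)\<^sup>2" and ?I2 = "LINT t:{0<..<h}|lborel. (\<Psi> 2 t)\<^sup>2"
  note I = bump_sq_pos[OF b True]
  \<comment> \<open>Frequencies along the first axis suffice, because the field M does not enter the
    critical number.\<close>
  have "g * ?J \<le> Sup S * (lam * (?I1 + ?I2 * (L1\<^sup>2 * (inverse (real (Suc n)))\<^sup>2)))" for n
  proof -
    let ?\<xi> = "(real (Suc n) / L1) *\<^sub>R axis 1 1 :: real^3"
    have xx: "?\<xi> \<bullet> ?\<xi> = (real (Suc n) / L1)\<^sup>2" by (simp add: inner_axis_axis power2_eq_square)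
    have le: "g * ?J / (lam * (?I1 + ?I2 / (?\<xi> \<bullet> ?\<xi>))) \<le> Sup S"
      by (rule cSup_upper[OF bump_ratio_in_S[OF b freq_axis I(1)] S_bdd]) simp
    have "0 \<le> ?I2 / (?\<xi> \<bullet> ?\<xi>)" by (intro divide_nonneg_nonneg set_integral_sq_nonneg) simp
    then have "0 < lam * (?I1 + ?I2 / (?\<xi> \<bullet> ?\<xi>))" using pos I(2) by (intro mult_pos_pos add_pos_nonneg)
    with le have "g * ?J \<le> Sup S * (lam * (?I1 + ?I2 / (?\<xi> \<bullet> ?\<xi>)))" by (simp add: pos_divide_le_eq)
    also have "?I2 / (?\<xi> \<bullet> ?\<xi>) = ?I2 * (L1\<^sup>2 * (inverse (real (Suc n)))\<^sup>2)"
      unfolding xx by (simp add: power_divide power_inverse[symmetric] divide_inverse power_mult_distrib)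
    finally show ?thesis .
  qed
  moreover have "(\<lambda>n. Sup S * (lam * (?I1 + ?I2 * (L1\<^sup>2 * (inverse (real (Suc n)))\<^sup>2)))) \<longlonglongrightarrow> Sup S * (lam * (?I1 + ?I2 * (L1\<^sup>2 * 0\<^sup>2)))"
    by (intro tendsto_intros LIMSEQ_inverse_real_of_nat)
  ultimately have "g * ?J \<le> Sup S * (lam * (?I1 + ?I2 * (L1\<^sup>2 * 0\<^sup>2)))"
    by (intro LIMSEQ_le_const) auto
  then show ?thesis using pos by (simp add: field_simps)
qed

end

section \<open>Stability and instability\<close>

text \<open>An approximate rational relation between M_1/L_1 and M_2/L_2 gives a lattice vector
  nearly orthogonal to M; a multiple of it is as long as desired, provided the approximation was
  fine enough to survive the multiplication.\<close>

lemma small_divisor_freq: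
  assumes L: "0 < L1" "0 < L2" and "0 < \<delta>"
  shows "\<exists>\<xi>. freq L1 L2 \<xi> \<and> \<bar>M \<bullet> \<xi>\<bar> < \<delta> \<and> B < \<xi> \<bullet> \<xi>"
proof -
  define V where "V a b = (a / L1) *\<^sub>R axis 1 1 + (b / L2) *\<^sub>R (axis 2 1 :: real^3)" for a b :: real
  have V_nth: "V a b $ 1 = a / L1" "V a b $ 2 = b / L2" "V a b $ 3 = 0" for a b
    by (simp_all add: V_def axis_def)
  have MV: "M \<bullet> V a b = M $ 1 * a / L1 + M $ 2 * b / L2" for a b
    by (simp add: inner_vec_def sum_3 V_nth)
  have VV: "V a b \<bullet> V a b = (a / L1)\<^sup>2 + (b / L2)\<^sup>2" for a b
    by (simp add: inner_vec_def sum_3 V_nth power2_eq_square)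
  have fr: "freq L1 L2 (V (of_int m) (of_int n))" if "m \<noteq> 0 \<or> n \<noteq> 0" for m n :: int
  proof -
    have "0 < V (of_int m) (of_int n) \<bullet> V (of_int m) (of_int n)"
      unfolding VV using that L by (auto simp: sum_power2_gt_zero_iff)
    then have "V (of_int m) (of_int n) \<noteq> 0" by auto
    then show ?thesis unfolding freq_def V_nth by blast
  qed
  define A where "A = \<bar>B\<bar> + 1"
  have "A \<ge> 1" "B < A" by (auto simp: A_def)
  \<comment> \<open>Any lattice vector with an integer coefficient of modulus at least m then has
    squared length above B, whichever axis carries that coefficient.\<close>
  obtain m :: nat where m: "A * (L1 + L2 + 1)\<^sup>2 < real m" using reals_Archimedean2 by blast
  have "1 \<le> A * (L1 + L2 + 1)\<^sup>2"
  proof -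
    have "1 \<le> (L1 + L2 + 1)\<^sup>2" using L by (simp add: one_le_power)
    then show ?thesis using \<open>A \<ge> 1\<close> mult_mono[of 1 A 1 "(L1 + L2 + 1)\<^sup>2"] by simp
  qed
  then have m1: "1 \<le> real m" using m by linarith
  have large: "B < (c / l)\<^sup>2" if "real m \<le> \<bar>c\<bar>" "0 < l" "l \<le> L1 + L2" for c l :: real
  proof -
    have "B * l\<^sup>2 \<le> A * l\<^sup>2" using \<open>B < A\<close> by (intro mult_right_mono) auto
    also have "\<dots> \<le> A * (L1 + L2 + 1)\<^sup>2" using that \<open>A \<ge> 1\<close> by (intro mult_left_mono power_mono) auto
    also have "\<dots> < real m * 1" using m by simp
    also have "\<dots> \<le> real m * real m" using m1 by (intro mult_left_mono) auto
    also have "\<dots> \<le> \<bar>c\<bar> * \<bar>c\<bar>" using that by (intro mult_mono) auto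
    finally have "B * l\<^sup>2 < c\<^sup>2" by (simp add: power2_eq_square)
    then show ?thesis using that by (simp add: power_divide pos_less_divide_eq)
  qed
  show ?thesis
  proof (cases "M $ 1 = 0")
    \<comment> \<open>The first axis is then exactly orthogonal to M.\<close>
    case True
    have "freq L1 L2 (V (of_int (int m)) (of_int 0))" using m1 by (intro fr) auto
    moreover have "M \<bullet> V (of_int (int m)) (of_int 0) = 0" by (simp add: MV True)
    moreover have "B < V (of_int (int m)) (of_int 0) \<bullet> V (of_int (int m)) (of_int 0)"
      unfolding VV using large[of "real m" L1] L by simp
    ultimately show ?thesis using \<open>0 < \<delta>\<close> by (intro exI conjI) auto
  next
    case False
    \<comment> \<open>With coefficients -m a and m k, the product M\<cdot>\<xi> becomes m (M_1/L_1)
      (k \<theta> - a).\<close>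
    define \<theta> where "\<theta> = (M $ 2 / L2) / (M $ 1 / L1)"
    define c where "c = \<bar>M $ 1 / L1\<bar>"
    have "c > 0" using False L by (simp add: c_def)
    \<comment> \<open>Dirichlet's theorem guarantees only k \<ge> 1, so length comes from the factor
      m, and N is chosen after m to compensate for it.\<close>
    obtain N :: nat where N: "real m * c / \<delta> < real N" using reals_Archimedean2 by blast
    have "0 \<le> real m * c / \<delta>" using \<open>c > 0\<close> \<open>0 < \<delta>\<close> by simp
    then have "N > 0" using N by (cases N) auto
    obtain a k where k: "0 < k" "k \<le> int N" "\<bar>of_int k * \<theta> - of_int a\<bar> < 1 / real N"
      using Dirichlet_approx[OF \<open>N > 0\<close>, of \<theta>] by metis
    let ?\<xi> = "V (of_int (- (int m * a))) (of_int (int m * k))"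
    have "freq L1 L2 ?\<xi>" using m1 k by (intro fr) auto
    moreover have "\<bar>M \<bullet> ?\<xi>\<bar> < \<delta>"
    proof -
      have "M \<bullet> ?\<xi> = real m * (M $ 1 / L1) * (of_int k * \<theta> - of_int a)"
        using False L by (simp add: MV \<theta>_def field_simps)
      then have "\<bar>M \<bullet> ?\<xi>\<bar> = real m * c * \<bar>of_int k * \<theta> - of_int a\<bar>" by (simp add: abs_mult c_def)
      also have "\<dots> \<le> real m * c * (1 / real N)"
        using k(3) \<open>c > 0\<close> by (intro mult_left_mono) auto
      also have "\<dots> < \<delta>" using N \<open>N > 0\<close> \<open>0 < \<delta>\<close> by (simp add: field_simps)
      finally show ?thesis .
    qed
    moreover have "B < ?\<xi> \<bullet> ?\<xi>"
    proof -
      have "real m * 1 \<le> real m * of_int k" using k(1) by (intro mult_left_mono) auto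
      then have "B < (of_int (int m * k) / L2)\<^sup>2" using L by (intro large) auto
      then show ?thesis unfolding VV using zero_le_power2[of "of_int (- (int m * a)) / L1"] by linarith
    qed
    ultimately show ?thesis by blast
  qed
qed

lemma set_integral_sq_eq_0:
  assumes "set_integrable M A (\<lambda>x. (f x :: real)\<^sup>2)" "(LINT x:A|M. (f x)\<^sup>2) \<le> 0"
  shows "AE x in M. x \<in> A \<longrightarrow> f x = 0"
proof -
  have "(LINT x|M. indicator A x *\<^sub>R (f x)\<^sup>2) = 0"
    using assms(2) set_integral_sq_nonneg[where A=A and M=M and f=f] unfolding set_lebesgue_integral_def by linarith
  then have "AE x in M. indicator A x *\<^sub>R (f x)\<^sup>2 = 0"
    using assms(1) by (subst (asm) integral_nonneg_eq_0_iff_AE) (auto simp: set_integrable_def)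
  then show ?thesis by (rule AE_mp) (auto intro!: AE_I2 simp: indicator_def)
qed

context profile begin

section \<open>Positive energy above the critical number\<close>

definition fld :: "real^3 \<Rightarrow> (real^3 \<Rightarrow> real) \<Rightarrow> real" where
  "fld M f = (LINT y:cell L1 L2 h|lborel. (\<Sum>i\<in>UNIV. M$i * wpd h f i y)\<^sup>2)"

lemma fld_nonneg: "0 \<le> fld M f" unfolding fld_def by (rule set_integral_sq_nonneg)

lemma fld_scale:
  assumes "M $ 3 \<noteq> 0"
  shows "fld ((1 / M $ 3) *\<^sub>R M) f = fld M f / (M $ 3)\<^sup>2"
proof -
  have "(\<Sum>i\<in>UNIV. ((1 / M $ 3) *\<^sub>R M) $ i * wpd h f i y)\<^sup>2 = (1 / (M $ 3)\<^sup>2) * (\<Sum>i\<in>UNIV. M$i * wpd h f i y)\<^sup>2" for y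
    by (simp add: sum_divide_distrib[symmetric] power_divide)
  then show ?thesis by (simp add: fld_def)
qed

text \<open>Gravity and the cubic term act on the third component alone. Gravity costs at most the
  fraction \<sigma>/m of its magnetic energy; half of what is left pays for the cubic term, and the
  other half keeps the energy positive.\<close>

lemma stability:
  assumes M: "mN L1 L2 h g lam \<rho> < \<bar>M $ 3\<bar>"
  shows "\<exists>\<epsilon>>0. \<forall>vp. H10_vec L1 L2 h vp \<and> nontrivial L1 L2 h vp \<and>
    (AE y in lborel. y \<in> cell L1 L2 h \<longrightarrow> norm (vp y) \<le> \<epsilon>) \<longrightarrow> deltaN L1 L2 h g lam \<rho> M vp > 0"
proof -
  define m where "m = (M $ 3)\<^sup>2"
  define \<sigma> where "\<sigma> = Sup S"
  have "\<sigma> > 0" using Sup_S_pos by (simp add: \<sigma>_def)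
  have "\<sigma> < m"
  proof -
    have "sqrt \<sigma> < \<bar>M $ 3\<bar>" using M by (simp add: mN_eq \<sigma>_def)
    then have "(sqrt \<sigma>)\<^sup>2 < \<bar>M $ 3\<bar>\<^sup>2" using \<open>\<sigma> > 0\<close> by (intro power_strict_mono) auto
    then show ?thesis using \<open>\<sigma> > 0\<close> by (simp add: m_def)
  qed
  then have "m > 0" using \<open>\<sigma> > 0\<close> by linarith
  then have M3: "M $ 3 \<noteq> 0" by (auto simp: m_def)
  define v where "v = (1 / M $ 3) *\<^sub>R M"
  have v3: "v $ 3 = 1" using M3 by (simp add: v_def)
  \<comment> \<open>Half of the surplus lam/2 (1 - \<sigma>/m) that gravity leaves.\<close>
  define \<gamma> where "\<gamma> = lam / 4 * (1 - \<sigma> / m)"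
  have "\<gamma> > 0" using \<open>\<sigma> < m\<close> \<open>m > 0\<close> pos by (simp add: \<gamma>_def)
  \<comment> \<open>The cubic bound g K combined with the Poincare constant along M / M_3, so that
    the remainder is at most c \<epsilon> times the magnetic energy of the third component.\<close>
  define c where "c = g * K * (4 * h\<^sup>2 / m)"
  have "c > 0" using pos K(1) \<open>m > 0\<close> by (simp add: c_def)
  define \<epsilon> where "\<epsilon> = min 1 (\<gamma> / c)"
  have "\<epsilon> > 0" "\<epsilon> \<le> 1" using \<open>\<gamma> > 0\<close> \<open>c > 0\<close> by (auto simp: \<epsilon>_def)
  have "c * \<epsilon> \<le> \<gamma>"
  proof -
    have "\<epsilon> \<le> \<gamma> / c" by (simp add: \<epsilon>_def)
    then show ?thesis using \<open>c > 0\<close> by (simp add: field_simps)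
  qed
  have "deltaN L1 L2 h g lam \<rho> M vp > 0"
    if H: "H10_vec L1 L2 h vp" and nt: "nontrivial L1 L2 h vp"
      and small: "AE y in lborel. y \<in> cell L1 L2 h \<longrightarrow> norm (vp y) \<le> \<epsilon>" for vp
  proof -
    let ?C = "cell L1 L2 h"
    define N where "N j = fld M (\<lambda>y. vp y $ j)" for j
    have N0: "0 \<le> N j" for j unfolding N_def by (rule fld_nonneg)
    have H': "H10 L1 L2 h (\<lambda>y. vp y $ j)" for j using H by (simp add: H10_vec_def)
    have P: "(LINT y:?C|lborel. (vp y $ j)\<^sup>2) \<le> 4 * h\<^sup>2 / m * N j" for j
    proof -
      have "(LINT y:?C|lborel. (vp y $ j)\<^sup>2) \<le> 4 * h\<^sup>2 * fld v (\<lambda>y. vp y $ j)"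
        unfolding fld_def by (rule poincare[OF pos(1-3) v3 H'])
      then show ?thesis unfolding v_def fld_scale[OF M3] N_def m_def by simp
    qed
    have W: "g / 2 * (LINT y:?C|lborel. deriv \<rho> (y $ 3) * (vp y $ 3)\<^sup>2) \<le> lam / 2 * (\<sigma> / m) * N 3"
    proof -
      have "(LINT y:?C|lborel. deriv \<rho> (y $ 3) * (vp y $ 3)\<^sup>2) \<le> lam * \<sigma> / g * (N 3 / m)"
      proof -
        have "(LINT y:?C|lborel. deriv \<rho> (y $ 3) * (vp y $ 3)\<^sup>2) \<le> lam * \<sigma> / g * fld v (\<lambda>y. vp y $ 3)"
          unfolding fld_def \<sigma>_def by (rule line_inequality[OF pos(1,2) rho_cont v3 bump_inequality H'])
        then show ?thesis unfolding v_def fld_scale[OF M3] N_def m_def .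
      qed
      then have "g / 2 * (LINT y:?C|lborel. deriv \<rho> (y $ 3) * (vp y $ 3)\<^sup>2) \<le> g / 2 * (lam * \<sigma> / g * (N 3 / m))"
        using pos by (intro mult_left_mono) auto
      then show ?thesis using pos by (simp add: field_simps)
    qed
    have T: "(LINT y:?C|lborel. (LBINT \<tau> = ereal 0..ereal (vp y $ 3). NN g \<rho> \<tau> (y$3))) \<le> \<gamma> * N 3"
    proof -
      have "\<bar>LINT y:?C|lborel. (LBINT \<tau> = ereal 0..ereal (vp y $ 3). NN g \<rho> \<tau> (y$3))\<bar> \<le> (LINT y:?C|lborel. g * K * \<epsilon> * (vp y $ 3)\<^sup>2)"
      proof (rule set_integral_abs_bound)
        show "set_integrable lborel ?C (\<lambda>y. g * K * \<epsilon> * (vp y $ 3)\<^sup>2)"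
          using H10_sq_integrable[OF H'[of 3]] by simp
        have bd: "\<bar>LBINT \<tau> = ereal 0..ereal (vp y $ 3). NN g \<rho> \<tau> (y$3)\<bar> \<le> g * K * \<epsilon> * (vp y $ 3)\<^sup>2"
          if "y \<in> ?C" "norm (vp y) \<le> \<epsilon>" for y
        proof -
          have v: "\<bar>vp y $ 3\<bar> \<le> \<epsilon>" using component_le_norm_cart[of "vp y" 3] that by linarith
          have "\<bar>LBINT \<tau> = ereal 0..ereal (vp y $ 3). NN g \<rho> \<tau> (y$3)\<bar> \<le> g * K * \<bar>vp y $ 3\<bar> ^ 3"
            using v \<open>\<epsilon> \<le> 1\<close> that by (intro NN_integral_bound) (auto simp: cell_def)
          also have "\<dots> = g * K * (\<bar>vp y $ 3\<bar> * (vp y $ 3)\<^sup>2)" by (simp add: power3_eq_cube power2_eq_square)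
          also have "\<dots> \<le> g * K * (\<epsilon> * (vp y $ 3)\<^sup>2)"
            using v pos K(1) by (intro mult_left_mono mult_right_mono) auto
          finally show ?thesis by (simp add: mult.assoc)
        qed
        show "AE y in lborel. y \<in> ?C \<longrightarrow> \<bar>LBINT \<tau> = ereal 0..ereal (vp y $ 3). NN g \<rho> \<tau> (y$3)\<bar> \<le> g * K * \<epsilon> * (vp y $ 3)\<^sup>2"
          by (rule AE_mp[OF small]) (use bd in \<open>auto intro!: AE_I2\<close>)
      qed
      also have "\<dots> = g * K * \<epsilon> * (LINT y:?C|lborel. (vp y $ 3)\<^sup>2)" by simp
      also have "\<dots> \<le> g * K * \<epsilon> * (4 * h\<^sup>2 / m * N 3)"
        using P[of 3] pos K(1) \<open>\<epsilon> > 0\<close> by (intro mult_left_mono) auto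
      also have "\<dots> = c * \<epsilon> * N 3" by (simp add: c_def)
      also have "\<dots> \<le> \<gamma> * N 3" using \<open>c * \<epsilon> \<le> \<gamma>\<close> N0 by (intro mult_right_mono) auto
      finally show ?thesis by linarith
    qed
    \<comment> \<open>If the magnetic energy of every component vanished, the Poincare inequality
      along M would make the displacement zero almost everywhere on the cell.\<close>
    have "\<exists>j. 0 < N j"
    proof (rule ccontr)
      assume "\<not> (\<exists>j. 0 < N j)"
      then have "N j = 0" for j using N0[of j] by (metis less_eq_real_def)
      then have "AE y in lborel. y \<in> ?C \<longrightarrow> vp y $ j = 0" for j
        using P[of j] by (intro set_integral_sq_eq_0 H10_sq_integrable[OF H']) auto
      then have "AE y in lborel. \<forall>j. y \<in> ?C \<longrightarrow> vp y $ j = 0" by (subst AE_all_countable) blast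
      then have "AE y in lborel. y \<in> ?C \<longrightarrow> vp y = 0" by (rule AE_mp) (auto intro!: AE_I2 simp: vec_eq_iff)
      then show False using nt by (simp add: nontrivial_def)
    qed
    then have "0 < N 1 \<or> 0 < N 2 \<or> 0 < N 3" by (metis exhaust_3)
    then have "0 < lam / 2 * N 1 + lam / 2 * N 2 + \<gamma> * N 3"
      using N0[of 1] N0[of 2] N0[of 3] pos \<open>\<gamma> > 0\<close>
      by (smt (verit) mult_nonneg_nonneg mult_pos_pos half_gt_zero)
    moreover have "lam / 2 * N 3 - lam / 2 * (\<sigma> / m) * N 3 - \<gamma> * N 3 = \<gamma> * N 3"
    proof -
      have "lam / 2 * n - lam / 2 * r * n - lam / 4 * (1 - r) * n = lam / 4 * (1 - r) * n" for r n :: real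
        by (simp add: field_simps)
      then show ?thesis unfolding \<gamma>_def .
    qed
    moreover have "deltaN L1 L2 h g lam \<rho> M vp = lam / 2 * (N 1 + N 2 + N 3)
       - g / 2 * (LINT y:?C|lborel. deriv \<rho> (y $ 3) * (vp y $ 3)\<^sup>2)
       - (LINT y:?C|lborel. (LBINT \<tau> = ereal 0..ereal (vp y $ 3). NN g \<rho> \<tau> (y$3)))"
      unfolding deltaN_def N_def fld_def by (simp add: sum_3)
    ultimately show ?thesis using W T by (simp add: distrib_left)
  qed
  with \<open>\<epsilon> > 0\<close> show ?thesis by blast
qed

text \<open>If no bump beat the constant (M_3)^2, the line inequality in the vertical direction
  would bound every quotient in \<open>S\<close> by it, against (M_3)^2 < \<open>Sup S\<close>. Thus
  a Sobolev competitor is traded for a smooth one-dimensional profile.\<close>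

lemma unstable_bump:
  assumes M: "\<bar>M $ 3\<bar> < mN L1 L2 h g lam \<rho>"
  obtains \<Psi> where "bump_seq h \<Psi>" "lam * ((M $ 3)\<^sup>2 * (LINT t:{0<..<h}|lborel. (\<Psi> 1 t)\<^sup>2))
    < g * (LINT t:{0<..<h}|lborel. deriv \<rho> t * (\<Psi> 0 t)\<^sup>2)"
proof (rule ccontr)
  note that0 = that
  assume no: "\<not> thesis"
  define m where "m = (M $ 3)\<^sup>2"
  have hyp: "(LINT t:{0<..<h}|lborel. deriv \<rho> t * (\<Psi> 0 t)\<^sup>2) \<le> lam * m / g * (LINT t:{0<..<h}|lborel. (\<Psi> 1 t)\<^sup>2)"
    if "bump_seq h \<Psi>" for \<Psi>
  proof (rule ccontr)
    assume "\<not> (LINT t:{0<..<h}|lborel. deriv \<rho> t * (\<Psi> 0 t)\<^sup>2) \<le> lam * m / g * (LINT t:{0<..<h}|lborel. (\<Psi> 1 t)\<^sup>2)"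
    then have "lam * (m * (LINT t:{0<..<h}|lborel. (\<Psi> 1 t)\<^sup>2)) < g * (LINT t:{0<..<h}|lborel. deriv \<rho> t * (\<Psi> 0 t)\<^sup>2)"
      using pos by (simp add: field_simps)
    with that0[OF that] no show False unfolding m_def by blast
  qed
  have "m < Sup S"
  proof -
    have "\<bar>M $ 3\<bar>\<^sup>2 < (sqrt (Sup S))\<^sup>2" using M by (intro power_strict_mono) (auto simp: mN_eq)
    then show ?thesis using Sup_S_pos by (simp add: m_def)
  qed
  then obtain s where "s \<in> S" "m < s" using less_cSupE Sup_S_pos(1) by metis
  then obtain w where w: "H1sigma L1 L2 h w" and s: "m < g * num w / (lam * (\<Sum>j\<in>UNIV. den w j))"
    by (auto simp: S_def)
  let ?d = "\<Sum>j\<in>UNIV. den w j"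
  have "0 \<le> m" by (simp add: m_def)
  have "0 \<le> ?d" by (intro sum_nonneg den_nonneg)
  \<comment> \<open>A zero denominator would make the quotient 0, which does not exceed m \<ge>
    0.\<close>
  have "?d \<noteq> 0" using s \<open>0 \<le> m\<close> by auto
  with \<open>0 \<le> ?d\<close> have "0 < lam * ?d" using pos by simp
  then have gt: "m * (lam * ?d) < g * num w" using s by (simp add: pos_less_divide_eq)
  have "den w 3 \<le> ?d" by (rule member_le_sum) (auto intro: den_nonneg)
  have "H10 L1 L2 h (\<lambda>x. w x $ 3)" using w by (simp add: H1sigma_def H10_vec_def)
  moreover have "axis 3 1 $ 3 = (1::real)" by simp
  ultimately have "num w \<le> lam * m / g * den w 3"
    using line_inequality[OF pos(1,2) rho_cont _ hyp, of "axis 3 1" "\<lambda>x. w x $ 3"] unfolding num_def den_axis by blast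
  also have "\<dots> \<le> lam * m / g * ?d"
    using \<open>den w 3 \<le> ?d\<close> pos \<open>0 \<le> m\<close> by (intro mult_left_mono) auto
  finally have "g * num w \<le> m * (lam * ?d)" using pos by (simp add: field_simps)
  with gt show False by simp
qed

text \<open>The one-dimensional profile wins by a gap G. The term with (M\<cdot>\<xi>)^2 and the
  term divided by |\<xi>|^2 may each consume a third of it; the last third makes the inequality
  strict.\<close>

lemma unstable_mode:
  assumes M: "\<bar>M $ 3\<bar> < mN L1 L2 h g lam \<rho>"
  obtains \<Psi> \<xi> \<epsilon>1 where "bump_flow L1 L2 h \<Psi> \<xi> \<epsilon>1"
    "lam * (\<Sum>j\<in>UNIV. LINT x:cell L1 L2 h|lborel. (dird M (\<lambda>x. bump_flow.w \<Psi> \<xi> x $ j) x)\<^sup>2) <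
     g * (LINT x:cell L1 L2 h|lborel. deriv \<rho> (x $ 3) * (bump_flow.w \<Psi> \<xi> x $ 3)\<^sup>2)"
proof -
  obtain \<Psi> where b: "bump_seq h \<Psi>" and lt: "lam * ((M $ 3)\<^sup>2 * (LINT t:{0<..<h}|lborel. (\<Psi> 1 t)\<^sup>2))
    < g * (LINT t:{0<..<h}|lborel. deriv \<rho> t * (\<Psi> 0 t)\<^sup>2)"
    using unstable_bump[OF M] by blast
  define Jn where "Jn k = (LINT t:{0<..<h}|lborel. (\<Psi> k t)\<^sup>2)" for k
  define J where "J = (LINT t:{0<..<h}|lborel. deriv \<rho> t * (\<Psi> 0 t)\<^sup>2)"
  have Jn0: "0 \<le> Jn k" for k unfolding Jn_def by (rule set_integral_sq_nonneg)
  define G where "G = g * J - lam * ((M $ 3)\<^sup>2 * Jn 1)"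
  have "G > 0" using lt by (simp add: G_def J_def Jn_def)
  \<comment> \<open>The bound by 1 allows (M\<cdot>\<xi>)^2 to be estimated by |M\<cdot>\<xi>|; the
    other entry limits the resulting cost to G/3.\<close>
  define \<delta> where "\<delta> = min 1 (G / (3 * (lam * (Jn 0 + 1))))"
  have p0: "0 < lam * (Jn 0 + 1)" using pos Jn0[of 0] by simp
  have "\<delta> > 0" using \<open>G > 0\<close> p0 by (simp add: \<delta>_def)
  \<comment> \<open>An upper bound for the numerator of the high-frequency term once
    (M\<cdot>\<xi>)^2 \<le> 1, fixed before \<xi> is known.\<close>
  define D where "D = lam * ((M $ 3)\<^sup>2 * Jn 2 + Jn 1)"
  have "D \<ge> 0" using pos Jn0 by (simp add: D_def)
  obtain \<xi> where f: "freq L1 L2 \<xi>" and mu: "\<bar>M \<bullet> \<xi>\<bar> < \<delta>" and big: "3 * D / G < \<xi> \<bullet> \<xi>"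
    using small_divisor_freq[OF pos(1,2) \<open>\<delta> > 0\<close>] by blast
  obtain \<epsilon>1 where bf: "bump_flow L1 L2 h \<Psi> \<xi> \<epsilon>1" using bump_flow_exists[OF pos(1,2) b f] ..
  interpret bump_flow L1 L2 h \<Psi> \<xi> \<epsilon>1 by (rule bf)
  have Jn_eq: "In k = Jn k" for k by (simp add: Jn_def In_def)
  have mu2: "(M \<bullet> \<xi>)\<^sup>2 \<le> \<delta>" "(M \<bullet> \<xi>)\<^sup>2 \<le> 1"
  proof -
    have "\<bar>M \<bullet> \<xi>\<bar> \<le> 1" using mu by (simp add: \<delta>_def)
    then have "\<bar>M \<bullet> \<xi>\<bar> * \<bar>M \<bullet> \<xi>\<bar> \<le> \<bar>M \<bullet> \<xi>\<bar> * 1" by (intro mult_left_mono) auto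
    then have "(M \<bullet> \<xi>)\<^sup>2 \<le> \<bar>M \<bullet> \<xi>\<bar>" by (simp add: power2_eq_square)
    then show "(M \<bullet> \<xi>)\<^sup>2 \<le> \<delta>" "(M \<bullet> \<xi>)\<^sup>2 \<le> 1" using mu \<open>\<bar>M \<bullet> \<xi>\<bar> \<le> 1\<close> by linarith+
  qed
  have t1: "lam * ((M \<bullet> \<xi>)\<^sup>2 * Jn 0) \<le> G / 3"
  proof -
    have "(M \<bullet> \<xi>)\<^sup>2 * (lam * Jn 0) \<le> \<delta> * (lam * (Jn 0 + 1))"
      using mu2 Jn0[of 0] pos \<open>\<delta> > 0\<close> by (intro mult_mono) auto
    also have "\<dots> \<le> G / (3 * (lam * (Jn 0 + 1))) * (lam * (Jn 0 + 1))"
      using p0 by (intro mult_right_mono) (auto simp: \<delta>_def)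
    also have "\<dots> = G / 3" using p0 pos by (simp add: field_simps)
    finally show ?thesis by (simp add: mult.left_commute)
  qed
  have t2: "lam * (((M $ 3)\<^sup>2 * Jn 2 + (M \<bullet> \<xi>)\<^sup>2 * Jn 1) / (\<xi> \<bullet> \<xi>)) \<le> G / 3"
  proof -
    have "(M \<bullet> \<xi>)\<^sup>2 * Jn 1 \<le> 1 * Jn 1" using mu2(2) Jn0 by (intro mult_right_mono)
    then have "lam * ((M $ 3)\<^sup>2 * Jn 2 + (M \<bullet> \<xi>)\<^sup>2 * Jn 1) \<le> D" using pos by (simp add: D_def)
    moreover have "D \<le> (\<xi> \<bullet> \<xi>) * (G / 3)" using big \<open>G > 0\<close> by (simp add: field_simps)
    ultimately have "lam * ((M $ 3)\<^sup>2 * Jn 2 + (M \<bullet> \<xi>)\<^sup>2 * Jn 1) \<le> G / 3 * (\<xi> \<bullet> \<xi>)" by (simp add: mult.commute)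
    then show ?thesis using xi_pos by (simp add: pos_divide_le_eq)
  qed
  have "lam * ((M $ 3)\<^sup>2 * Jn 1 + (M \<bullet> \<xi>)\<^sup>2 * Jn 0 + ((M $ 3)\<^sup>2 * Jn 2 + (M \<bullet> \<xi>)\<^sup>2 * Jn 1) / (\<xi> \<bullet> \<xi>)) < g * J"
  proof -
    have "x + y + z < j" if "y \<le> G / 3" "z \<le> G / 3" "0 < G" "G = j - x" for x y z j G :: real
      using that by linarith
    from this[OF t1 t2 \<open>G > 0\<close> G_def] show ?thesis unfolding distrib_left[of lam] .
  qed
  then have "2 * pi\<^sup>2 * L1 * L2 * (lam * ((M $ 3)\<^sup>2 * Jn 1 + (M \<bullet> \<xi>)\<^sup>2 * Jn 0 + ((M $ 3)\<^sup>2 * Jn 2 + (M \<bullet> \<xi>)\<^sup>2 * Jn 1) / (\<xi> \<bullet> \<xi>)))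
     < 2 * pi\<^sup>2 * L1 * L2 * (g * J)"
    using pos by (intro mult_strict_left_mono) auto
  then show ?thesis
    using that[OF bf] unfolding integral_dird_w integral_w3[OF rho_cont] Jn_eq J_def[symmetric]
    by (simp only: mult.left_commute[of lam] mult.left_commute[of g])
qed

end

section \<open>Negative energy below the critical number\<close>

lemma square_perturbation:
  fixes a b \<epsilon> :: real
  assumes "\<bar>a\<bar> \<le> B" "\<bar>b\<bar> \<le> B" "0 < \<epsilon>" "\<epsilon> \<le> 1"
  shows "\<bar>(a + \<epsilon> * b)\<^sup>2 - a\<^sup>2\<bar> \<le> 3 * \<epsilon> * B\<^sup>2"
proof -
  have "B \<ge> 0" using assms(1) by linarith
  have eq: "(a + \<epsilon> * b)\<^sup>2 - a\<^sup>2 = \<epsilon> * (b * (2 * a + \<epsilon> * b))" by (simp add: power2_eq_square algebra_simps)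
  have "\<bar>2 * a + \<epsilon> * b\<bar> \<le> 2 * \<bar>a\<bar> + \<bar>\<epsilon> * b\<bar>" using abs_triangle_ineq[of "2 * a" "\<epsilon> * b"] by simp
  moreover have "\<bar>\<epsilon> * b\<bar> \<le> 1 * B" unfolding abs_mult using assms by (intro mult_mono) auto
  ultimately have "\<bar>2 * a + \<epsilon> * b\<bar> \<le> 3 * B" using assms(1) by linarith
  then have "\<bar>b\<bar> * \<bar>2 * a + \<epsilon> * b\<bar> \<le> B * (3 * B)" using assms \<open>B \<ge> 0\<close> by (intro mult_mono) auto
  then have "\<epsilon> * (\<bar>b\<bar> * \<bar>2 * a + \<epsilon> * b\<bar>) \<le> \<epsilon> * (B * (3 * B))" using assms by (intro mult_left_mono) auto
  then show ?thesis unfolding eq abs_mult using assms by (simp add: power2_eq_square algebra_simps)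
qed

context bump_flow begin

lemma dird_Theta:
  assumes e: "\<epsilon> \<in> I"
  shows "dird M (\<lambda>x. \<Theta> \<epsilon> x $ j) x = \<epsilon> * (dird M (\<lambda>x. w x $ j) x + \<epsilon> * dird M (\<lambda>x. v \<epsilon> x $ j) x)"
proof -
  have dw: "(\<lambda>x. w x $ j) differentiable at x" and dv: "(\<lambda>x. v \<epsilon> x $ j) differentiable at x" for x
    by (intro smooth_differentiable w_smooth v_smooth[OF e])+
  have d: "(\<lambda>x. \<epsilon> * w x $ j) differentiable at x" "(\<lambda>x. \<epsilon>\<^sup>2 * v \<epsilon> x $ j) differentiable at x" for x
    using dw dv by (auto intro: differentiable_mult)
  have "pd i (\<lambda>x. \<Theta> \<epsilon> x $ j) x = \<epsilon> * pd i (\<lambda>x. w x $ j) x + \<epsilon>\<^sup>2 * pd i (\<lambda>x. v \<epsilon> x $ j) x" for i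
  proof -
    have "(\<lambda>x. \<Theta> \<epsilon> x $ j) = (\<lambda>x. \<epsilon> * w x $ j + \<epsilon>\<^sup>2 * v \<epsilon> x $ j)" by (simp add: \<Theta>_def)
    then show ?thesis by (simp only: pd_add[OF d] pd_cmult[OF dw] pd_cmult[OF dv])
  qed
  then show ?thesis
    unfolding dird_def by (simp add: sum_distrib_left sum.distrib algebra_simps power2_eq_square)
qed

lemma alg_dird: "F \<in> alg I gens \<Longrightarrow> (\<lambda>\<epsilon>. dird M (F \<epsilon>)) \<in> alg I gens"
  unfolding dird_def[abs_def] sum_3 by (intro alg_intros alg_pd[OF gens_closed])

text \<open>A single constant for the mode, the corrector and their derivatives along M makes every
  error in the energy expansion a multiple of \<epsilon>.\<close>

lemma uniform_bound:
  "\<exists>B>0. \<forall>\<epsilon>\<in>I. \<forall>j x. \<bar>w x $ j\<bar> \<le> B \<and> \<bar>v \<epsilon> x $ j\<bar> \<le> B \<and>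
     \<bar>dird M (\<lambda>x. w x $ j) x\<bar> \<le> B \<and> \<bar>dird M (\<lambda>x. v \<epsilon> x $ j) x\<bar> \<le> B"
proof -
  note bd = alg_bounded[OF gens_closed]
  have "\<forall>j. \<exists>B. \<forall>\<epsilon>\<in>I. \<forall>x. \<bar>w x $ j\<bar> \<le> B" using bd[OF w_alg] by blast
  then obtain B1 where B1: "\<And>j \<epsilon> x. \<epsilon> \<in> I \<Longrightarrow> \<bar>w x $ j\<bar> \<le> B1 j" by metis
  have "\<forall>j. \<exists>B. \<forall>\<epsilon>\<in>I. \<forall>x. \<bar>v \<epsilon> x $ j\<bar> \<le> B" using bd[OF v_alg] by blast
  then obtain B2 where B2: "\<And>j \<epsilon> x. \<epsilon> \<in> I \<Longrightarrow> \<bar>v \<epsilon> x $ j\<bar> \<le> B2 j" by metis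
  have "\<forall>j. \<exists>B. \<forall>\<epsilon>\<in>I. \<forall>x. \<bar>dird M (\<lambda>x. w x $ j) x\<bar> \<le> B" using bd[OF alg_dird[OF w_alg]] by blast
  then obtain B3 where B3: "\<And>j \<epsilon> x. \<epsilon> \<in> I \<Longrightarrow> \<bar>dird M (\<lambda>x. w x $ j) x\<bar> \<le> B3 j" by metis
  have "\<forall>j. \<exists>B. \<forall>\<epsilon>\<in>I. \<forall>x. \<bar>dird M (\<lambda>x. v \<epsilon> x $ j) x\<bar> \<le> B" using bd[OF alg_dird[OF v_alg]] by blast
  then obtain B4 where B4: "\<And>j \<epsilon> x. \<epsilon> \<in> I \<Longrightarrow> \<bar>dird M (\<lambda>x. v \<epsilon> x $ j) x\<bar> \<le> B4 j" by metis
  define b where "b j = \<bar>B1 j\<bar> + \<bar>B2 j\<bar> + \<bar>B3 j\<bar> + \<bar>B4 j\<bar>" for j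
  define B where "B = (\<Sum>j\<in>UNIV. b j) + 1"
  have b0: "0 \<le> b j" for j by (simp add: b_def)
  have "0 < B" unfolding B_def using sum_nonneg[of UNIV b] b0 by (simp add: add_nonneg_pos)
  have bB: "b j \<le> B" for j using member_le_sum[of j UNIV b] b0 by (simp add: B_def)
  have le: "B1 j \<le> B" "B2 j \<le> B" "B3 j \<le> B" "B4 j \<le> B" for j
    using bB[of j] unfolding b_def by linarith+
  show ?thesis
    using \<open>0 < B\<close> B1 B2 B3 B4 le by (intro exI[of _ B]) (meson order_trans)
qed

end

context profile begin

text \<open>After division by \<epsilon>^2 the energy is at most E0/2 + c \<epsilon>, where E0/2 is
  the quadratic energy of the mode. The corrector and the cubic term enter only through c.\<close>

lemma energy_negative:
  assumes bf: "bump_flow L1 L2 h \<Psi> \<xi> \<epsilon>1"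
    and neg: "lam * (\<Sum>j\<in>UNIV. LINT x:cell L1 L2 h|lborel. (dird M (\<lambda>x. bump_flow.w \<Psi> \<xi> x $ j) x)\<^sup>2) <
     g * (LINT x:cell L1 L2 h|lborel. deriv \<rho> (x $ 3) * (bump_flow.w \<Psi> \<xi> x $ 3)\<^sup>2)"
  shows "\<exists>\<epsilon>3>0. \<epsilon>3 \<le> \<epsilon>1 \<and> (\<forall>\<epsilon>\<in>{0<..<\<epsilon>3}. deltaN L1 L2 h g lam \<rho> M (bump_flow.\<Theta> \<Psi> \<xi> \<epsilon>) < 0)"
proof -
  interpret bump_flow L1 L2 h \<Psi> \<xi> \<epsilon>1 by (rule bf)
  let ?C = "cell L1 L2 h"
  define vol where "vol = measure lborel ?C"
  have "vol \<ge> 0" by (simp add: vol_def)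
  obtain B where B: "0 < B" and b: "\<And>\<epsilon> j x. \<epsilon> \<in> I \<Longrightarrow> \<bar>w x $ j\<bar> \<le> B \<and> \<bar>v \<epsilon> x $ j\<bar> \<le> B \<and>
     \<bar>dird M (\<lambda>x. w x $ j) x\<bar> \<le> B \<and> \<bar>dird M (\<lambda>x. v \<epsilon> x $ j) x\<bar> \<le> B"
    using uniform_bound[of M] by metis
  define W where "W j = (LINT x:?C|lborel. (dird M (\<lambda>x. w x $ j) x)\<^sup>2)" for j
  define J where "J = (LINT x:?C|lborel. deriv \<rho> (x $ 3) * (w x $ 3)\<^sup>2)"
  define E0 where "E0 = lam * (\<Sum>j\<in>UNIV. W j) - g * J"
  have "E0 < 0" using neg by (simp add: E0_def W_def J_def)
  have cw: "continuous_on UNIV (\<lambda>x. w x $ j)" for j by (rule smooth_continuous[OF w_smooth])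
  have crho: "continuous_on UNIV (\<lambda>x::real^3. deriv \<rho> (x $ 3))"
    by (intro continuous_on_compose2[OF rho_cont[of UNIV]] continuous_intros) auto
  have sd: "continuous_on UNIV (dird M f)" if "smooth f" for f
    using smooth_dird_pow[OF that, where m=1 and v=M] by (intro smooth_continuous) simp
  \<comment> \<open>Errors of the magnetic term over three components, of the gravity term, and of
    the cubic term, whose 8 is the cube of 2 in |\<Theta>_3| \<le> 2 B \<epsilon>.\<close>
  define c where "c = lam / 2 * (3 * (3 * B\<^sup>2 * vol)) + g / 2 * (R * (3 * B\<^sup>2) * vol) + 8 * g * K * B ^ 3 * vol"
  have "c \<ge> 0" using pos R(1) K(1) B \<open>vol \<ge> 0\<close> by (simp add: c_def)
  \<comment> \<open>The entries keep \<epsilon> admissible for the flow, keep |\<Theta>_3| at most 1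
    so that the cubic bound applies, and keep \<epsilon> c below -E0/2.\<close>
  define \<epsilon>3 where "\<epsilon>3 = min \<epsilon>1 (min (1 / (2 * B)) (- E0 / (2 * (c + 1))))"
  have "\<epsilon>3 > 0" using \<epsilon>1(1) B \<open>E0 < 0\<close> \<open>c \<ge> 0\<close> by (auto simp: \<epsilon>3_def intro!: divide_pos_pos divide_neg_pos)
  moreover have "deltaN L1 L2 h g lam \<rho> M (\<Theta> \<epsilon>) < 0" if "\<epsilon> \<in> {0<..<\<epsilon>3}" for \<epsilon>
  proof -
    have e: "\<epsilon> \<in> I" "0 < \<epsilon>" "\<epsilon> \<le> 1" using that \<epsilon>1 by (auto simp: \<epsilon>3_def)
    have e2: "2 * B * \<epsilon> \<le> 1"
    proof -
      have "\<epsilon> \<le> 1 / (2 * B)" using that by (auto simp: \<epsilon>3_def)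
      then show ?thesis using B by (simp add: field_simps)
    qed
    have e3: "E0 / 2 + \<epsilon> * c < 0"
    proof -
      have "\<epsilon> < - E0 / (2 * (c + 1))" using that by (auto simp: \<epsilon>3_def)
      then have "\<epsilon> * (2 * (c + 1)) < - E0" using pos_less_divide_eq[of "2 * (c + 1)" \<epsilon> "- E0"] \<open>c \<ge> 0\<close> by auto
      then show ?thesis using e(2) by (simp add: algebra_simps)
    qed
    have T1: "(LINT y:?C|lborel. (\<Sum>i\<in>UNIV. M$i * wpd h (\<lambda>z. \<Theta> \<epsilon> z $ j) i y)\<^sup>2) \<le> \<epsilon>\<^sup>2 * (W j + \<epsilon> * (3 * B\<^sup>2 * vol))" for j
    proof -
      have "(LINT y:?C|lborel. (\<Sum>i\<in>UNIV. M$i * wpd h (\<lambda>z. \<Theta> \<epsilon> z $ j) i y)\<^sup>2) = (LINT y:?C|lborel. (dird M (\<lambda>z. \<Theta> \<epsilon> z $ j) y)\<^sup>2)"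
        by (rule set_integral_wpd_smooth[OF Theta_smooth[OF e(1)]])
      also have "\<dots> \<le> (LINT y:?C|lborel. \<epsilon>\<^sup>2 * ((dird M (\<lambda>x. w x $ j) y)\<^sup>2 + 3 * \<epsilon> * B\<^sup>2))"
      proof (rule set_integral_mono)
        show "set_integrable lborel ?C (\<lambda>y. (dird M (\<lambda>z. \<Theta> \<epsilon> z $ j) y)\<^sup>2)"
          by (intro cell_integrable_continuous continuous_on_power sd Theta_smooth e)
        show "set_integrable lborel ?C (\<lambda>y. \<epsilon>\<^sup>2 * ((dird M (\<lambda>x. w x $ j) y)\<^sup>2 + 3 * \<epsilon> * B\<^sup>2))"
          by (intro cell_integrable_continuous continuous_on_mult continuous_on_add continuous_on_power continuous_on_const sd w_smooth)
        fix y
        have "(dird M (\<lambda>x. w x $ j) y + \<epsilon> * dird M (\<lambda>x. v \<epsilon> x $ j) y)\<^sup>2 \<le> (dird M (\<lambda>x. w x $ j) y)\<^sup>2 + 3 * \<epsilon> * B\<^sup>2"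
          using square_perturbation[of "dird M (\<lambda>x. w x $ j) y" B "dird M (\<lambda>x. v \<epsilon> x $ j) y" \<epsilon>] b[OF e(1), of y j] e by auto
        then show "(dird M (\<lambda>z. \<Theta> \<epsilon> z $ j) y)\<^sup>2 \<le> \<epsilon>\<^sup>2 * ((dird M (\<lambda>x. w x $ j) y)\<^sup>2 + 3 * \<epsilon> * B\<^sup>2)"
          unfolding dird_Theta[OF e(1)] power_mult_distrib by (intro mult_left_mono) auto
      qed
      also have "\<dots> = \<epsilon>\<^sup>2 * (W j + vol * (3 * \<epsilon> * B\<^sup>2))"
      proof -
        have i: "set_integrable lborel ?C (\<lambda>y. (dird M (\<lambda>x. w x $ j) y)\<^sup>2)"
          by (intro cell_integrable_continuous continuous_on_power sd w_smooth)
        show ?thesis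
          unfolding W_def vol_def cell_integral_const[symmetric]
          by (subst set_integral_add(2)[OF i cell_integrable_const, symmetric]) simp
      qed
      finally show ?thesis by (simp add: algebra_simps)
    qed
    have T2: "\<epsilon>\<^sup>2 * (J - \<epsilon> * (R * (3 * B\<^sup>2) * vol)) \<le> (LINT y:?C|lborel. deriv \<rho> (y $ 3) * (\<Theta> \<epsilon> y $ 3)\<^sup>2)"
    proof -
      have i: "set_integrable lborel ?C (\<lambda>y. deriv \<rho> (y $ 3) * (w y $ 3)\<^sup>2)"
        by (intro cell_integrable_continuous continuous_on_mult continuous_on_power crho cw)
      have "\<epsilon>\<^sup>2 * (J - vol * (R * (3 * \<epsilon> * B\<^sup>2))) = (LINT y:?C|lborel. \<epsilon>\<^sup>2 * (deriv \<rho> (y $ 3) * (w y $ 3)\<^sup>2 - R * (3 * \<epsilon> * B\<^sup>2)))"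
        unfolding J_def vol_def cell_integral_const[symmetric]
        by (subst set_integral_diff(2)[OF i cell_integrable_const, symmetric]) simp
      also have "\<dots> \<le> (LINT y:?C|lborel. deriv \<rho> (y $ 3) * (\<Theta> \<epsilon> y $ 3)\<^sup>2)"
      proof (rule set_integral_mono)
        show "set_integrable lborel ?C (\<lambda>y. \<epsilon>\<^sup>2 * (deriv \<rho> (y $ 3) * (w y $ 3)\<^sup>2 - R * (3 * \<epsilon> * B\<^sup>2)))"
          by (intro cell_integrable_continuous continuous_on_mult continuous_on_diff continuous_on_power continuous_on_const crho cw)
        show "set_integrable lborel ?C (\<lambda>y. deriv \<rho> (y $ 3) * (\<Theta> \<epsilon> y $ 3)\<^sup>2)"
          by (intro cell_integrable_continuous continuous_on_mult continuous_on_power crho smooth_continuous Theta_smooth e)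
        fix y assume y: "y \<in> ?C"
        let ?D = "(w y $ 3 + \<epsilon> * v \<epsilon> y $ 3)\<^sup>2 - (w y $ 3)\<^sup>2"
        have "\<bar>deriv \<rho> (y $ 3)\<bar> * \<bar>?D\<bar> \<le> R * (3 * \<epsilon> * B\<^sup>2)"
          using y R(1) b[OF e(1), of y 3] e by (intro mult_mono R(2) square_perturbation) (auto simp: cell_def)
        then have "- (R * (3 * \<epsilon> * B\<^sup>2)) \<le> deriv \<rho> (y $ 3) * ?D" unfolding abs_mult[symmetric] by linarith
        then have "deriv \<rho> (y $ 3) * (w y $ 3)\<^sup>2 - R * (3 * \<epsilon> * B\<^sup>2) \<le> deriv \<rho> (y $ 3) * (w y $ 3 + \<epsilon> * v \<epsilon> y $ 3)\<^sup>2"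
          unfolding right_diff_distrib by linarith
        then have "\<epsilon>\<^sup>2 * (deriv \<rho> (y $ 3) * (w y $ 3)\<^sup>2 - R * (3 * \<epsilon> * B\<^sup>2)) \<le> \<epsilon>\<^sup>2 * (deriv \<rho> (y $ 3) * (w y $ 3 + \<epsilon> * v \<epsilon> y $ 3)\<^sup>2)"
          by (intro mult_left_mono) auto
        moreover have "\<Theta> \<epsilon> y $ 3 = \<epsilon> * (w y $ 3 + \<epsilon> * v \<epsilon> y $ 3)" by (simp add: \<Theta>_def power2_eq_square algebra_simps)
        ultimately show "\<epsilon>\<^sup>2 * (deriv \<rho> (y $ 3) * (w y $ 3)\<^sup>2 - R * (3 * \<epsilon> * B\<^sup>2)) \<le> deriv \<rho> (y $ 3) * (\<Theta> \<epsilon> y $ 3)\<^sup>2"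
          by (simp add: power_mult_distrib mult.left_commute)
      qed
      finally show ?thesis by (simp add: algebra_simps)
    qed
    have T3: "\<bar>LINT y:?C|lborel. (LBINT \<tau> = ereal 0..ereal (\<Theta> \<epsilon> y $ 3). NN g \<rho> \<tau> (y$3))\<bar> \<le> \<epsilon>\<^sup>2 * (\<epsilon> * (8 * g * K * B ^ 3 * vol))"
    proof -
      have "\<bar>LINT y:?C|lborel. (LBINT \<tau> = ereal 0..ereal (\<Theta> \<epsilon> y $ 3). NN g \<rho> \<tau> (y$3))\<bar> \<le> (LINT y:?C|lborel. g * K * (2 * B * \<epsilon>) ^ 3)"
      proof (rule set_integral_abs_bound[OF cell_integrable_const])
        have "\<bar>LBINT \<tau> = ereal 0..ereal (\<Theta> \<epsilon> y $ 3). NN g \<rho> \<tau> (y$3)\<bar> \<le> g * K * (2 * B * \<epsilon>) ^ 3" if y: "y \<in> ?C" for y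
        proof -
          have eq: "\<Theta> \<epsilon> y $ 3 = \<epsilon> * (w y $ 3 + \<epsilon> * v \<epsilon> y $ 3)" by (simp add: \<Theta>_def power2_eq_square algebra_simps)
          have "\<bar>\<epsilon> * v \<epsilon> y $ 3\<bar> \<le> 1 * B" unfolding abs_mult using b[OF e(1), of y 3] e by (intro mult_mono) auto
          then have "\<bar>w y $ 3 + \<epsilon> * v \<epsilon> y $ 3\<bar> \<le> 2 * B" using b[OF e(1), of y 3] by linarith
          then have "\<epsilon> * \<bar>w y $ 3 + \<epsilon> * v \<epsilon> y $ 3\<bar> \<le> \<epsilon> * (2 * B)" using e by (intro mult_left_mono) auto
          then have t: "\<bar>\<Theta> \<epsilon> y $ 3\<bar> \<le> 2 * B * \<epsilon>" unfolding eq abs_mult using e by (simp add: mult.commute)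
          have "\<bar>LBINT \<tau> = ereal 0..ereal (\<Theta> \<epsilon> y $ 3). NN g \<rho> \<tau> (y$3)\<bar> \<le> g * K * \<bar>\<Theta> \<epsilon> y $ 3\<bar> ^ 3"
            using t e2 y by (intro NN_integral_bound) (auto simp: cell_def)
          also have "\<dots> \<le> g * K * (2 * B * \<epsilon>) ^ 3"
            using t pos K(1) by (intro mult_left_mono power_mono) auto
          finally show ?thesis .
        qed
        then show "AE y in lborel. y \<in> ?C \<longrightarrow> \<bar>LBINT \<tau> = ereal 0..ereal (\<Theta> \<epsilon> y $ 3). NN g \<rho> \<tau> (y$3)\<bar> \<le> g * K * (2 * B * \<epsilon>) ^ 3" by simp
      qed
      also have "\<dots> = \<epsilon>\<^sup>2 * (\<epsilon> * (8 * g * K * B ^ 3 * vol))"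
        unfolding cell_integral_const vol_def[symmetric] by (simp add: power_mult_distrib power3_eq_cube power2_eq_square)
      finally show ?thesis .
    qed
    have sum: "lam / 2 * (\<Sum>j\<in>UNIV. LINT y:?C|lborel. (\<Sum>i\<in>UNIV. M$i * wpd h (\<lambda>z. \<Theta> \<epsilon> z $ j) i y)\<^sup>2)
       \<le> lam / 2 * (\<Sum>j\<in>UNIV. \<epsilon>\<^sup>2 * (W j + \<epsilon> * (3 * B\<^sup>2 * vol)))"
      using pos by (intro mult_left_mono sum_mono T1) auto
    have "g / 2 * (\<epsilon>\<^sup>2 * (J - \<epsilon> * (R * (3 * B\<^sup>2) * vol))) \<le> g / 2 * (LINT y:?C|lborel. deriv \<rho> (y $ 3) * (\<Theta> \<epsilon> y $ 3)\<^sup>2)"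
      using pos by (intro mult_left_mono T2) auto
    with sum T3 have "deltaN L1 L2 h g lam \<rho> M (\<Theta> \<epsilon>) \<le> lam / 2 * (\<Sum>j\<in>UNIV. \<epsilon>\<^sup>2 * (W j + \<epsilon> * (3 * B\<^sup>2 * vol)))
        - g / 2 * (\<epsilon>\<^sup>2 * (J - \<epsilon> * (R * (3 * B\<^sup>2) * vol))) + \<epsilon>\<^sup>2 * (\<epsilon> * (8 * g * K * B ^ 3 * vol))"
      unfolding deltaN_def by linarith
    also have "\<dots> = \<epsilon>\<^sup>2 * (E0 / 2 + \<epsilon> * c)"
      by (simp add: E0_def c_def sum_3 field_simps)
    also have "\<dots> < 0" using e(2) e3 by (intro mult_pos_neg) auto
    finally show ?thesis .
  qed
  ultimately show ?thesis by (intro exI[of _ \<epsilon>3]) (auto simp: \<epsilon>3_def)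
qed

text \<open>The field may depend on k, so the amplitude can be fitted to the corrector's norm in
  this particular space.\<close>

lemma instability:
  assumes M: "\<bar>M $ 3\<bar> < mN L1 L2 h g lam \<rho>"
  shows "\<exists>w. Csigma L1 L2 h w \<and>
    (\<exists>\<epsilon>0\<in>{0<..<1}. \<forall>\<epsilon>\<in>{0<..<\<epsilon>0}. \<exists>vpr.
       Hk_vec L1 L2 h k vpr \<and> Hk_norm L1 L2 h k vpr \<le> 1 \<and>
       Hk1_0star L1 L2 h k (\<lambda>y. \<epsilon> *\<^sub>R w y + \<epsilon>\<^sup>2 *\<^sub>R vpr y) \<and>
       deltaN L1 L2 h g lam \<rho> M (\<lambda>y. \<epsilon> *\<^sub>R w y + \<epsilon>\<^sup>2 *\<^sub>R vpr y) < 0)"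
proof -
  obtain \<Psi> \<xi> \<epsilon>1 where bf: "bump_flow L1 L2 h \<Psi> \<xi> \<epsilon>1" and neg:
    "lam * (\<Sum>j\<in>UNIV. LINT x:cell L1 L2 h|lborel. (dird M (\<lambda>x. bump_flow.w \<Psi> \<xi> x $ j) x)\<^sup>2) <
     g * (LINT x:cell L1 L2 h|lborel. deriv \<rho> (x $ 3) * (bump_flow.w \<Psi> \<xi> x $ 3)\<^sup>2)"
    using unstable_mode[OF M] by blast
  interpret bump_flow L1 L2 h \<Psi> \<xi> \<epsilon>1 by (rule bf)
  obtain \<epsilon>2 where e2: "0 < \<epsilon>2" "\<epsilon>2 \<le> \<epsilon>1" "\<And>\<epsilon> k. \<epsilon> \<in> {0<..<\<epsilon>2} \<Longrightarrow> Hk1_0star L1 L2 h k (\<Theta> \<epsilon>)"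
    using Hk1_0star_Theta by blast
  obtain \<epsilon>3 where e3: "0 < \<epsilon>3" "\<epsilon>3 \<le> \<epsilon>1" "\<And>\<epsilon>. \<epsilon> \<in> {0<..<\<epsilon>3} \<Longrightarrow> deltaN L1 L2 h g lam \<rho> M (\<Theta> \<epsilon>) < 0"
    using energy_negative[OF bf neg] by blast
  obtain B where B: "\<And>\<epsilon>. \<epsilon> \<in> I \<Longrightarrow> Hk_norm L1 L2 h k (v \<epsilon>) \<le> B" using Hk_norm_v_bounded by blast
  \<comment> \<open>Then a B \<le> 1, and a \<le> 1 gives a^2 B \<le> 1 as well.\<close>
  define a where "a = 1 / (\<bar>B\<bar> + 1)"
  have a: "0 < a" "a \<le> 1" by (auto simp: a_def field_simps)
  have aB: "a\<^sup>2 * B \<le> 1"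
  proof -
    have "a * B \<le> a * (\<bar>B\<bar> + 1)" using a by (intro mult_left_mono) auto
    also have "\<dots> = 1" by (simp add: a_def)
    finally have "a * (a * B) \<le> a * 1" using a by (intro mult_left_mono) auto
    then show ?thesis using a(2) unfolding power2_eq_square mult.assoc by linarith
  qed
  define \<epsilon>0 where "\<epsilon>0 = min (1 / 2) (min \<epsilon>2 \<epsilon>3)"
  have "\<epsilon>0 \<in> {0<..<1}" using e2 e3 by (auto simp: \<epsilon>0_def)
  moreover have "\<exists>vpr. Hk_vec L1 L2 h k vpr \<and> Hk_norm L1 L2 h k vpr \<le> 1 \<and>
       Hk1_0star L1 L2 h k (\<lambda>y. \<epsilon> *\<^sub>R (a *\<^sub>R w y) + \<epsilon>\<^sup>2 *\<^sub>R vpr y) \<and>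
       deltaN L1 L2 h g lam \<rho> M (\<lambda>y. \<epsilon> *\<^sub>R (a *\<^sub>R w y) + \<epsilon>\<^sup>2 *\<^sub>R vpr y) < 0" if "\<epsilon> \<in> {0<..<\<epsilon>0}" for \<epsilon>
  proof (intro exI[of _ "\<lambda>y. a\<^sup>2 *\<^sub>R v (a * \<epsilon>) y"] conjI)
    have le: "a * \<epsilon> \<le> \<epsilon>" using a that mult_right_mono[of a 1 \<epsilon>] by auto
    have "0 < a * \<epsilon>" "\<epsilon> < \<epsilon>2" "\<epsilon> < \<epsilon>3" using that a by (auto simp: \<epsilon>0_def)
    then have ae: "a * \<epsilon> \<in> {0<..<\<epsilon>2}" "a * \<epsilon> \<in> {0<..<\<epsilon>3}" "a * \<epsilon> \<in> I"
      using le e2(2) by (auto simp del: mult_le_cancel_right2)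
    \<comment> \<open>The field a w run with parameter \<epsilon> is the field w run with parameter
      a \<epsilon>, so membership and negativity are inherited from the smaller parameter.\<close>
    have eq: "(\<lambda>y. \<epsilon> *\<^sub>R (a *\<^sub>R w y) + \<epsilon>\<^sup>2 *\<^sub>R (a\<^sup>2 *\<^sub>R v (a * \<epsilon>) y)) = \<Theta> (a * \<epsilon>)"
      by (simp add: \<Theta>_def fun_eq_iff power_mult_distrib mult.commute)
    show "Hk1_0star L1 L2 h k (\<lambda>y. \<epsilon> *\<^sub>R (a *\<^sub>R w y) + \<epsilon>\<^sup>2 *\<^sub>R (a\<^sup>2 *\<^sub>R v (a * \<epsilon>) y))"
      unfolding eq by (rule e2(3)[OF ae(1)])
    show "deltaN L1 L2 h g lam \<rho> M (\<lambda>y. \<epsilon> *\<^sub>R (a *\<^sub>R w y) + \<epsilon>\<^sup>2 *\<^sub>R (a\<^sup>2 *\<^sub>R v (a * \<epsilon>) y)) < 0"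
      unfolding eq by (rule e3(3)[OF ae(2)])
    have s: "smooth (\<lambda>x. v (a * \<epsilon>) x $ j)" for j by (rule v_smooth[OF ae(3)])
    have "periodic L1 L2 (\<lambda>x. a\<^sup>2 * v (a * \<epsilon>) x $ j)" for j using periodic_v[of "a * \<epsilon>"] by (simp add: periodic_def)
    then show "Hk_vec L1 L2 h k (\<lambda>y. a\<^sup>2 *\<^sub>R v (a * \<epsilon>) y)"
      unfolding Hk_vec_def using s by (auto intro!: Hk_smooth smooth_cmult)
    have "a\<^sup>2 * Hk_norm L1 L2 h k (v (a * \<epsilon>)) \<le> a\<^sup>2 * B" using B[OF ae(3)] by (intro mult_left_mono) auto
    then show "Hk_norm L1 L2 h k (\<lambda>y. a\<^sup>2 *\<^sub>R v (a * \<epsilon>) y) \<le> 1"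
      unfolding Hk_norm_scaleR[OF s] using aB by simp
  qed
  ultimately show ?thesis
    using Csigma_scaleR[OF Csigma_w, of a] by (intro exI[of _ "\<lambda>x. a *\<^sub>R w x"]) blast
qed

end

theorem theorem3p1:
  fixes L1 L2 h :: real
  assumes "0 < L1" and "0 < L2" and "0 < h"
  shows "\<exists>C::nat \<Rightarrow> real \<Rightarrow> real. (\<forall>k a. 0 < C k a) \<and>
    (\<forall>g lam (\<rho>::real \<Rightarrow> real) (M::real^3).
      0 < g \<longrightarrow> 0 < lam \<longrightarrow>
      (\<forall>x. (\<rho> has_real_derivative deriv \<rho> x) (at x)) \<longrightarrow>
      (\<forall>x. (deriv \<rho> has_real_derivative deriv (deriv \<rho>) x) (at x)) \<longrightarrow>
      continuous_on UNIV (deriv (deriv \<rho>)) \<longrightarrow>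
      (\<exists>x0\<in>{0<..<h}. 0 < deriv \<rho> x0) \<longrightarrow>
      M \<noteq> 0 \<longrightarrow>
      ((\<bar>M$3\<bar> < mN L1 L2 h g lam \<rho> \<longrightarrow>
         (\<forall>k\<ge>3. \<exists>w. Csigma L1 L2 h w \<and>
            (\<exists>\<epsilon>0\<in>{0<..<1}. \<forall>\<epsilon>\<in>{0<..<\<epsilon>0}. \<exists>vpr.
               Hk_vec L1 L2 h k vpr \<and> Hk_norm L1 L2 h k vpr \<le> C k (Hk_norm L1 L2 h k w) \<and>
               Hk1_0star L1 L2 h k (\<lambda>y. \<epsilon> *\<^sub>R w y + \<epsilon>\<^sup>2 *\<^sub>R vpr y) \<and>
               deltaN L1 L2 h g lam \<rho> M (\<lambda>y. \<epsilon> *\<^sub>R w y + \<epsilon>\<^sup>2 *\<^sub>R vpr y) < 0))) \<and>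
       (\<bar>M$3\<bar> > mN L1 L2 h g lam \<rho> \<longrightarrow>
         (\<exists>\<epsilon>>0. \<forall>vp. H10_vec L1 L2 h vp \<and> nontrivial L1 L2 h vp \<and>
            (AE y in lborel. y \<in> cell L1 L2 h \<longrightarrow> norm (vp y) \<le> \<epsilon>) \<longrightarrow>
            deltaN L1 L2 h g lam \<rho> M vp > 0))))"
proof (intro exI[of _ "\<lambda>k a. 1"] conjI allI impI)
  fix g lam :: real and \<rho> :: "real \<Rightarrow> real" and M :: "real^3"
  assume "0 < g" "0 < lam" "\<forall>x. (\<rho> has_real_derivative deriv \<rho> x) (at x)"
    "\<forall>x. (deriv \<rho> has_real_derivative deriv (deriv \<rho>) x) (at x)"
    "continuous_on UNIV (deriv (deriv \<rho>))" "\<exists>x0\<in>{0<..<h}. 0 < deriv \<rho> x0"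
  then interpret profile L1 L2 h g lam \<rho> using assms by unfold_locales auto
  {
    fix k :: nat
    assume "\<bar>M$3\<bar> < mN L1 L2 h g lam \<rho>"
    then show "\<exists>w. Csigma L1 L2 h w \<and>
      (\<exists>\<epsilon>0\<in>{0<..<1}. \<forall>\<epsilon>\<in>{0<..<\<epsilon>0}. \<exists>vpr.
         Hk_vec L1 L2 h k vpr \<and> Hk_norm L1 L2 h k vpr \<le> 1 \<and>
         Hk1_0star L1 L2 h k (\<lambda>y. \<epsilon> *\<^sub>R w y + \<epsilon>\<^sup>2 *\<^sub>R vpr y) \<and>
         deltaN L1 L2 h g lam \<rho> M (\<lambda>y. \<epsilon> *\<^sub>R w y + \<epsilon>\<^sup>2 *\<^sub>R vpr y) < 0)"
      by (rule instability)
  next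
    assume "mN L1 L2 h g lam \<rho> < \<bar>M$3\<bar>"
    then show "\<exists>\<epsilon>>0. \<forall>vp. H10_vec L1 L2 h vp \<and> nontrivial L1 L2 h vp \<and>
      (AE y in lborel. y \<in> cell L1 L2 h \<longrightarrow> norm (vp y) \<le> \<epsilon>) \<longrightarrow> deltaN L1 L2 h g lam \<rho> M vp > 0"
      by (rule stability)
  }
qed simp

end
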